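(* Let $m,n\ge1$ and let $\lhd$ be an admissible order. The spinor representation $V_q(m,n)^{\lhd}$ of $\mathrm{U}_q(\mathfrak{osp}(2m+1|2n),\Pi^{\lhd})$ is irreducible, with highest weight vector $|0\rangle$ of weight $$\big(-(-1)^{[\Phi_2]},-(-1)^{[\Phi_3]},\dots,-(-1)^{[\Phi_{m+n}]},\sqrt{-1}\,q^{1/2}\big).$$
   Context: $q$ is an indeterminate over $\mathbb{C}$; all algebras and vector spaces are over $\mathbb{C}(q^{1/2})$; $\sqrt{-1}\in\mathbb{C}$ is the imaginary unit. For a superalgebra, $[x]\in\mathbb{Z}_2$ denotes the parity of a homogeneous element $x$. **Root data.** Let $\mathcal E_{m|n}$ be the real vector space with basis $\varepsilon_1,\dots,\varepsilon_m,\delta_1,\dots,\delta_n$ and symmetric bilinear form $(\varepsilon_i,\varepsilon_j)=-\delta_{ij}$, $(\delta_\mu,\delta_\nu)=\delta_{\mu\nu}$, $(\varepsilon_i,\delta_\mu)=0$. An admissible order $\lhd$ is a total order on this basis with $\varepsilon_i\lhd\varepsilon_{i+1}$ and $\delta_\mu\lhd\delta_{\mu+1}$ for all $i,\mu$. Write the ordered basis as $\mathcal E_1\lhd\mathcal E_2\lhd\cdots\lhd\mathcal E_{m+n}$. The simple roots are $\Pi^\lhd=\{\alpha_1,\dots,\alpha_{m+n}\}$ with $\alpha_i=\mathcal E_i-\mathcal E_{i+1}$ for $1\le i\le m+n-1$ and $\alpha_{m+n}=\mathcal E_{m+n}$. Let $\Theta$ be the set of indices of odd simple roots: for $i<m+n$,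 $i\in\Theta$ iff exactly one of $\mathcal E_i,\mathcal E_{i+1}$ is a $\delta_\mu$; and $m+n\in\Theta$ iff $\mathcal E_{m+n}=\delta_n$. Set $a_{ij}=2(\alpha_i,\alpha_j)/(\alpha_i,\alpha_i)$ and $d_i=(\alpha_i,\alpha_i)/2$ if $(\alpha_i,\alpha_i)\ne0$; $a_{ij}=-(\alpha_i,\alpha_j)$ and $d_i=-1$ if $(\alpha_i,\alpha_i)=0$. Let $q_i=q^{d_i}$. **$q$-numbers.** $[k]_{p}=\frac{p^k-p^{-k}}{p-p^{-1}}$, $\{k\}_p=\frac{p^k-(-p)^{-k}}{p+p^{-1}}$, $[N]_p!=\prod_{i=1}^N[i]_p$, $\{N\}_p!=\prod_{i=1}^N\{i\}_p$, $[0]_p!=\{0\}_p!=1$, $\begin{bmatrix}N\\k\end{bmatrix}_p=\frac{[N]_p!}{[N-k]_p![k]_p!}$, $\left\{\begin{matrix}N\\k\end{matrix}\right\}_p=\frac{\{N\}_p!}{\{N-k\}_p!\{k\}_p!}$. **The quantum supergroup $\mathrm{U}_q(\mathfrak{osp}(2m+1|2n),\Pi^\lhd)$** is the associative superalgebra generated by $e_i,f_i,k_i^{\pm1}$ ($1\le i\le m+n$), with $e_s,f_s$ odd for $s\in\Theta$ and all other generators even, subject to: (R1) $k_ik_i^{-1}=k_i^{-1}k_i=1$, $k_ik_j=k_jk_i$; $k_ie_jk_i^{-1}=q_i^{a_{ij}}e_j$, $k_if_jk_i^{-1}=q_i^{-a_{ij}}f_j$; $e_if_j-(-1)^{[e_i][f_j]}f_je_i=\delta_{ij}\frac{k_i-k_i^{-1}}{q-q^{-1}}$.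 (R2) If $i\notin\Theta$, then for all $j\ne i$: $\sum_{k=0}^{1-a_{ij}}(-1)^k\begin{bmatrix}1-a_{ij}\\k\end{bmatrix}_{q_i}e_i^ke_je_i^{1-a_{ij}-k}=0$, and the same with all $e$'s replaced by $f$'s. If $s\in\Theta$ and $a_{ss}=2$, then for all $j\ne s$: $\sum_{k=0}^{1-a_{sj}}(-1)^{\frac12k(k+1)+k[e_j]}\left\{\begin{matrix}1-a_{sj}\\k\end{matrix}\right\}_{q_s}e_s^ke_je_s^{1-a_{sj}-k}=0$, and the same with all $e$'s replaced by $f$'s. If $a_{ss}=0$, then $e_s^2=f_s^2=0$. (R3) Higher order Serre relations. Put $$e_{i;s;j}=e_i\big(e_se_j-(-1)^{[e_j]}q_j^{a_{js}}e_je_s\big)-(-1)^{[e_i](1+[e_j])}q_i^{a_{is}+a_{ij}}\big(e_se_j-(-1)^{[e_j]}q_j^{a_{js}}e_je_s\big)e_i,$$ and define $f_{i;s;j}$ by the same formula with all $e$'s replaced by $f$'s. (a) If $1<s<m+n-1$, $a_{ss}=0$ (i.e. $\alpha_s$ is isotropic odd) and $a_{s-1,s}=-a_{s,s+1}$, then $e_se_{s-1;s;s+1}+(-1)^{[e_{s-1}]+[e_{s+1}]}e_{s-1;s;s+1}e_s=0$. (b) If $s=m+n-1>1$, $a_{ss}=0$ and $\alpha_{m+n}=\varepsilon_m$, then $e_se_{s-1;s;s+1}+(-1)^{[e_{s-1}]}e_{s-1;s;s+1}e_s=0$. (c) If $s=m+n-1>1$, $a_{ss}=0$ and $\alpha_{m+n}=\delta_n$,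 then $e_se_{s-1;s;s+1}-(-1)^{[e_{s-1}]}e_{s-1;s;s+1}e_s=0$. In each of (a), (b), (c) the same relation with all $e$'s replaced by $f$'s is also imposed. **The deformed Clifford superalgebra $\mathrm{Cl}_q(m,n)^\lhd$** is the associative superalgebra generated by $\Phi_i,\Phi_i^\dagger,\mathfrak U_i^{\pm1}$ ($1\le i\le m+n$), where $\mathfrak U_i^{\pm1}$ are even, and $\Phi_i,\Phi_i^\dagger$ are even if $\mathcal E_i\in\{\varepsilon_1,\dots,\varepsilon_m\}$ and odd if $\mathcal E_i\in\{\delta_1,\dots,\delta_n\}$, subject to - $\mathfrak U_i\mathfrak U_j=\mathfrak U_j\mathfrak U_i$, $\mathfrak U_i\mathfrak U_i^{-1}=\mathfrak U_i^{-1}\mathfrak U_i=1$; - $\mathfrak U_i\Phi_j\mathfrak U_i^{-1}=q^{-(-1)^{[\Phi_j]}\delta_{ij}}\Phi_j$, $\mathfrak U_i\Phi_j^\dagger\mathfrak U_i^{-1}=q^{(-1)^{[\Phi_j]}\delta_{ij}}\Phi_j^\dagger$; - $\Phi_i\Phi_j-(-1)^{[\Phi_i][\Phi_j]}\Phi_j\Phi_i=\Phi_i^\dagger\Phi_j^\dagger-(-1)^{[\Phi_i^\dagger][\Phi_j^\dagger]}\Phi_j^\dagger\Phi_i^\dagger=0$; - $\Phi_i\Phi_j^\dagger-(-1)^{[\Phi_i][\Phi_j^\dagger]}\Phi_j^\dagger\Phi_i=0$ for $i\ne j$; - $\Phi_i\Phi_i^\dagger-(-1)^{[\Phi_i]}q\Phi_i^\dagger\Phi_i=\mathfrak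 U_i^{-1}$, $\Phi_i\Phi_i^\dagger-(-1)^{[\Phi_i]}q^{-1}\Phi_i^\dagger\Phi_i=\mathfrak U_i$. **Fock space.** $V_q(m,n)^\lhd$ is the $\mathrm{Cl}_q(m,n)^\lhd$-module with basis $|\mathbf t\rangle=(\Phi_1^\dagger)^{t_1}(\Phi_2^\dagger)^{t_2}\cdots(\Phi_{m+n}^\dagger)^{t_{m+n}}|0\rangle$, where $\mathbf t=(t_1,\dots,t_{m+n})$ with $t_i\in\mathbb{Z}_{\ge0}$ if $[\Phi_i^\dagger]=\bar0$ and $t_i\in\{0,1\}$ if $[\Phi_i^\dagger]=\bar1$, and the vacuum vector $|0\rangle$ satisfies $\Phi_i|0\rangle=0$, $\mathfrak U_i|0\rangle=|0\rangle$ for all $i$; the action is determined by these conditions and the defining relations of $\mathrm{Cl}_q(m,n)^\lhd$. **Spinor representation.** $V_q(m,n)^\lhd$ is made into a $\mathrm{U}_q(\mathfrak{osp}(2m+1|2n),\Pi^\lhd)$-module through the algebra homomorphism $\pi^\lhd$ to $\mathrm{Cl}_q(m,n)^\lhd$ with $e_i\mapsto\Phi_i\Phi_{i+1}^\dagger$, $f_i\mapsto\Phi_{i+1}\Phi_i^\dagger$, $k_i\mapsto-(-1)^{[\Phi_{i+1}]}\mathfrak U_i\mathfrak U_{i+1}^{-1}$ for $1\le i\le m+n-1$, and $e_{m+n}\mapsto\sqrt{-1}(q^{1/2}-q^{-1/2})^{-1}\Phi_{m+n}$, $f_{m+n}\mapsto\Phi_{m+n}^\dagger$, $k_{m+n}\mapsto\sqrt{-1}q^{1/2}\mathfrak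 U_{m+n}$. A highest weight vector of weight $(\lambda_1,\dots,\lambda_{m+n})$ is a nonzero vector $w$ with $e_iw=0$ and $k_iw=\lambda_iw$ for all $i$. *)

theory Defs
  imports
    Complex_Main
    "HOL-Library.Poly_Mapping"
    "HOL-Computational_Algebra.Polynomial"
    "HOL-Computational_Algebra.Fraction_Field"
    "HOL-Algebra.Module"
    "HOL-Algebra.QuotRing"
begin

section \<open>The ground field\<close>

text \<open>The field of rational functions over the complex numbers in the indeterminate
  \<open>q\<^sup>1\<^sup>/\<^sup>2\<close>.\<close>

type_synonym kq = "complex poly fract"

definition q_half :: kq where "q_half = Fract [:0, 1:] 1"

definition qq :: kq where "qq = q_half ^ 2"

definition im_unit :: kq where "im_unit = Fract [:\<i>:] 1"

section \<open>Quantum integers\<close>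

definition qnum :: "kq \<Rightarrow> nat \<Rightarrow> kq" where
  "qnum p k = (p ^ k - inverse p ^ k) / (p - inverse p)"

definition qnum' :: "kq \<Rightarrow> nat \<Rightarrow> kq" where
  "qnum' p k = (p ^ k - inverse (- p) ^ k) / (p + inverse p)"

definition qfact :: "kq \<Rightarrow> nat \<Rightarrow> kq" where
  "qfact p N = (\<Prod>i=1..N. qnum p i)"

definition qfact' :: "kq \<Rightarrow> nat \<Rightarrow> kq" where
  "qfact' p N = (\<Prod>i=1..N. qnum' p i)"

definition qbinom :: "kq \<Rightarrow> nat \<Rightarrow> nat \<Rightarrow> kq" where
  "qbinom p N k = qfact p N / (qfact p (N - k) * qfact p k)"

definition qbinom' :: "kq \<Rightarrow> nat \<Rightarrow> nat \<Rightarrow> kq" where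
  "qbinom' p N k = qfact' p N / (qfact' p (N - k) * qfact' p k)"

section \<open>Associative algebras given by generators and relations\<close>

text \<open>A \<open>kq\<close>-algebra is a ring record with a scalar multiplication; the record type
  is the one of the library locale \<open>algebra\<close>, which itself is restricted to commutative
  algebras.\<close>

type_synonym 'a kalg = "(kq, 'a) module"

definition alg_hom :: "'a kalg \<Rightarrow> 'b kalg \<Rightarrow> ('a \<Rightarrow> 'b) set" where
  "alg_hom A B = {h \<in> ring_hom A B.
     \<forall>c. \<forall>x\<in>carrier A. h (c \<odot>\<^bsub>A\<^esub> x) = c \<odot>\<^bsub>B\<^esub> h x}"

text \<open>Words form a monoid under concatenation, so that the product which
  \<open>Poly_Mapping\<close> puts on finitely supported functions on words is that of the free
  algebra.\<close>

instantiation list :: (type) monoid_add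
begin

definition zero_list :: "'a list" where "zero_list = []"

definition plus_list :: "'a list \<Rightarrow> 'a list \<Rightarrow> 'a list" where "plus_list xs ys = xs @ ys"

instance
  by standard (simp_all add: zero_list_def plus_list_def)

end

type_synonym 'g free = "'g list \<Rightarrow>\<^sub>0 kq"

definition gen :: "'g \<Rightarrow> 'g free" where
  "gen g = Poly_Mapping.single [g] 1"

definition scal :: "kq \<Rightarrow> 'g free \<Rightarrow> 'g free" (infixr \<open>*\<^sub>k\<close> 75) where
  "c *\<^sub>k x = Poly_Mapping.single [] c * x"

text \<open>The type \<open>'g\<close> may contain more generators than wanted, so the set \<open>G\<close> of
  generators is given explicitly.\<close>

definition free_alg :: "'g set \<Rightarrow> 'g free kalg" where
  "free_alg G =
     \<lparr>carrier = {x. \<forall>w\<in>Poly_Mapping.keys x. set w \<subseteq> G},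
      mult = (*), one = 1, zero = 0, add = (+), smult = (*\<^sub>k)\<rparr>"

text \<open>The algebra presented by generators \<open>G\<close> and relators \<open>R\<close> is the quotient of
  the free algebra by the two-sided ideal generated by \<open>R\<close>, and \<open>cls\<close> is the quotient
  map.\<close>

definition rel_ideal :: "'g set \<Rightarrow> 'g free set \<Rightarrow> 'g free set" where
  "rel_ideal G R = Idl\<^bsub>free_alg G\<^esub> R"

definition cls :: "'g set \<Rightarrow> 'g free set \<Rightarrow> 'g free \<Rightarrow> 'g free set" where
  "cls G R x = rel_ideal G R +>\<^bsub>free_alg G\<^esub> x"

definition pres_alg :: "'g set \<Rightarrow> 'g free set \<Rightarrow> 'g free set kalg" where
  "pres_alg G R = (let Q = free_alg G Quot rel_ideal G R in
     \<lparr>carrier = carrier Q, mult = mult Q, one = one Q, zero = zero Q, add = add Q,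
      smult = (\<lambda>c X. cls G R (c *\<^sub>k 1) \<otimes>\<^bsub>Q\<^esub> X)\<rparr>)"

text \<open>The homomorphism of free algebras determined by its values on the generators.\<close>

definition free_ext :: "('g \<Rightarrow> 'h free) \<Rightarrow> 'g free \<Rightarrow> 'h free" where
  "free_ext h x =
     (\<Sum>w\<in>Poly_Mapping.keys x. Poly_Mapping.lookup x w *\<^sub>k prod_list (map h w))"

text \<open>The map between presented algebras sending (the class of) each generator \<open>g\<close> to
  the class of \<open>h g\<close>; it is well defined if and only if \<open>free_ext h\<close> maps the relators
  of the source into the ideal of the target.\<close>

definition pres_hom ::
  "'h set \<Rightarrow> 'h free set \<Rightarrow> ('g \<Rightarrow> 'h free) \<Rightarrow> 'g free set \<Rightarrow> 'h free set" where
  "pres_hom G' R' h X = the_elem ((\<lambda>x. cls G' R' (free_ext h x)) ` X)"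

section \<open>Modules over algebras\<close>

definition End_alg :: "(kq \<Rightarrow> 'v \<Rightarrow> 'v) \<Rightarrow> ('v::ab_group_add \<Rightarrow> 'v) kalg" where
  "End_alg scale =
     \<lparr>carrier = {f. Vector_Spaces.linear scale scale f},
      mult = (\<circ>), one = id, zero = (\<lambda>_. 0), add = (\<lambda>f g v. f v + g v),
      smult = (\<lambda>c f v. scale c (f v))\<rparr>"

definition alg_module ::
  "'a kalg \<Rightarrow> (kq \<Rightarrow> 'v \<Rightarrow> 'v) \<Rightarrow> ('a \<Rightarrow> 'v::ab_group_add \<Rightarrow> 'v) \<Rightarrow> bool" where
  "alg_module A scale \<rho> \<longleftrightarrow> vector_space scale \<and> \<rho> \<in> alg_hom A (End_alg scale)"

definition irreducible_module ::
  "'a kalg \<Rightarrow> (kq \<Rightarrow> 'v \<Rightarrow> 'v) \<Rightarrow> ('a \<Rightarrow> 'v::ab_group_add \<Rightarrow> 'v) \<Rightarrow> bool" where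
  "irreducible_module A scale \<rho> \<longleftrightarrow>
     alg_module A scale \<rho> \<and> (UNIV :: 'v set) \<noteq> {0} \<and>
     (\<forall>W. Modules.module.subspace scale W \<and> (\<forall>x\<in>carrier A. \<forall>w\<in>W. \<rho> x w \<in> W) \<longrightarrow>
        W = {0} \<or> W = UNIV)"

section \<open>Root data\<close>

datatype bvec = Eps nat | Del nat

definition bvecs :: "nat \<Rightarrow> nat \<Rightarrow> bvec set" where
  "bvecs m n = Eps ` {1..m} \<union> Del ` {1..n}"

definition admissible_order :: "nat \<Rightarrow> nat \<Rightarrow> (bvec \<times> bvec) set \<Rightarrow> bool" where
  "admissible_order m n r \<longleftrightarrow>
     r \<subseteq> bvecs m n \<times> bvecs m n \<and> strict_linear_order_on (bvecs m n) r \<and>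
     (\<forall>i. 1 \<le> i \<and> i < m \<longrightarrow> (Eps i, Eps (i + 1)) \<in> r) \<and>
     (\<forall>i. 1 \<le> i \<and> i < n \<longrightarrow> (Del i, Del (i + 1)) \<in> r)"

datatype osp_gen = GE nat | GF nat | GK nat | GKinv nat

datatype cl_gen = GPhi nat | GPhiD nat | GU nat | GUinv nat

context
  fixes m n :: nat and r :: "(bvec \<times> bvec) set"
begin

definition Idx :: "nat set" where "Idx = {1..m + n}"

text \<open>The \<open>i\<close>-th element of the basis in the order \<open>r\<close>, counting from 1.\<close>

definition ob :: "nat \<Rightarrow> bvec" where
  "ob i = (THE b. b \<in> bvecs m n \<and> Suc (card {c \<in> bvecs m n. (c, b) \<in> r}) = i)"

definition bform :: "(bvec \<Rightarrow>\<^sub>0 real) \<Rightarrow> (bvec \<Rightarrow>\<^sub>0 real) \<Rightarrow> real" where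
  "bform x y =
     - (\<Sum>i=1..m. Poly_Mapping.lookup x (Eps i) * Poly_Mapping.lookup y (Eps i))
     + (\<Sum>\<mu>=1..n. Poly_Mapping.lookup x (Del \<mu>) * Poly_Mapping.lookup y (Del \<mu>))"

definition alpha :: "nat \<Rightarrow> bvec \<Rightarrow>\<^sub>0 real" where
  "alpha i =
     (if i < m + n
      then Poly_Mapping.single (ob i) 1 - Poly_Mapping.single (ob (i + 1)) 1
      else Poly_Mapping.single (ob i) 1)"

definition Theta :: "nat set" where
  "Theta = {i \<in> Idx. if i < m + n then (ob i \<in> range Del) \<noteq> (ob (i + 1) \<in> range Del)
                     else ob i = Del n}"

definition cartan :: "nat \<Rightarrow> nat \<Rightarrow> real" where
  "cartan i j =
     (if bform (alpha i) (alpha i) \<noteq> 0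
      then 2 * bform (alpha i) (alpha j) / bform (alpha i) (alpha i)
      else - bform (alpha i) (alpha j))"

definition dd :: "nat \<Rightarrow> real" where
  "dd i = (if bform (alpha i) (alpha i) \<noteq> 0 then bform (alpha i) (alpha i) / 2 else - 1)"

text \<open>The numbers \<open>cartan i j\<close> and \<open>2 * dd i\<close> are integers for indices in \<open>Idx\<close>; here and
  below \<open>floor\<close> only converts them to type \<open>int\<close>.\<close>

definition qi :: "nat \<Rightarrow> kq" where
  "qi i = q_half powi \<lfloor>2 * dd i\<rfloor>"

section \<open>The quantum supergroup\<close>

text \<open>Parities are natural numbers 0 and 1 attached to the generators; they enter the
  defining relations only through signs. Submodules in \<open>irreducible_module\<close> are not
  required to be graded, which gives the stronger notion of irreducibility.\<close>

definition par :: "nat \<Rightarrow> nat" where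
  "par i = (if i \<in> Theta then 1 else 0)"

definition serre :: "kq \<Rightarrow> nat \<Rightarrow> osp_gen free \<Rightarrow> osp_gen free \<Rightarrow> osp_gen free" where
  "serre p N x y = (\<Sum>k=0..N. ((-1) ^ k * qbinom p N k) *\<^sub>k (x ^ k * y * x ^ (N - k)))"

definition serre' ::
  "kq \<Rightarrow> nat \<Rightarrow> nat \<Rightarrow> osp_gen free \<Rightarrow> osp_gen free \<Rightarrow> osp_gen free" where
  "serre' p N t x y =
     (\<Sum>k=0..N. ((-1) ^ (k * (k + 1) div 2 + k * t) * qbinom' p N k) *\<^sub>k
        (x ^ k * y * x ^ (N - k)))"

text \<open>In the following two definitions \<open>g\<close> is to be instantiated by \<open>\<lambda>i. gen (GE i)\<close>
  and \<open>\<lambda>i. gen (GF i)\<close>.\<close>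

definition higher :: "(nat \<Rightarrow> osp_gen free) \<Rightarrow> nat \<Rightarrow> nat \<Rightarrow> nat \<Rightarrow> osp_gen free" where
  "higher g i s j =
     (let b = g s * g j - ((-1) ^ par j * qi j powi \<lfloor>cartan j s\<rfloor>) *\<^sub>k (g j * g s)
      in g i * b
         - ((-1) ^ (par i * (1 + par j)) * qi i powi \<lfloor>cartan i s + cartan i j\<rfloor>) *\<^sub>k (b * g i))"

definition serre_rels :: "(nat \<Rightarrow> osp_gen free) \<Rightarrow> osp_gen free set" where
  "serre_rels g =
     {serre (qi i) (nat \<lfloor>1 - cartan i j\<rfloor>) (g i) (g j) | i j.
        i \<in> Idx \<and> j \<in> Idx \<and> i \<notin> Theta \<and> j \<noteq> i}
   \<union> {serre' (qi s) (nat \<lfloor>1 - cartan s j\<rfloor>) (par j) (g s) (g j) | s j.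
        s \<in> Theta \<and> cartan s s = 2 \<and> j \<in> Idx \<and> j \<noteq> s}
   \<union> {g s ^ 2 | s. s \<in> Idx \<and> cartan s s = 0}
   \<union> {g s * higher g (s - 1) s (s + 1)
        + (-1) ^ (par (s - 1) + par (s + 1)) *\<^sub>k (higher g (s - 1) s (s + 1) * g s) | s.
        1 < s \<and> s + 1 < m + n \<and> cartan s s = 0 \<and>
        cartan (s - 1) s = - cartan s (s + 1)}
   \<union> {g s * higher g (s - 1) s (s + 1)
        + (-1) ^ par (s - 1) *\<^sub>k (higher g (s - 1) s (s + 1) * g s) | s.
        1 < s \<and> s + 1 = m + n \<and> cartan s s = 0 \<and>
        alpha (m + n) = Poly_Mapping.single (Eps m) 1}
   \<union> {g s * higher g (s - 1) s (s + 1)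
        - (-1) ^ par (s - 1) *\<^sub>k (higher g (s - 1) s (s + 1) * g s) | s.
        1 < s \<and> s + 1 = m + n \<and> cartan s s = 0 \<and>
        alpha (m + n) = Poly_Mapping.single (Del n) 1}"

definition osp_gens :: "osp_gen set" where
  "osp_gens = GE ` Idx \<union> GF ` Idx \<union> GK ` Idx \<union> GKinv ` Idx"

definition osp_rels :: "osp_gen free set" where
  "osp_rels =
     (\<Union>i\<in>Idx. {gen (GK i) * gen (GKinv i) - 1, gen (GKinv i) * gen (GK i) - 1})
   \<union> (\<Union>i\<in>Idx. \<Union>j\<in>Idx.
        {gen (GK i) * gen (GK j) - gen (GK j) * gen (GK i),
         gen (GK i) * gen (GE j) * gen (GKinv i) - qi i powi \<lfloor>cartan i j\<rfloor> *\<^sub>k gen (GE j),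
         gen (GK i) * gen (GF j) * gen (GKinv i) - qi i powi (- \<lfloor>cartan i j\<rfloor>) *\<^sub>k gen (GF j),
         gen (GE i) * gen (GF j) - (-1) ^ (par i * par j) *\<^sub>k (gen (GF j) * gen (GE i))
           - (if i = j then inverse (qq - inverse qq) *\<^sub>k (gen (GK i) - gen (GKinv i)) else 0)})
   \<union> serre_rels (\<lambda>i. gen (GE i)) \<union> serre_rels (\<lambda>i. gen (GF i))"

definition Uq_osp :: "osp_gen free set kalg" where
  "Uq_osp = pres_alg osp_gens osp_rels"

definition osp_cls :: "osp_gen \<Rightarrow> osp_gen free set" where
  "osp_cls g = cls osp_gens osp_rels (gen g)"

section \<open>The deformed Clifford superalgebra\<close>

definition parPhi :: "nat \<Rightarrow> nat" where
  "parPhi i = (if ob i \<in> range Del then 1 else 0)"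

definition cl_gens :: "cl_gen set" where
  "cl_gens = GPhi ` Idx \<union> GPhiD ` Idx \<union> GU ` Idx \<union> GUinv ` Idx"

definition cl_rels :: "cl_gen free set" where
  "cl_rels =
     (\<Union>i\<in>Idx. {gen (GU i) * gen (GUinv i) - 1, gen (GUinv i) * gen (GU i) - 1,
        gen (GPhi i) * gen (GPhiD i)
          - ((-1) ^ parPhi i * qq) *\<^sub>k (gen (GPhiD i) * gen (GPhi i)) - gen (GUinv i),
        gen (GPhi i) * gen (GPhiD i)
          - ((-1) ^ parPhi i * inverse qq) *\<^sub>k (gen (GPhiD i) * gen (GPhi i)) - gen (GU i)})
   \<union> (\<Union>i\<in>Idx. \<Union>j\<in>Idx.
        {gen (GU i) * gen (GU j) - gen (GU j) * gen (GU i),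
         gen (GU i) * gen (GPhi j) * gen (GUinv i)
           - qq powi (if i = j then - ((-1) ^ parPhi j) else 0) *\<^sub>k gen (GPhi j),
         gen (GU i) * gen (GPhiD j) * gen (GUinv i)
           - qq powi (if i = j then (-1) ^ parPhi j else 0) *\<^sub>k gen (GPhiD j),
         gen (GPhi i) * gen (GPhi j)
           - (-1) ^ (parPhi i * parPhi j) *\<^sub>k (gen (GPhi j) * gen (GPhi i)),
         gen (GPhiD i) * gen (GPhiD j)
           - (-1) ^ (parPhi i * parPhi j) *\<^sub>k (gen (GPhiD j) * gen (GPhiD i))})
   \<union> {gen (GPhi i) * gen (GPhiD j)
        - (-1) ^ (parPhi i * parPhi j) *\<^sub>k (gen (GPhiD j) * gen (GPhi i)) | i j.
        i \<in> Idx \<and> j \<in> Idx \<and> i \<noteq> j}"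

definition Cl_q :: "cl_gen free set kalg" where
  "Cl_q = pres_alg cl_gens cl_rels"

definition cl_cls :: "cl_gen free \<Rightarrow> cl_gen free set" where
  "cl_cls x = cls cl_gens cl_rels x"

section \<open>Fock space and spinor representation\<close>

definition occ :: "(nat \<Rightarrow> nat) set" where
  "occ = {t. (\<forall>i. i \<notin> Idx \<longrightarrow> t i = 0) \<and> (\<forall>i\<in>Idx. parPhi i = 1 \<longrightarrow> t i \<le> 1)}"

text \<open>\<open>ket \<rho> vac t\<close> is the vector obtained from \<open>vac\<close> by the ordered monomial in the
  creation operators with exponents \<open>t 1, \<dots>, t (m + n)\<close>.\<close>

definition ket :: "(cl_gen free set \<Rightarrow> 'v \<Rightarrow> 'v) \<Rightarrow> 'v \<Rightarrow> (nat \<Rightarrow> nat) \<Rightarrow> 'v" where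
  "ket \<rho> vac t =
     \<rho> (cl_cls (prod_list (map (\<lambda>i. gen (GPhiD i) ^ t i) [1..<m + n + 1]))) vac"

text \<open>Fock space is determined up to isomorphism: \<open>\<rho>\<close> makes the vector space \<open>'v\<close> a
  module over the deformed Clifford superalgebra in which the vectors \<open>ket \<rho> vac t\<close> are
  pairwise distinct and form a basis.\<close>

definition fock_space ::
  "(kq \<Rightarrow> 'v \<Rightarrow> 'v) \<Rightarrow> (cl_gen free set \<Rightarrow> 'v \<Rightarrow> 'v) \<Rightarrow> 'v::ab_group_add \<Rightarrow> bool" where
  "fock_space scale \<rho> vac \<longleftrightarrow>
     alg_module Cl_q scale \<rho> \<and>
     (\<forall>i\<in>Idx. \<rho> (cl_cls (gen (GPhi i))) vac = 0 \<and> \<rho> (cl_cls (gen (GU i))) vac = vac) \<and>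
     inj_on (ket \<rho> vac) occ \<and>
     \<not> Modules.module.dependent scale (ket \<rho> vac ` occ) \<and>
     Modules.module.span scale (ket \<rho> vac ` occ) = UNIV"

fun spinor_img :: "osp_gen \<Rightarrow> cl_gen free" where
  "spinor_img (GE i) =
     (if i < m + n then gen (GPhi i) * gen (GPhiD (i + 1))
      else (im_unit * inverse (q_half - inverse q_half)) *\<^sub>k gen (GPhi i))"
| "spinor_img (GF i) =
     (if i < m + n then gen (GPhi (i + 1)) * gen (GPhiD i) else gen (GPhiD i))"
| "spinor_img (GK i) =
     (if i < m + n then (- ((-1) ^ parPhi (i + 1))) *\<^sub>k (gen (GU i) * gen (GUinv (i + 1)))
      else (im_unit * q_half) *\<^sub>k gen (GU i))"
| "spinor_img (GKinv i) =
     (if i < m + n then (- ((-1) ^ parPhi (i + 1))) *\<^sub>k (gen (GU (i + 1)) * gen (GUinv i))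
      else inverse (im_unit * q_half) *\<^sub>k gen (GUinv i))"

definition spinor_hom :: "osp_gen free set \<Rightarrow> cl_gen free set" where
  "spinor_hom = pres_hom cl_gens cl_rels spinor_img"

definition spinor_rep ::
  "(cl_gen free set \<Rightarrow> 'v \<Rightarrow> 'v) \<Rightarrow> osp_gen free set \<Rightarrow> 'v \<Rightarrow> 'v" where
  "spinor_rep \<rho> = \<rho> \<circ> spinor_hom"

definition highest_weight_vector ::
  "(kq \<Rightarrow> 'v \<Rightarrow> 'v) \<Rightarrow> (osp_gen free set \<Rightarrow> 'v \<Rightarrow> 'v) \<Rightarrow>
   'v::ab_group_add \<Rightarrow> (nat \<Rightarrow> kq) \<Rightarrow> bool" where
  "highest_weight_vector scale \<sigma> w wt \<longleftrightarrow>
     w \<noteq> 0 \<and>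
     (\<forall>i\<in>Idx. \<sigma> (osp_cls (GE i)) w = 0 \<and> \<sigma> (osp_cls (GK i)) w = scale (wt i) w)"

end

end

theory Submission
  imports Defs
begin

text \<open>
  Two things have to be shown: that the assignment on generators defines an algebra homomorphism
  into the deformed Clifford superalgebra, and that its image is large enough to act irreducibly
  on Fock space. Write \<open>N = m + n\<close>, and \<open>X i\<close>, \<open>Y i\<close>, \<open>U i\<close>, \<open>U' i\<close> for the actions of
  \<open>\<Phi>\<^sub>i\<close>, its dagger, and the invertible elements attached to \<open>i\<close>.

  Homomorphism. The map \<open>spinor_hom\<close> is defined on cosets, so the image of each relator of the
  quantum supergroup must lie in the ideal of the Clifford relations; the vanishing of its action
  on Fock space alone would not give this. A linear projection \<open>p\<close> whose kernel is the ideal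
  makes \<open>z \<mapsto> p (x * z)\<close> an action of the free algebra in which exactly the members of the ideal
  act as zero (\<open>ex_faithful_rep\<close>). It therefore suffices to verify every relation as an identity
  between linear operators satisfying the Clifford relations (locale \<open>cl_rep\<close>).

  With the convention that \<open>X (N + 1)\<close> and \<open>Y (N + 1)\<close> are the action of 1 and have parity 0,
  every \<open>e\<^sub>i\<close>, including the last one, is a scalar multiple of \<open>X i \<circ> Y (i + 1)\<close>, and every \<open>f\<^sub>i\<close>
  is up to sign \<open>Y i \<circ> X (i + 1)\<close>. The Serre relations, including the ones of higher order, are
  homogeneous in each generator, and they follow from three facts: operators with different
  indices supercommute, \<open>X i\<close> and \<open>Y i\<close> square to zero for odd \<open>i\<close>, and they satisfy the quantum
  Serre relation of type \<open>A\<^sub>2\<close> for even \<open>i\<close>. These facts are symmetric under exchanging \<open>X\<close> with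
  \<open>Y\<close> and stable under rescaling \<open>X\<close>, so that one calculation (locale \<open>ladder\<close>) serves \<open>e\<close> and
  \<open>f\<close> (\<open>serre_rels_vanish\<close>). The other relations come from \<open>YX_XY\<close>, which expresses \<open>Y i \<circ> X i\<close>
  and \<open>X i \<circ> Y i\<close> through \<open>U i\<close> and \<open>U' i\<close>.

  Irreducibility. On an invariant subspace the products of \<open>e\<^sub>i\<close> with \<open>X (i + 1)\<close> in both orders
  combine to \<open>X i \<circ> U (i + 1)\<close>. Descending from the last index, the subspace is stable under the
  whole Clifford superalgebra (\<open>Clifford_invariant\<close>). Applying annihilation operators to a
  nonzero vector of it leads to the vacuum (\<open>vac_mem\<close>), because \<open>X i\<close> lowers \<open>(Y i)\<^sup>k\<close> with the
  coefficient \<open>(q\<^sup>k - q\<^sup>-\<^sup>k) / (q - q\<^sup>-\<^sup>1)\<close>, which does not vanish as \<open>q\<close> is not a root of unity.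
  From the vacuum the creation operators reach the whole space.
\<close>

section \<open>The free algebra\<close>

lemma free_eq_sum_monomials:
  "x = (\<Sum>w\<in>Poly_Mapping.keys x. Poly_Mapping.single w (Poly_Mapping.lookup x w))"
  by (rule poly_mapping_eqI)
     (simp add: lookup_sum lookup_single when_def in_keys_iff sum.delta' if_distrib cong: if_cong)

lemma free_induct [case_names zero add]:
  fixes x :: "'g free"
  assumes "P 0" and "\<And>w c x. P x \<Longrightarrow> P (Poly_Mapping.single w c + x)"
  shows "P x"
proof -
  have "P (\<Sum>w\<in>S. Poly_Mapping.single w (Poly_Mapping.lookup x w))" if "finite S" for S
    using that by induction (use assms in auto)
  then show ?thesis
    using free_eq_sum_monomials[of x] by (metis finite_keys)
qed

lemma single_Nil_commute:
  "Poly_Mapping.single [] c * x = x * (Poly_Mapping.single [] c :: 'g free)"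
  by (induction x rule: free_induct)
     (simp_all add: distrib_left distrib_right mult_single plus_list_def mult.commute)

lemma scal_times_left: "(c *\<^sub>k x) * y = c *\<^sub>k (x * y)"
  by (simp add: scal_def mult.assoc)

lemma scal_times_right: "x * (c *\<^sub>k y) = c *\<^sub>k (x * y)"
proof -
  have "x * (Poly_Mapping.single [] c * y) = (Poly_Mapping.single [] c * x) * y"
    by (subst single_Nil_commute) (simp only: mult.assoc)
  then show ?thesis by (simp add: scal_def mult.assoc)
qed

lemma single_Nil_1: "Poly_Mapping.single [] 1 = (1 :: 'g free)"
  by (metis single_one zero_list_def)

global_interpretation free_vs: vector_space "(*\<^sub>k) :: kq \<Rightarrow> 'g free \<Rightarrow> 'g free"
proof
  fix a b :: kq and x y :: "'g free"
  show "a *\<^sub>k (x + y) = a *\<^sub>k x + a *\<^sub>k y" by (simp add: scal_def distrib_left)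
  show "(a + b) *\<^sub>k x = a *\<^sub>k x + b *\<^sub>k x" by (simp add: scal_def distrib_right single_add)
  show "a *\<^sub>k b *\<^sub>k x = (a * b) *\<^sub>k x"
    by (simp add: scal_def mult_single plus_list_def flip: mult.assoc)
  show "1 *\<^sub>k x = x" by (simp add: scal_def single_Nil_1)
qed

lemma single_eq_scal: "Poly_Mapping.single w c = c *\<^sub>k (prod_list (map gen w) :: 'g free)"
proof -
  have "prod_list (map gen w) = (Poly_Mapping.single w 1 :: 'g free)"
    by (induction w) (simp_all add: gen_def mult_single plus_list_def single_Nil_1)
  then show ?thesis by (simp add: scal_def mult_single plus_list_def)
qed

section \<open>Homomorphisms out of the free algebra\<close>

lemma free_ext_superset:
  assumes "finite S" "Poly_Mapping.keys x \<subseteq> S"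
  shows "free_ext h x = (\<Sum>w\<in>S. Poly_Mapping.lookup x w *\<^sub>k prod_list (map h w))"
  unfolding free_ext_def
  by (rule sum.mono_neutral_left) (use assms in \<open>auto simp: in_keys_iff\<close>)

lemma free_ext_add: "free_ext h (x + y) = free_ext h x + free_ext h y"
proof -
  let ?S = "Poly_Mapping.keys x \<union> Poly_Mapping.keys y"
  have "Poly_Mapping.keys (x + y) \<subseteq> ?S" by (rule keys_add)
  then show ?thesis
    using free_ext_superset[of ?S "x + y" h] free_ext_superset[of ?S x h]
      free_ext_superset[of ?S y h]
    by (simp add: lookup_add free_vs.scale_left_distrib sum.distrib)
qed

lemma free_ext_zero [simp]: "free_ext h 0 = 0"
  by (simp add: free_ext_def)

lemma free_ext_single: "free_ext h (Poly_Mapping.single w c) = c *\<^sub>k prod_list (map h w)"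
  by (subst free_ext_superset[of "{w}"]) (auto)

lemma free_ext_gen [simp]: "free_ext h (gen g) = h g"
  by (simp add: gen_def free_ext_single)

lemma free_ext_one [simp]: "free_ext h 1 = 1"
  by (simp add: free_ext_single flip: single_Nil_1)

lemma free_ext_mult: "free_ext h (x * y) = free_ext h x * free_ext h y"
proof (induction x rule: free_induct)
  case (add w c x)
  have "free_ext h (Poly_Mapping.single w c * y) = (c *\<^sub>k prod_list (map h w)) * free_ext h y"
    by (induction y rule: free_induct)
       (simp_all add: distrib_left free_ext_add mult_single free_ext_single plus_list_def
         scal_times_left scal_times_right)
  with add show ?case by (simp add: distrib_right free_ext_add free_ext_single)
qed simp

lemma free_ext_scal: "free_ext h (c *\<^sub>k x) = c *\<^sub>k free_ext h x"
  by (simp add: scal_def free_ext_mult free_ext_single scal_times_left)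

lemma free_ext_uminus: "free_ext h (- x) = - free_ext h x"
  using free_ext_add[of h x "- x"] by (simp add: add_eq_0_iff)

lemma free_ext_diff: "free_ext h (x - y) = free_ext h x - free_ext h y"
  using free_ext_add[of h x "- y"] by (simp add: free_ext_uminus)

lemma free_ext_power: "free_ext h (x ^ k) = free_ext h x ^ k"
  by (induction k) (simp_all add: free_ext_mult)

lemma free_ext_sum: "free_ext h (sum f S) = (\<Sum>i\<in>S. free_ext h (f i))"
  by (induction S rule: infinite_finite_induct) (simp_all add: free_ext_add)

lemmas free_ext_simps =
  free_ext_add free_ext_mult free_ext_scal free_ext_uminus free_ext_diff free_ext_power free_ext_sum

section \<open>Algebras given by generators and relations\<close>

lemma carrier_free_alg: "carrier (free_alg G) = {x. \<forall>w\<in>Poly_Mapping.keys x. set w \<subseteq> G}"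
  and mult_free_alg [simp]: "mult (free_alg G) = (*)"
  and one_free_alg [simp]: "one (free_alg G) = 1"
  and zero_free_alg [simp]: "zero (free_alg G) = 0"
  and add_free_alg [simp]: "add (free_alg G) = (+)"
  by (simp_all add: free_alg_def)

lemma free_alg_closed:
  shows "0 \<in> carrier (free_alg G)" and "1 \<in> carrier (free_alg G)"
    and "x \<in> carrier (free_alg G) \<Longrightarrow> y \<in> carrier (free_alg G) \<Longrightarrow> x + y \<in> carrier (free_alg G)"
    and "x \<in> carrier (free_alg G) \<Longrightarrow> y \<in> carrier (free_alg G) \<Longrightarrow> x * y \<in> carrier (free_alg G)"
    and "x \<in> carrier (free_alg G) \<Longrightarrow> - x \<in> carrier (free_alg G)"
    and "x \<in> carrier (free_alg G) \<Longrightarrow> y \<in> carrier (free_alg G) \<Longrightarrow> x - y \<in> carrier (free_alg G)"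
    and "x \<in> carrier (free_alg G) \<Longrightarrow> c *\<^sub>k x \<in> carrier (free_alg G)"
    and "x \<in> carrier (free_alg G) \<Longrightarrow> x ^ k \<in> carrier (free_alg G)"
    and "g \<in> G \<Longrightarrow> gen g \<in> carrier (free_alg G)"
    and "(\<And>i. i \<in> S \<Longrightarrow> f i \<in> carrier (free_alg G)) \<Longrightarrow> sum f S \<in> carrier (free_alg G)"
    and "(\<And>a. a \<in> set xs \<Longrightarrow> a \<in> carrier (free_alg G)) \<Longrightarrow> prod_list xs \<in> carrier (free_alg G)"
proof -
  show z: "0 \<in> carrier (free_alg G)" by (simp add: carrier_free_alg)
  show o: "1 \<in> carrier (free_alg G)" by (simp add: carrier_free_alg zero_list_def)
  show a: "x \<in> carrier (free_alg G) \<Longrightarrow> y \<in> carrier (free_alg G) \<Longrightarrow> x + y \<in> carrier (free_alg G)" for x y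
    using keys_add[of x y] unfolding carrier_free_alg by blast
  show m: "x \<in> carrier (free_alg G) \<Longrightarrow> y \<in> carrier (free_alg G) \<Longrightarrow> x * y \<in> carrier (free_alg G)" for x y
    using keys_mult[of x y] unfolding carrier_free_alg plus_list_def by fastforce
  show g: "g \<in> G \<Longrightarrow> gen g \<in> carrier (free_alg G)" for g by (simp add: carrier_free_alg gen_def)
  show s: "x \<in> carrier (free_alg G) \<Longrightarrow> c *\<^sub>k x \<in> carrier (free_alg G)" for c x
    unfolding scal_def by (rule m) (simp_all add: carrier_free_alg)
  show n: "x \<in> carrier (free_alg G) \<Longrightarrow> - x \<in> carrier (free_alg G)" for x
    using s[of x "-1"] by simp
  show "x \<in> carrier (free_alg G) \<Longrightarrow> y \<in> carrier (free_alg G) \<Longrightarrow> x - y \<in> carrier (free_alg G)" for x y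
    using a[of x "- y"] n[of y] by simp
  show "x \<in> carrier (free_alg G) \<Longrightarrow> x ^ k \<in> carrier (free_alg G)"
    by (induction k) (simp_all add: o m)
  show "(\<And>i. i \<in> S \<Longrightarrow> f i \<in> carrier (free_alg G)) \<Longrightarrow> sum f S \<in> carrier (free_alg G)"
    by (induction S rule: infinite_finite_induct) (simp_all add: z a)
  show "(\<And>a. a \<in> set xs \<Longrightarrow> a \<in> carrier (free_alg G)) \<Longrightarrow> prod_list xs \<in> carrier (free_alg G)"
    by (induction xs) (simp_all add: o m)
qed

lemma ring_free_alg: "ring (free_alg G)"
proof (rule ringI)
  show "abelian_group (free_alg G)"
  proof (rule abelian_groupI)
    fix x assume "x \<in> carrier (free_alg G)"
    then show "\<exists>y\<in>carrier (free_alg G). y \<oplus>\<^bsub>free_alg G\<^esub> x = \<zero>\<^bsub>free_alg G\<^esub>"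
      by (intro bexI[of _ "- x"]) (simp_all add: free_alg_closed)
  qed (simp_all add: free_alg_closed algebra_simps)
  show "Group.monoid (free_alg G)"
    by (rule monoidI) (simp_all add: free_alg_closed mult.assoc)
qed (simp_all add: algebra_simps)

lemma a_inv_free_alg:
  assumes "x \<in> carrier (free_alg G)"
  shows "\<ominus>\<^bsub>free_alg G\<^esub> x = - x"
proof -
  interpret ring "free_alg G" by (rule ring_free_alg)
  show ?thesis using minus_equality[of "- x" x] assms by (simp add: free_alg_closed)
qed

lemma a_minus_free_alg:
  assumes "x \<in> carrier (free_alg G)" "y \<in> carrier (free_alg G)"
  shows "x \<ominus>\<^bsub>free_alg G\<^esub> y = x - y"
  using assms by (simp add: a_minus_def a_inv_free_alg)

lemma free_ext_closed:
  assumes "\<And>g. g \<in> G \<Longrightarrow> h g \<in> carrier (free_alg G')" and "x \<in> carrier (free_alg G)"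
  shows "free_ext h x \<in> carrier (free_alg G')"
  unfolding free_ext_def
  by (intro free_alg_closed) (use assms in \<open>auto simp: carrier_free_alg\<close>)

locale presentation =
  fixes G :: "'g set" and R :: "'g free set"
  assumes rels: "R \<subseteq> carrier (free_alg G)"
begin

abbreviation "F \<equiv> free_alg G"
abbreviation "J \<equiv> rel_ideal G R"

sublocale F: ring "free_alg G" by (rule ring_free_alg)

sublocale J: ideal "rel_ideal G R" "free_alg G"
  unfolding rel_ideal_def by (rule F.genideal_ideal[OF rels])

lemma rels_subset: "R \<subseteq> J"
  unfolding rel_ideal_def by (rule F.genideal_self[OF rels])

lemma J_subset: "x \<in> J \<Longrightarrow> x \<in> carrier F"
  using J.a_subset by blast

lemma J_closed:
  shows "0 \<in> J" and "x \<in> J \<Longrightarrow> y \<in> J \<Longrightarrow> x + y \<in> J"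
    and "x \<in> J \<Longrightarrow> y \<in> carrier F \<Longrightarrow> x * y \<in> J"
    and "x \<in> J \<Longrightarrow> y \<in> carrier F \<Longrightarrow> y * x \<in> J"
    and "x \<in> J \<Longrightarrow> c *\<^sub>k x \<in> J"
proof -
  show "0 \<in> J" using J.zero_closed by simp
  show "x \<in> J \<Longrightarrow> y \<in> J \<Longrightarrow> x + y \<in> J" using J.a_closed by simp
  show "x \<in> J \<Longrightarrow> y \<in> carrier F \<Longrightarrow> x * y \<in> J" using J.I_r_closed by simp
  show l: "x \<in> J \<Longrightarrow> y \<in> carrier F \<Longrightarrow> y * x \<in> J" for y using J.I_l_closed by simp
  show "x \<in> J \<Longrightarrow> c *\<^sub>k x \<in> J"
    using l[of "c *\<^sub>k 1"] by (simp add: scal_times_left free_alg_closed)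
qed

lemma J_least:
  assumes "ideal I (free_alg G)" "R \<subseteq> I"
  shows "J \<subseteq> I"
  unfolding rel_ideal_def by (rule F.genideal_minimal[OF assms])

lemma carrier_pres: "carrier (pres_alg G R) = cls G R ` carrier F"
  by (auto simp: pres_alg_def Let_def FactRing_def A_RCOSETS_def' cls_def)

lemma cls_eq_iff:
  assumes "x \<in> carrier F" "y \<in> carrier F"
  shows "cls G R x = cls G R y \<longleftrightarrow> x - y \<in> J"
  using F.quotient_eq_iff_same_a_r_cos[OF J.ideal_axioms assms] assms
  by (simp add: a_minus_free_alg cls_def)

lemma mem_cls_iff:
  assumes "x \<in> carrier F"
  shows "y \<in> cls G R x \<longleftrightarrow> y \<in> carrier F \<and> y - x \<in> J"
proof -
  have "y \<in> cls G R x \<longleftrightarrow> (\<exists>j\<in>J. y = j + x)"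
    by (auto simp: cls_def a_r_coset_def')
  also have "\<dots> \<longleftrightarrow> y - x \<in> J" by (metis diff_add_cancel add_diff_cancel)
  also have "\<dots> \<longleftrightarrow> y \<in> carrier F \<and> y - x \<in> J"
    using assms J_subset free_alg_closed(3)[of "y - x" G x] by auto
  finally show ?thesis .
qed

lemma pres_mult:
  assumes "x \<in> carrier F" "y \<in> carrier F"
  shows "cls G R x \<otimes>\<^bsub>pres_alg G R\<^esub> cls G R y = cls G R (x * y)"
  using J.rcoset_mult_add[OF assms] by (simp add: pres_alg_def Let_def FactRing_def cls_def)

lemma pres_add:
  assumes "x \<in> carrier F" "y \<in> carrier F"
  shows "cls G R x \<oplus>\<^bsub>pres_alg G R\<^esub> cls G R y = cls G R (x + y)"
  using J.a_rcos_sum[OF assms] by (simp add: pres_alg_def Let_def FactRing_def cls_def)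

lemma pres_one: "\<one>\<^bsub>pres_alg G R\<^esub> = cls G R 1"
  by (simp add: pres_alg_def Let_def FactRing_def cls_def)

lemma pres_smult:
  assumes "x \<in> carrier F"
  shows "c \<odot>\<^bsub>pres_alg G R\<^esub> cls G R x = cls G R (c *\<^sub>k x)"
proof -
  have "c \<odot>\<^bsub>pres_alg G R\<^esub> cls G R x = cls G R (c *\<^sub>k 1) \<otimes>\<^bsub>pres_alg G R\<^esub> cls G R x"
    by (simp add: pres_alg_def Let_def)
  also have "\<dots> = cls G R (c *\<^sub>k x)"
    by (subst pres_mult) (simp_all add: assms free_alg_closed scal_times_left)
  finally show ?thesis .
qed

lemmas pres_ops = pres_mult pres_add pres_one pres_smult

end

text \<open>The universal property of a presentation. The elements that \<open>free_ext h\<close> sends into the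
  target ideal form an ideal of the source; as it contains the relators, it contains the ideal they
  generate, and so \<open>pres_hom\<close> is independent of the representative chosen in a coset.\<close>

lemma pres_hom_universal:
  assumes P: "presentation G R" and P': "presentation G' R'"
    and gens: "\<And>g. g \<in> G \<Longrightarrow> h g \<in> carrier (free_alg G')"
    and rels: "\<And>x. x \<in> R \<Longrightarrow> free_ext h x \<in> rel_ideal G' R'"
  shows "x \<in> carrier (free_alg G) \<Longrightarrow> pres_hom G' R' h (cls G R x) = cls G' R' (free_ext h x)"
    and "pres_hom G' R' h \<in> alg_hom (pres_alg G R) (pres_alg G' R')"
proof -
  interpret P: presentation G R by fact
  interpret P': presentation G' R' by fact
  let ?I = "{x \<in> carrier (free_alg G). free_ext h x \<in> P'.J}"
  have closed: "free_ext h x \<in> carrier (free_alg G')" if "x \<in> carrier (free_alg G)" for x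
    using free_ext_closed[of G h G'] gens that by blast
  have "ideal ?I (free_alg G)"
  proof (rule idealI[OF ring_free_alg])
    show "subgroup ?I (add_monoid (free_alg G))"
    proof (rule group.subgroupI)
      show "Group.group (add_monoid (free_alg G))"
        by (rule P.F.a_group)
      have "0 \<in> ?I" by (simp add: free_alg_closed P'.J_closed)
      then show "?I \<noteq> {}" by blast
      fix a assume a: "a \<in> ?I"
      have "inv\<^bsub>add_monoid (free_alg G)\<^esub> a = - a"
        using a_inv_free_alg[of a G] a by (simp add: a_inv_def)
      then show "inv\<^bsub>add_monoid (free_alg G)\<^esub> a \<in> ?I"
        using a P'.J_closed(5)[of "free_ext h a" "-1"] by (simp add: free_alg_closed free_ext_simps)
    qed (auto simp: free_alg_closed free_ext_simps P'.J_closed)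
  qed (auto simp: free_alg_closed free_ext_simps P'.J_closed closed)
  then have J: "free_ext h x \<in> P'.J" if "x \<in> P.J" for x
    using P.J_least[of ?I] rels P.rels that by auto
  show ev: "pres_hom G' R' h (cls G R x) = cls G' R' (free_ext h x)"
    if x: "x \<in> carrier (free_alg G)" for x
  proof -
    have "cls G' R' (free_ext h y) = cls G' R' (free_ext h x)" if "y \<in> cls G R x" for y
    proof -
      have y: "y \<in> carrier (free_alg G)" "y - x \<in> P.J"
        using that P.mem_cls_iff[OF x] by blast+
      have "free_ext h y - free_ext h x \<in> P'.J"
        using J[OF y(2)] by (simp only: free_ext_diff)
      then show ?thesis using P'.cls_eq_iff[OF closed[OF y(1)] closed[OF x]] by blast
    qed
    moreover have "x \<in> cls G R x" using x by (simp add: P.mem_cls_iff P.J_closed)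
    ultimately have "(\<lambda>y. cls G' R' (free_ext h y)) ` cls G R x = {cls G' R' (free_ext h x)}"
      by blast
    then show ?thesis by (simp add: pres_hom_def)
  qed
  have "pres_hom G' R' h \<in> ring_hom (pres_alg G R) (pres_alg G' R')"
  proof (rule ring_hom_memI)
    fix X assume "X \<in> carrier (pres_alg G R)"
    then show "pres_hom G' R' h X \<in> carrier (pres_alg G' R')"
      by (auto simp: P.carrier_pres P'.carrier_pres ev closed)
  next
    fix X Y assume "X \<in> carrier (pres_alg G R)" "Y \<in> carrier (pres_alg G R)"
    then obtain x y where X: "X = cls G R x" "x \<in> carrier (free_alg G)"
      and Y: "Y = cls G R y" "y \<in> carrier (free_alg G)"
      unfolding P.carrier_pres by blast
    show "pres_hom G' R' h (X \<otimes>\<^bsub>pres_alg G R\<^esub> Y) =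
        pres_hom G' R' h X \<otimes>\<^bsub>pres_alg G' R'\<^esub> pres_hom G' R' h Y"
      using X Y by (simp add: P.pres_mult ev free_alg_closed free_ext_mult P'.pres_mult closed)
    show "pres_hom G' R' h (X \<oplus>\<^bsub>pres_alg G R\<^esub> Y) =
        pres_hom G' R' h X \<oplus>\<^bsub>pres_alg G' R'\<^esub> pres_hom G' R' h Y"
      using X Y by (simp add: P.pres_add ev free_alg_closed free_ext_add P'.pres_add closed)
  next
    show "pres_hom G' R' h \<one>\<^bsub>pres_alg G R\<^esub> = \<one>\<^bsub>pres_alg G' R'\<^esub>"
      by (simp add: P.pres_one P'.pres_one ev free_alg_closed)
  qed
  moreover have "pres_hom G' R' h (c \<odot>\<^bsub>pres_alg G R\<^esub> X) =
      c \<odot>\<^bsub>pres_alg G' R'\<^esub> pres_hom G' R' h X"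
    if "X \<in> carrier (pres_alg G R)" for c X
  proof -
    obtain x where X: "X = cls G R x" "x \<in> carrier (free_alg G)"
      using \<open>X \<in> carrier (pres_alg G R)\<close> unfolding P.carrier_pres by blast
    then show ?thesis
      by (simp add: P.pres_smult ev free_alg_closed free_ext_scal P'.pres_smult closed)
  qed
  ultimately show "pres_hom G' R' h \<in> alg_hom (pres_alg G R) (pres_alg G' R')"
    by (simp add: alg_hom_def)
qed

section \<open>Representations of free and presented algebras\<close>

text \<open>The unit need not act as the identity: in the representation of \<open>ex_faithful_rep\<close> it
  acts as a projection.\<close>

locale free_rep = vector_space scale
  for scale :: "kq \<Rightarrow> 'v::ab_group_add \<Rightarrow> 'v" +
  fixes A :: "'g free \<Rightarrow> 'v \<Rightarrow> 'v"
  assumes rep_add: "A (x + y) v = A x v + A y v"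
    and rep_scal: "A (c *\<^sub>k x) v = scale c (A x v)"
    and rep_mult: "A (x * y) v = A x (A y v)"
    and vec_add: "A x (u + v) = A x u + A x v"
    and vec_scale: "A x (scale c v) = scale c (A x v)"
begin

lemma rep_zero: "A 0 v = 0"
  using rep_add[of 0 0 v] by simp

lemma rep_uminus: "A (- x) v = - A x v"
  using rep_add[of x "- x" v] by (simp add: rep_zero add_eq_0_iff)

lemma rep_diff: "A (x - y) v = A x v - A y v"
  using rep_add[of x "- y" v] by (simp add: rep_uminus)

lemma vec_zero: "A x 0 = 0"
  using vec_add[of x 0 0] by simp

lemma vec_uminus: "A x (- v) = - A x v"
  using vec_add[of x v "- v"] by (simp add: vec_zero add_eq_0_iff)

lemma vec_diff: "A x (u - v) = A x u - A x v"
  using vec_add[of x u "- v"] by (simp add: vec_uminus)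

lemma rep_one: "A 1 (A x v) = A x v" "A x (A 1 v) = A x v"
  using rep_mult[of 1 x v] rep_mult[of x 1 v] by simp_all

end

text \<open>Kills the generators outside \<open>G\<close>. A representation given on \<open>free_alg G\<close> extends
  along this retraction to the whole type, which removes all membership conditions from the laws of
  \<open>free_rep\<close>.\<close>

definition retract :: "'g set \<Rightarrow> 'g free \<Rightarrow> 'g free" where
  "retract G = free_ext (\<lambda>g. if g \<in> G then gen g else 0)"

lemma retract_closed: "retract G x \<in> carrier (free_alg G)"
  unfolding retract_def free_ext_def by (intro free_alg_closed) (auto intro: free_alg_closed)

lemma retract_id:
  assumes "x \<in> carrier (free_alg G)"
  shows "retract G x = x"
proof -
  have "retract G x = (\<Sum>w\<in>Poly_Mapping.keys x. Poly_Mapping.single w (Poly_Mapping.lookup x w))"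
    unfolding retract_def free_ext_def
  proof (rule sum.cong[OF refl])
    fix w assume "w \<in> Poly_Mapping.keys x"
    then have "set w \<subseteq> G" using assms by (simp add: carrier_free_alg)
    then have "map (\<lambda>g. if g \<in> G then gen g else 0) w = map gen w" by auto
    then show "Poly_Mapping.lookup x w *\<^sub>k prod_list (map (\<lambda>g. if g \<in> G then gen g else 0) w) =
        Poly_Mapping.single w (Poly_Mapping.lookup x w)"
      by (simp only: single_eq_scal)
  qed
  then show ?thesis using free_eq_sum_monomials[of x] by simp
qed

lemma retract_simps:
  "retract G (x + y) = retract G x + retract G y" "retract G (x * y) = retract G x * retract G y"
  "retract G (c *\<^sub>k x) = c *\<^sub>k retract G x"
  by (simp_all add: retract_def free_ext_simps)

text \<open>Extend a basis of \<open>J\<close> to a basis of the whole space, and map the basis vectors in \<open>J\<close> to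
  0 and the others to themselves.\<close>

lemma (in vector_space) ex_projection_along:
  assumes "subspace J"
  shows "\<exists>p. Vector_Spaces.linear scale scale p \<and> (\<forall>x. p x - x \<in> J) \<and> (\<forall>x. p x = 0 \<longleftrightarrow> x \<in> J)"
proof -
  interpret pair: vector_space_pair scale scale ..
  obtain B where B: "B \<subseteq> J" "independent B" "J = span B"
    using basis_exists[of J] assms span_minimal by (metis subset_antisym)
  let ?f = "\<lambda>x. if x \<in> B then 0 else x"
  obtain p where p: "Vector_Spaces.linear scale scale p" "\<And>x. x \<in> extend_basis B \<Longrightarrow> p x = ?f x"
    using pair.linear_independent_extend[OF independent_extend_basis[OF B(2)], of ?f] by blast
  interpret p: Vector_Spaces.linear scale scale p by fact
  have p0: "p x = 0" if "x \<in> J" for x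
  proof -
    have "x \<in> span B" using that B by blast
    then show ?thesis
    proof (induction rule: span_induct)
      case base
      show ?case by (rule subspaceI) (simp_all add: p.zero p.add p.scale)
    next
      case (step x)
      then show ?case using p(2)[of x] extend_basis_superset[OF B(2)] by auto
    qed
  qed
  have pJ: "p x - x \<in> J" for x
  proof -
    have "x \<in> span (extend_basis B)" by (simp add: span_extend_basis[OF B(2)])
    then show ?thesis
    proof (induction rule: span_induct)
      case base
      show ?case
      proof (rule subspaceI)
        fix x y c assume x: "x \<in> {x. p x - x \<in> J}" and y: "y \<in> {x. p x - x \<in> J}"
        have "p (x + y) - (x + y) = (p x - x) + (p y - y)" by (simp add: p.add)
        also have "\<dots> \<in> J" using x y subspace_add[OF assms] by blast
        finally show "x + y \<in> {x. p x - x \<in> J}" by blast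
        have "p (scale c x) - scale c x = scale c (p x - x)"
          by (simp add: p.scale scale_right_diff_distrib)
        also have "\<dots> \<in> J" using x subspace_scale[OF assms] by blast
        finally show "scale c x \<in> {x. p x - x \<in> J}" by blast
      qed (simp add: p.zero subspace_0[OF assms])
    next
      case (step x)
      then show ?case using p(2)[of x] B assms by (auto simp: subspace_0 subspace_neg)
    qed
  qed
  have "x \<in> J" if "p x = 0" for x
    using pJ[of x] that assms subspace_neg[of J "- x"] by simp
  then show ?thesis using p(1) p0 pJ by blast
qed

context presentation
begin

text \<open>The left regular representation of the presented algebra, carried by a linear complement of
  the ideal inside the free algebra instead of by cosets. It turns the membership of an element in
  the ideal into the vanishing of an operator.\<close>

lemma ex_faithful_rep:
  "\<exists>A :: 'g free \<Rightarrow> 'g free \<Rightarrow> 'g free. free_rep (*\<^sub>k) A \<and> (\<forall>x\<in>R. \<forall>z. A x z = 0) \<and>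
     (\<forall>x\<in>carrier F. (\<forall>z. A x z = 0) \<longrightarrow> x \<in> J)"
proof -
  have "free_vs.subspace J"
    by (rule free_vs.subspaceI) (simp_all add: J_closed)
  then obtain p where p: "Vector_Spaces.linear (*\<^sub>k) (*\<^sub>k) p"
    and pJ: "\<And>x. p x - x \<in> J" and p0: "\<And>x. p x = 0 \<longleftrightarrow> x \<in> J"
    using free_vs.ex_projection_along by blast
  interpret p: Vector_Spaces.linear "(*\<^sub>k)" "(*\<^sub>k)" p by fact
  have pF: "p x \<in> carrier F" if "x \<in> carrier F" for x
    using free_alg_closed(3)[OF J_subset[OF pJ[of x]] that] by simp
  have pp: "p (x * p y) = p (x * y)" if "x \<in> carrier F" for x y
  proof -
    have "p (x * p y - x * y) = 0"
      using J_closed(4)[OF pJ[of y] that] by (simp add: p0 right_diff_distrib)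
    then show ?thesis by (simp add: p.diff)
  qed
  define A where "A x z = p (retract G x * retract G z)" for x z
  have "free_rep (*\<^sub>k) A"
  proof unfold_locales
    fix x y u v :: "'g free" and c :: kq
    show "A (x + y) v = A x v + A y v"
      by (simp add: A_def retract_simps distrib_right p.add)
    show "A x (u + v) = A x u + A x v"
      by (simp add: A_def retract_simps distrib_left p.add)
    show "A (c *\<^sub>k x) v = c *\<^sub>k A x v" "A x (c *\<^sub>k v) = c *\<^sub>k A x v"
      by (simp_all add: A_def retract_simps scal_times_left scal_times_right p.scale)
    show "A (x * y) v = A x (A y v)"
      unfolding A_def
      by (simp add: retract_id pF free_alg_closed retract_closed pp) (simp add: retract_simps mult.assoc)
  qed
  moreover have "A x z = 0" if "x \<in> R" for x z
    using that rels rels_subset by (auto simp: A_def p0 retract_id retract_closed J_closed subset_iff)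
  moreover have "x \<in> J" if "x \<in> carrier F" "\<And>z. A x z = 0" for x
    \<comment> \<open>Acting on 1 gives \<open>p x = 0\<close>.\<close>
    using that(2)[of 1] that(1) by (simp add: A_def retract_id free_alg_closed p0)
  ultimately show ?thesis by blast
qed

text \<open>Pulls a module over a presented algebra back to a representation of the free algebra, in
  which one can calculate with operators.\<close>

lemma module_free_rep:
  assumes "alg_module (pres_alg G R) scale \<rho>"
  defines "A \<equiv> \<lambda>x. \<rho> (cls G R (retract G x))"
  shows "free_rep scale A" and "A 1 = id" and "x \<in> R \<Longrightarrow> A x v = 0"
    and "x \<in> carrier F \<Longrightarrow> \<rho> (cls G R x) = A x"
proof -
  have vs: "vector_space scale" and hom: "\<rho> \<in> ring_hom (pres_alg G R) (End_alg scale)"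
    and smult: "X \<in> carrier (pres_alg G R) \<Longrightarrow> \<rho> (c \<odot>\<^bsub>pres_alg G R\<^esub> X) = c \<odot>\<^bsub>End_alg scale\<^esub> \<rho> X" for c X
    using assms(1) by (auto simp: alg_module_def alg_hom_def)
  have C: "cls G R (retract G x) \<in> carrier (pres_alg G R)" for x
    using retract_closed by (auto simp: carrier_pres)
  note h = ring_hom_add[OF hom C C] ring_hom_mult[OF hom C C] smult[OF C] pres_ops[symmetric] retract_closed
  have lin: "Vector_Spaces.linear scale scale (A x)" for x
    using ring_hom_closed[OF hom C] by (simp add: A_def End_alg_def)
  interpret vector_space scale by (rule vs)
  show "free_rep scale A"
  proof unfold_locales
    fix x y u v c
    show "A (x + y) v = A x v + A y v" "A (x * y) v = A x (A y v)" "A (c *\<^sub>k x) v = scale c (A x v)"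
      by (simp_all add: A_def retract_simps h) (simp_all add: End_alg_def)
    show "A x (u + v) = A x u + A x v" "A x (scale c v) = scale c (A x v)"
      using lin[of x] by (simp_all add: Vector_Spaces.linear_iff)
  qed
  then interpret A: free_rep scale A .
  show one: "A 1 = id"
    using ring_hom_one[OF hom] by (simp add: A_def pres_one retract_id free_alg_closed) (simp add: End_alg_def)
  show "\<rho> (cls G R x) = A x" if "x \<in> carrier F" for x
    using that by (simp add: A_def retract_id)
  show "A x v = 0" if "x \<in> R"
  proof -
    have x: "x \<in> carrier F" "x \<in> J" using that rels rels_subset by auto
    then have "cls G R x = cls G R 0" by (simp add: cls_eq_iff free_alg_closed)
    then have "A x = A 0" using x by (simp add: A_def retract_id free_alg_closed)
    then show ?thesis using A.rep_zero by simp
  qed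
qed

end

section \<open>The ordered basis\<close>

locale ordered_basis =
  fixes m n :: nat and r :: "(bvec \<times> bvec) set"
  assumes m: "m \<ge> 1" and n: "n \<ge> 1" and order: "admissible_order m n r"
begin

text \<open>The inverse of \<open>ob\<close>.\<close>

definition rank :: "bvec \<Rightarrow> nat" where
  "rank b = Suc (card {c \<in> bvecs m n. (c, b) \<in> r})"

lemma finite_bvecs: "finite (bvecs m n)"
  by (simp add: bvecs_def)

lemma card_bvecs: "card (bvecs m n) = m + n"
proof -
  have "card (Eps ` {1..m} \<union> Del ` {1..n}) = card (Eps ` {1..m}) + card (Del ` {1..n})"
    by (rule card_Un_disjoint) auto
  also have "\<dots> = m + n" by (simp add: card_image inj_on_def)
  finally show ?thesis by (simp add: bvecs_def)
qed

lemma rank_less: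
  assumes "(b, b') \<in> r"
  shows "rank b < rank b'"
proof -
  have tr: "trans r" and irr: "irrefl r" and sub: "r \<subseteq> bvecs m n \<times> bvecs m n"
    using order by (auto simp: admissible_order_def strict_linear_order_on_def)
  have "{c \<in> bvecs m n. (c, b) \<in> r} \<subset> {c \<in> bvecs m n. (c, b') \<in> r}"
    using transD[OF tr _ assms] irr sub assms by (auto simp: irrefl_def)
  then show ?thesis
    unfolding rank_def using psubset_card_mono[of "{c \<in> bvecs m n. (c, b') \<in> r}"] finite_bvecs by simp
qed

lemma bij_rank: "bij_betw rank (bvecs m n) {1..m + n}"
proof -
  have irr: "irrefl r" and tot: "total_on (bvecs m n) r"
    using order by (auto simp: admissible_order_def strict_linear_order_on_def)
  have inj: "inj_on rank (bvecs m n)"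
    by (rule inj_onI) (metis tot total_on_def rank_less less_irrefl)
  have "rank b \<in> {1..m + n}" if "b \<in> bvecs m n" for b
  proof -
    have "{c \<in> bvecs m n. (c, b) \<in> r} \<subset> bvecs m n"
      using that irr by (auto simp: irrefl_def)
    then have "card {c \<in> bvecs m n. (c, b) \<in> r} < m + n"
      using psubset_card_mono[OF finite_bvecs] card_bvecs by simp
    then show ?thesis by (simp add: rank_def)
  qed
  then have "rank ` bvecs m n \<subseteq> {1..m + n}" by blast
  moreover have "card (rank ` bvecs m n) = card {1..m + n}"
    using card_image[OF inj] card_bvecs by simp
  ultimately have "rank ` bvecs m n = {1..m + n}"
    by (simp add: card_subset_eq)
  with inj show ?thesis by (simp add: bij_betw_def)
qed

lemma ob:
  assumes "i \<in> {1..m + n}"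
  shows ob_mem: "ob m n r i \<in> bvecs m n" and rank_ob: "rank (ob m n r i) = i"
proof -
  have "\<exists>!b. b \<in> bvecs m n \<and> rank b = i"
    using bij_rank assms unfolding bij_betw_def inj_on_def by (metis imageE)
  from theI'[OF this] show "ob m n r i \<in> bvecs m n" "rank (ob m n r i) = i"
    unfolding ob_def rank_def by blast+
qed

lemma ob_eq_iff: "i \<in> {1..m + n} \<Longrightarrow> j \<in> {1..m + n} \<Longrightarrow> ob m n r i = ob m n r j \<longleftrightarrow> i = j"
  using rank_ob by metis

text \<open>The last basis vector has no successor in the order, whereas \<open>Eps i\<close> with \<open>i < m\<close> and
  \<open>Del i\<close> with \<open>i < n\<close> do.\<close>

lemma ob_last: "ob m n r (m + n) = Eps m \<or> ob m n r (m + n) = Del n"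
proof -
  let ?b = "ob m n r (m + n)"
  have b: "?b \<in> bvecs m n" "rank ?b = m + n" using ob[of "m + n"] m by auto
  have max: "c \<in> bvecs m n" if "(?b, c) \<in> r" for c
    using order that by (auto simp: admissible_order_def)
  have no: "(?b, c) \<notin> r" for c
  proof
    assume c: "(?b, c) \<in> r"
    have "rank c \<in> {1..m + n}" using bij_rank max[OF c] by (auto simp: bij_betw_def)
    with rank_less[OF c] b(2) show False by simp
  qed
  show ?thesis
  proof (cases ?b)
    case (Eps i)
    then have "1 \<le> i" "i \<le> m" using b by (auto simp: bvecs_def)
    moreover have "\<not> i < m"
      using no Eps \<open>1 \<le> i\<close> order unfolding admissible_order_def by metis
    ultimately show ?thesis using Eps by simp
  next
    case (Del i)
    then have "1 \<le> i" "i \<le> n" using b by (auto simp: bvecs_def)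
    moreover have "\<not> i < n"
      using no Del \<open>1 \<le> i\<close> order unfolding admissible_order_def by metis
    ultimately show ?thesis using Del by simp
  qed
qed

section \<open>Cartan matrix and parities\<close>

abbreviation "N \<equiv> m + n"

text \<open>The value of the form on the \<open>i\<close>-th basis vector and the parity of \<open>\<Phi>\<^sub>i\<close>, both
  extended by 0. With a zero vector at position \<open>m + n + 1\<close>, the last simple root is a difference
  of consecutive basis vectors like all the others.\<close>

definition sq_norm :: "nat \<Rightarrow> int" where
  "sq_norm i = (if i \<in> {1..N} then - ((-1) ^ parPhi m n r i) else 0)"

definition phi_parity :: "nat \<Rightarrow> nat" where
  "phi_parity i = (if i \<in> {1..N} then parPhi m n r i else 0)"

lemma phi_parity_cases: "phi_parity i = 0 \<or> phi_parity i = Suc 0"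
  by (simp add: phi_parity_def parPhi_def)

lemma sq_norm_eq: "i \<in> {1..N} \<Longrightarrow> sq_norm i = (if phi_parity i = 0 then -1 else 1)"
  by (simp add: phi_parity_def sq_norm_def parPhi_def)

lemma sq_norm_out: "i \<notin> {1..N} \<Longrightarrow> sq_norm i = 0"
  by (simp only: sq_norm_def if_False)

lemma bform_ob:
  assumes "i \<in> {1..N}" "j \<in> {1..N}"
  shows "bform m n (Poly_Mapping.single (ob m n r i) 1) (Poly_Mapping.single (ob m n r j) 1) =
    of_int (if i = j then sq_norm i else 0)"
proof (cases "i = j")
  case True
  then show ?thesis
    using ob_mem[OF assms(1)] assms(1)
    by (cases "ob m n r i")
       (auto simp: bform_def lookup_single when_def bvecs_def sq_norm_def parPhi_def if_distrib[of "\<lambda>x. x * _"]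
          sum.delta' sum.delta cong: if_cong)
next
  case False
  then have "ob m n r i \<noteq> ob m n r j" using ob_eq_iff assms by blast
  then have *: "Poly_Mapping.lookup (Poly_Mapping.single (ob m n r i) (1 :: real)) c *
      Poly_Mapping.lookup (Poly_Mapping.single (ob m n r j) 1) c = 0" for c
    by (auto simp: lookup_single when_def)
  show ?thesis
    using False by (simp add: bform_def *)
qed

lemma bform_diff:
  "bform m n (x - y) z = bform m n x z - bform m n y z"
  "bform m n z (x - y) = bform m n z x - bform m n z y"
  by (simp_all add: bform_def lookup_minus algebra_simps sum_subtractf)

text \<open>The form on the simple roots, as an integer.\<close>

definition root_form :: "nat \<Rightarrow> nat \<Rightarrow> int" where
  "root_form i j = (if i = j then sq_norm i + sq_norm (i + 1) else if j = i + 1 then - sq_norm j else if i = j + 1 then - sq_norm i else 0)"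

lemma bform_alpha:
  assumes "i \<in> {1..N}" "j \<in> {1..N}"
  shows "bform m n (alpha m n r i) (alpha m n r j) = of_int (root_form i j)"
proof -
  consider "i = j" | "j = i + 1" | "i = j + 1" | "i \<noteq> j" "j \<noteq> i + 1" "i \<noteq> j + 1" by blast
  then show ?thesis
    using assms by cases (auto simp: alpha_def bform_diff bform_ob root_form_def sq_norm_out)
qed

lemma Theta_iff:
  assumes "i \<in> {1..N}"
  shows "i \<in> Theta m n r \<longleftrightarrow> phi_parity i \<noteq> phi_parity (i + 1)"
proof (cases "i = N")
  case True
  then show ?thesis using assms ob_last m by (auto simp: Theta_def Idx_def phi_parity_def parPhi_def)
next
  case False
  then show ?thesis using assms by (auto simp: Theta_def Idx_def phi_parity_def parPhi_def)
qed

lemma par_eq: "i \<in> {1..N} \<Longrightarrow> par m n r i = (if phi_parity i = phi_parity (i + 1) then 0 else 1)"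
  by (simp add: par_def Theta_iff)

lemma root_form_self:
  assumes "i \<in> {1..N}"
  shows "root_form i i = (if i = N then sq_norm N else if phi_parity i = phi_parity (i + 1) then 2 * sq_norm i else 0)"
  using assms phi_parity_cases[of i] phi_parity_cases[of "i + 1"] by (auto simp: root_form_def sq_norm_eq sq_norm_out)

lemma root_form_self_eq_0: "i \<in> {1..N} \<Longrightarrow> root_form i i = 0 \<longleftrightarrow> i < N \<and> phi_parity i \<noteq> phi_parity (i + 1)"
  by (auto simp: root_form_self sq_norm_eq)

lemma cartan_diag:
  assumes "i \<in> {1..N}"
  shows "cartan m n r i i = (if i < N \<and> phi_parity i \<noteq> phi_parity (i + 1) then 0 else 2)"
  using assms by (simp add: cartan_def bform_alpha root_form_self_eq_0)

lemma cartan_off_diag: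
  assumes i: "i \<in> {1..N}" and j: "j \<in> {1..N}" and "i \<noteq> j" and eq: "i = N \<or> phi_parity i = phi_parity (i + 1)"
  shows "cartan m n r i j =
    (if j = i + 1 then -1 else if i = j + 1 then (if i = N then -2 else -1) else 0)"
proof -
  have sq_norm: "sq_norm i \<noteq> 0" using sq_norm_eq[OF i] by simp
  have root_form_ii: "root_form i i = (if i = N then 1 else 2) * sq_norm i" using root_form_self[OF i] eq by auto
  have root_form_ij: "root_form i j = (if j = i + 1 then - sq_norm i else if i = j + 1 then - sq_norm i else 0)"
    using sq_norm_eq[OF i] sq_norm_eq[OF j] eq j \<open>i \<noteq> j\<close> by (auto simp: root_form_def)
  then show ?thesis
    unfolding cartan_def bform_alpha[OF i i] bform_alpha[OF i j] root_form_ii root_form_ij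
    using sq_norm j by auto
qed

lemma root_form_self_cases:
  assumes "i \<in> {1..N}"
  shows "root_form i i \<in> {0, 1, -1, 2, -2}"
  using assms by (simp add: root_form_self sq_norm_eq)

lemma qi_eq:
  assumes "i \<in> {1..N}"
  shows "qi m n r i = q_half powi (if root_form i i = 0 then -2 else root_form i i)"
proof -
  have "2 * dd m n r i = of_int (if root_form i i = 0 then -2 else root_form i i)"
    using assms by (simp add: dd_def bform_alpha)
  then show ?thesis unfolding qi_def by (simp only: floor_of_int)
qed

lemma q_half_powi_double: "q_half powi (2 * k) = qq powi k"
  unfolding power_int_mult qq_def power_int_numeral ..

text \<open>In all cases of the definitions of \<open>cartan\<close> and \<open>dd\<close> one has \<open>d\<^sub>i a\<^sub>i\<^sub>j = (\<alpha>\<^sub>i, \<alpha>\<^sub>j)\<close>, also for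
  isotropic roots. For the last root \<open>2 d\<^sub>i = \<plusminus>1\<close>, which is why powers of \<open>q_half\<close> occur.\<close>

lemma qi_powi_cartan:
  assumes "i \<in> {1..N}" "j \<in> {1..N}"
  shows "qi m n r i powi \<lfloor>cartan m n r i j\<rfloor> = qq powi root_form i j"
proof -
  let ?d = "if root_form i i = 0 then -2 else root_form i i"
  have "cartan m n r i j = (if root_form i i = 0 then - of_int (root_form i j) else 2 * of_int (root_form i j) / of_int (root_form i i))"
    using assms by (simp add: cartan_def bform_alpha)
  then have "\<exists>k. cartan m n r i j = of_int k \<and> ?d * k = 2 * root_form i j"
    using root_form_self_cases[OF assms(1)]
    by (elim insertE emptyE)
       (auto intro: exI[of _ "root_form i j"] exI[of _ "- root_form i j"] exI[of _ "2 * root_form i j"] exI[of _ "- 2 * root_form i j"])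
  then obtain k where k: "cartan m n r i j = of_int k" "?d * k = 2 * root_form i j" by blast
  have "qi m n r i powi \<lfloor>cartan m n r i j\<rfloor> = q_half powi (?d * k)"
    unfolding qi_eq[OF assms(1)] power_int_mult k(1) floor_of_int ..
  then show ?thesis by (simp only: k(2) q_half_powi_double)
qed

end

section \<open>Serre relations for products of ladder operators\<close>

text \<open>What the Serre relations need to know about creation and annihilation operators. The relation
  \<open>boson\<close> is the quantum Serre relation of type \<open>A\<^sub>2\<close> for \<open>x i\<close> and \<open>y i\<close>, solved for one monomial so
  that it can be used for rewriting. Index \<open>N + 1\<close> carries the action of the unit; it makes the
  last generator an instance of the definition of \<open>E\<close>. The assumptions are homogeneous in \<open>x\<close> and
  \<open>y\<close> and symmetric in them.\<close>

locale ladder = vector_space scale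
  for scale :: "kq \<Rightarrow> 'v::ab_group_add \<Rightarrow> 'v" +
  fixes N :: nat and p :: "nat \<Rightarrow> nat" and q :: kq and x y :: "nat \<Rightarrow> 'v \<Rightarrow> 'v"
  assumes q_nz: "q \<noteq> 0"
    and parity: "p i = 0 \<or> p i = Suc 0"
    and lin: "x i (u + v) = x i u + x i v" "y i (u + v) = y i u + y i v"
      "x i (scale c v) = scale c (x i v)" "y i (scale c v) = scale c (y i v)"
    and comm: "\<lbrakk>1 \<le> i; i < j; j \<le> N + 1\<rbrakk> \<Longrightarrow> x j (x i v) = scale ((-1) ^ (p i * p j)) (x i (x j v))"
      "\<lbrakk>1 \<le> i; i < j; j \<le> N + 1\<rbrakk> \<Longrightarrow> x j (y i v) = scale ((-1) ^ (p i * p j)) (y i (x j v))"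
      "\<lbrakk>1 \<le> i; i < j; j \<le> N + 1\<rbrakk> \<Longrightarrow> y j (x i v) = scale ((-1) ^ (p i * p j)) (x i (y j v))"
      "\<lbrakk>1 \<le> i; i < j; j \<le> N + 1\<rbrakk> \<Longrightarrow> y j (y i v) = scale ((-1) ^ (p i * p j)) (y i (y j v))"
    and boson: "\<lbrakk>1 \<le> i; i \<le> N; p i = 0\<rbrakk> \<Longrightarrow>
        x i (x i (y i v)) = scale (q + inverse q) (x i (y i (x i v))) - y i (x i (x i v))"
      "\<lbrakk>1 \<le> i; i \<le> N; p i = 0\<rbrakk> \<Longrightarrow>
        x i (y i (y i v)) = scale (q + inverse q) (y i (x i (y i v))) - y i (y i (x i v))"
    and fermion: "\<lbrakk>1 \<le> i; i \<le> N; p i = Suc 0\<rbrakk> \<Longrightarrow> x i (x i v) = 0"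
      "\<lbrakk>1 \<le> i; i \<le> N; p i = Suc 0\<rbrakk> \<Longrightarrow> y i (y i v) = 0"
    and top: "p (Suc N) = 0" "x (Suc N) (x i v) = x i v" "x (Suc N) (y i v) = y i v"
      "y (Suc N) = x (Suc N)"
begin

lemma lin_more:
  "x i 0 = 0" "y i 0 = 0" "x i (- v) = - x i v" "y i (- v) = - y i v"
  "x i (u - v) = x i u - x i v" "y i (u - v) = y i u - y i v"
proof -
  show z: "x i 0 = 0" "y i 0 = 0" using lin(1)[of i 0 0] lin(2)[of i 0 0] by simp_all
  show m: "x i (- v) = - x i v" "y i (- v) = - y i v" for v
    using lin(1)[of i v "- v"] lin(2)[of i v "- v"] z by (simp_all add: add_eq_0_iff)
  show "x i (u - v) = x i u - x i v" "y i (u - v) = y i u - y i v"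
    using lin(1)[of i u "- v"] lin(2)[of i u "- v"] m by simp_all
qed

definition E :: "nat \<Rightarrow> 'v \<Rightarrow> 'v" where
  "E i v = x i (y (Suc i) v)"

definition par :: "nat \<Rightarrow> nat" where
  "par i = (if p i = p (Suc i) then 0 else 1)"

lemma E_supercommute_right:
  assumes "1 \<le> i" "Suc i < j" "j \<le> N"
  shows "E i (E j v) = scale ((-1) ^ (par i * par j)) (E j (E i v))"
proof -
  obtain i' j' where ij': "i' = Suc i" "j' = Suc j" by blast
  have ij: "i < j" "j \<le> N + 1" "i < j'" "j' \<le> N + 1" "1 \<le> i'" "i' < j" "i' < j'"
    using assms ij' by auto
  have E: "E i v = x i (y i' v)" "E j v = x j (y j' v)" for v
    by (simp_all add: E_def ij')
  have par: "par i = (if p i = p i' then 0 else 1)" "par j = (if p j = p j' then 0 else 1)"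
    by (simp_all add: par_def ij')
  note cm = comm[of i j, OF assms(1) ij(1,2)] comm[of i j', OF assms(1) ij(3,4)]
    comm[of i' j, OF ij(5,6,2)] comm[of i' j', OF ij(5,7,4)]
  show ?thesis
    unfolding E par using parity[of i] parity[of i'] parity[of j] parity[of j']
    by (elim disjE; simp add: cm lin lin_more)
qed

lemma E_serre2:
  assumes "1 \<le> i" "j = Suc i" "j \<le> N"
  shows E_serre2_right: "p i = p j \<Longrightarrow>
      E j (E i (E i v)) - scale (q + inverse q) (E i (E j (E i v))) + E i (E i (E j v)) = 0"
    and E_serre2_left: "j < N \<Longrightarrow> p j = p (Suc j) \<Longrightarrow>
      E i (E j (E j v)) - scale (q + inverse q) (E j (E i (E j v))) + E j (E j (E i v)) = 0"
proof -
  define \<beta> where "\<beta> = q + inverse q"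
  obtain k where k: "k = Suc j" by blast
  have ij: "i < j" "j \<le> N + 1" "i < k" "k \<le> N + 1" "1 \<le> j" "j < k" "i \<le> N"
    using assms k by auto
  have E: "E i v = x i (y j v)" "E j v = x j (y k v)" for v
    by (simp_all add: E_def assms(2) k)
  note cm = comm[of i j, OF assms(1) ij(1,2)] comm[of i k, OF assms(1) ij(3,4)]
    comm[of j k, OF ij(5,6,4)]
  note f = boson[of j, folded \<beta>_def, OF ij(5) assms(3)] fermion[of j, OF ij(5) assms(3)]
    fermion[of i, OF assms(1) ij(7)]
  show "E j (E i (E i v)) - scale (q + inverse q) (E i (E j (E i v))) + E i (E i (E j v)) = 0"
    if "p i = p j"
    unfolding \<beta>_def[symmetric] E using parity[of j] parity[of k]
    by (elim disjE; simp add: cm lin lin_more f that; simp add: algebra_simps)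
  show "E i (E j (E j v)) - scale (q + inverse q) (E j (E i (E j v))) + E j (E j (E i v)) = 0"
    if "j < N" and jk: "p j = p (Suc j)"
  proof -
    have "1 \<le> k" "k \<le> N" using that k by auto
    note f' = f fermion[of k, OF this]
    have "p k = p j" using jk k by simp
    then show ?thesis
      unfolding \<beta>_def[symmetric] E using parity[of i] parity[of j]
      by (elim disjE; simp add: cm lin lin_more f'; simp add: algebra_simps)
  qed
qed

lemma E_sq:
  assumes "1 \<le> i" "i \<le> N" "p i \<noteq> p (Suc i)"
  shows "E i (E i v) = 0"
proof -
  obtain j where j: "j = Suc i" by blast
  have ij: "i < j" "j \<le> N + 1" "1 \<le> j" using assms j by auto
  note cm = comm[of i j, OF assms(1) ij(1,2)]
  have E: "E i v = x i (y j v)" for v by (simp add: E_def j)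
  consider "p i = Suc 0" | "p i = 0" "p j = Suc 0"
    using parity[of i] parity[of j] assms(3) j by auto
  then show ?thesis
  proof cases
    case 1
    then show ?thesis by (simp add: E cm lin lin_more fermion(1)[OF assms(1,2)])
  next
    case 2
    then have "j \<le> N" using ij(2) top(1) by (cases "j = Suc N") auto
    then show ?thesis using 2 by (simp add: E cm lin lin_more fermion(2)[OF ij(3)])
  qed
qed

text \<open>The short root has no partner on its right, so this is the relation of length three between
  \<open>x N\<close> and \<open>y N\<close>. With \<open>\<beta> = q + q\<^sup>-\<^sup>1\<close> the quantum integer \<open>[3]\<close> at \<open>q\<^sup>1\<^sup>/\<^sup>2\<close> is \<open>\<beta> + 1\<close>, and applying
  \<open>boson\<close> twice brings every monomial into the span of \<open>xyxx\<close> and \<open>yxxx\<close>.\<close>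

lemma E_serre3:
  assumes "1 \<le> i" "N = Suc i" "p N = 0"
  shows "E i (E N (E N (E N v))) - scale (q + inverse q + 1) (E N (E i (E N (E N v))))
   + scale (q + inverse q + 1) (E N (E N (E i (E N v)))) - E N (E N (E N (E i v))) = 0"
proof -
  \<comment> \<open>Only \<open>\<beta>\<close> occurs in the cancellation; the identity is polynomial in it.\<close>
  define \<beta> where "\<beta> = q + inverse q"
  have ij: "i < N" "N < Suc N" "i < Suc N" "1 \<le> N" "N \<le> N + 1" "Suc N \<le> N + 1" using assms by auto
  have E: "E i v = x i (y N v)" "E N v = x N (y (Suc N) v)" for v
    using assms(2) by (simp_all add: E_def)
  note cm = comm[of i N, OF assms(1) ij(1,5)] comm[of i "Suc N", OF assms(1) ij(3,6)]
    comm[of N "Suc N", OF ij(4,2,6)]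
  note f = boson[of N, folded \<beta>_def, OF ij(4) order_refl assms(3)]
  show ?thesis
    using parity[of i] unfolding \<beta>_def[symmetric] E
    by (elim disjE; simp add: cm lin lin_more f assms(3) top(1); simp add: algebra_simps)
qed

text \<open>Sorting by index splits every monomial into a word in the operators of index \<open>j\<close> and one in
  those of index \<open>k\<close>. One of the two indices is fermionic, and there only words alternating
  between \<open>x\<close> and \<open>y\<close> survive; at the bosonic index \<open>boson\<close> reduces three words to two. What
  remains cancels, because the two coefficients \<open>q\<close> and \<open>q\<^sup>-\<^sup>1\<close> belong to indices of opposite
  parity.\<close>

lemma E_higher:
  fixes i j k :: nat
  assumes "1 \<le> i" and j: "j = Suc i" and k: "k = Suc j" and "j < N" and jk: "p j \<noteq> p k"
  defines "b \<equiv> \<lambda>v. E j (E k v) - scale ((-1) ^ par k * (if p k = 0 then q else inverse q)) (E k (E j v))"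
  defines "h \<equiv> \<lambda>v. E i (b v) - scale ((-1) ^ (par i * (1 + par k)) * (if p j = 0 then q else inverse q)) (b (E i v))"
  shows "E j (h v) + scale ((-1) ^ (par i + par k)) (h (E j v)) = 0"
proof -
  obtain l where l: "l = Suc k" by blast
  have ij: "i < j" "j < k" "k < l" "i < k" "i < l" "j < l" "j \<le> N + 1" "k \<le> N + 1" "l \<le> N + 1"
      "1 \<le> j" "1 \<le> k" "j \<le> N" "k \<le> N"
    using assms(1,4) j k l by auto
  have E: "E i v = x i (y j v)" "E j v = x j (y k v)" "E k v = x k (y l v)" for v
    by (simp_all add: E_def j k l)
  have par: "par i = (if p i = p j then 0 else 1)" "par k = (if p k = p l then 0 else 1)"
    by (simp_all add: par_def j l)
  note cm = comm[of i j, OF assms(1) ij(1) ij(7)]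
    comm[of i k, OF assms(1) ij(4) ij(8)]
    comm[of i l, OF assms(1) ij(5) ij(9)]
    comm[of j k, OF ij(10) ij(2) ij(8)]
    comm[of j l, OF ij(10) ij(6) ij(9)]
    comm[of k l, OF ij(11) ij(3) ij(9)]
  note fj = fermion[of j, OF ij(10) ij(12)] boson[of j, OF ij(10) ij(12)]
  note fk = fermion[of k, OF ij(11) ij(13)] boson[of k, OF ij(11) ij(13)]
  consider "p j = 0" "p k = Suc 0" | "p j = Suc 0" "p k = 0" using jk parity[of j] parity[of k] by auto
  then show ?thesis
  proof cases
    case 1
    note f = fj(3-4)[OF 1(1)] fk(1-2)[OF 1(2)]
    show ?thesis
      unfolding h_def b_def E par
      using parity[of i] parity[of l]
      by (elim disjE; simp add: 1 q_nz cm lin lin_more f scale_left_distrib scale_right_distrib scale_right_diff_distrib)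
  next
    case 2
    note f = fj(1-2)[OF 2(1)] fk(3-4)[OF 2(2)]
    show ?thesis
      unfolding h_def b_def E par
      using parity[of i] parity[of l]
      by (elim disjE; simp add: 2 q_nz cm lin lin_more f scale_left_distrib scale_right_distrib scale_right_diff_distrib)
  qed
qed

lemma ladder_swap: "ladder scale N p q y x"
proof (intro ladder.intro ladder_axioms.intro)
  show "vector_space scale" by (rule vector_space_axioms)
  show "y i (y i (x i v)) = scale (q + inverse q) (y i (x i (y i v))) - x i (y i (y i v))"
    "y i (x i (x i v)) = scale (q + inverse q) (x i (y i (x i v))) - x i (x i (y i v))"
    if "1 \<le> i" "i \<le> N" "p i = 0" for i v
    using boson[OF that, of v] by simp_all
qed (use q_nz parity lin comm fermion top in \<open>simp_all\<close>)

text \<open>The scalar \<open>c i\<close> absorbs the normalisation of the last \<open>e\<close> and the signs in the \<open>f\<close>.\<close>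

lemma ladder_rescale:
  assumes "c (Suc N) = 1"
  shows "ladder scale N p q (\<lambda>i v. scale (c i) (x i v)) y"
proof (intro ladder.intro ladder_axioms.intro)
  show "vector_space scale" by (rule vector_space_axioms)
  show "p i = 0 \<or> p i = Suc 0" for i by (rule parity)
qed (use q_nz assms in \<open>simp_all add: lin comm fermion boson top scale_right_distrib
  scale_right_diff_distrib mult.commute mult.left_commute\<close>)

end

section \<open>Quantum integers away from roots of unity\<close>

lemma q_half_power_neq_1: "k > 0 \<Longrightarrow> q_half ^ k \<noteq> 1"
proof
  assume "k > 0" "q_half ^ k = 1"
  have "q_half ^ k = Fract ([:0, 1:] ^ k) 1"
    by (induction k) (simp_all add: q_half_def One_fract_def)
  with \<open>q_half ^ k = 1\<close> have "[:0, 1:] ^ k = (1 :: complex poly)"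
    by (simp add: One_fract_def eq_fract)
  then have "degree ([:0, 1:] ^ k :: complex poly) = 0" by simp
  with \<open>k > 0\<close> show False by (simp add: degree_power_eq)
qed

lemma q_half_neq_0: "q_half \<noteq> 0"
  by (simp add: q_half_def Zero_fract_def eq_fract)

lemma qq_neq_0: "qq \<noteq> 0"
  by (simp add: qq_def q_half_neq_0)

lemma two_neq_0: "(2 :: kq) \<noteq> 0"
proof
  assume "(2 :: kq) = 0"
  moreover have "(2 :: kq) = Fract 2 1"
    by (simp only: one_add_one[symmetric] One_fract_def add_fract) simp
  ultimately have "Fract (2 :: complex poly) 1 = Fract 0 1" by (simp only: Zero_fract_def)
  then show False by (simp add: eq_fract)
qed

context
  fixes p :: kq
  assumes nz: "p \<noteq> 0" and no_root: "\<forall>k>0. p ^ k \<noteq> 1"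
begin

lemma diff_inverse_neq_0: "p - inverse p \<noteq> 0"
  using no_root[rule_format, of 2] nz by (auto simp: field_simps power2_eq_square)

lemma add_inverse_neq_0: "p + inverse p \<noteq> 0"
proof
  assume "p + inverse p = 0"
  then have "p ^ 2 = -1" using nz by (simp add: field_simps power2_eq_square eq_neg_iff_add_eq_0)
  then have "p ^ 4 = 1" using power_mult[of p 2 2] by simp
  then show False using no_root[rule_format, of 4] by simp
qed

lemma qnum_small: "qnum p (Suc 0) = 1" "qnum p 2 = p + inverse p" "qnum p 3 = p ^ 2 + inverse p ^ 2 + 1"
proof -
  note d = diff_inverse_neq_0
  show "qnum p (Suc 0) = 1" using d by (simp add: qnum_def)
  have "p ^ 2 - inverse p ^ 2 = (p + inverse p) * (p - inverse p)"
    by (simp add: algebra_simps power2_eq_square)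
  then show "qnum p 2 = p + inverse p" using d by (simp add: qnum_def)
  obtain y where y: "inverse p = y" by blast
  have "p * y = 1" using nz by (simp flip: y)
  moreover have "(p ^ 2 + y ^ 2 + 1) * (p - y) = p ^ 3 - y ^ 3 + (p * y) * (y - p) + (p - y)"
    by (simp add: algebra_simps power2_eq_square power3_eq_cube)
  ultimately have "p ^ 3 - y ^ 3 = (p ^ 2 + y ^ 2 + 1) * (p - y)" by simp
  then have "p ^ 3 - inverse p ^ 3 = (p ^ 2 + inverse p ^ 2 + 1) * (p - inverse p)" by (simp only: y)
  then show "qnum p 3 = p ^ 2 + inverse p ^ 2 + 1" using d by (simp add: qnum_def)
qed

lemma qnum_3_neq_0: "p ^ 2 + inverse p ^ 2 + 1 \<noteq> 0"
proof
  obtain y where y: "inverse p = y" by blast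
  assume "p ^ 2 + inverse p ^ 2 + 1 = 0"
  then have "p ^ 2 + y ^ 2 + 1 = 0" by (simp only: y)
  moreover have "p * y = 1" using nz by (simp flip: y)
  moreover have "p ^ 2 * (p ^ 2 + y ^ 2 + 1) = p ^ 4 + (p * y) ^ 2 + p ^ 2"
    by (simp add: algebra_simps power_mult_distrib flip: power_add)
  ultimately have "p ^ 4 + 1 + p ^ 2 = 0" by simp
  moreover have "p ^ 6 - 1 = (p ^ 2 - 1) * (p ^ 4 + 1 + p ^ 2)"
    by (simp add: algebra_simps flip: power_add)
  ultimately have "p ^ 6 = 1" by simp
  then show False using no_root[rule_format, of 6] by simp
qed

text \<open>Only these lengths occur, since the off-diagonal entries of the Cartan matrix in rows of
  nonisotropic roots are 0, -1 and -2.\<close>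

lemma serre_small:
  "serre p (Suc 0) a b = b * a - a * b"
  "serre p 2 a b = b * a * a - (p + inverse p) *\<^sub>k (a * b * a) + a * a * b"
  "serre p 3 a b = b * a * a * a - (p ^ 2 + inverse p ^ 2 + 1) *\<^sub>k (a * b * a * a)
     + (p ^ 2 + inverse p ^ 2 + 1) *\<^sub>k (a * a * b * a) - a * a * a * b"
proof -
  have f: "qfact p 0 = 1" "qfact p (Suc 0) = 1" "qfact p 2 = p + inverse p"
    "qfact p 3 = (p + inverse p) * (p ^ 2 + inverse p ^ 2 + 1)"
    using qnum_small
    by (simp_all add: qfact_def numeral_2_eq_2 numeral_3_eq_3 prod.atLeast_Suc_atMost[symmetric] atLeastAtMostSuc_conv mult.commute)
  have b: "qbinom p (Suc 0) 0 = 1" "qbinom p (Suc 0) (Suc 0) = 1"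
    "qbinom p 2 0 = 1" "qbinom p 2 (Suc 0) = p + inverse p" "qbinom p 2 2 = 1"
    "qbinom p 3 0 = 1" "qbinom p 3 (Suc 0) = p ^ 2 + inverse p ^ 2 + 1"
    "qbinom p 3 2 = p ^ 2 + inverse p ^ 2 + 1" "qbinom p 3 3 = 1"
    using add_inverse_neq_0 qnum_3_neq_0 by (simp_all add: qbinom_def f)
  obtain c d where c: "p + inverse p = c" and d: "p ^ 2 + inverse p ^ 2 + 1 = d" by blast
  note b' = b[unfolded c d, unfolded numeral_2_eq_2 numeral_3_eq_3]
  show "serre p (Suc 0) a b = b * a - a * b"
    by (simp add: serre_def b')
  show "serre p 2 a b = b * a * a - (p + inverse p) *\<^sub>k (a * b * a) + a * a * b"
    unfolding c numeral_2_eq_2 by (simp add: serre_def b' mult.assoc)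
  show "serre p 3 a b = b * a * a * a - (p ^ 2 + inverse p ^ 2 + 1) *\<^sub>k (a * b * a * a)
     + (p ^ 2 + inverse p ^ 2 + 1) *\<^sub>k (a * a * b * a) - a * a * a * b"
    unfolding d unfolding numeral_3_eq_3 by (simp add: serre_def b' mult.assoc)
qed

lemma serre'_small: "serre' p (Suc 0) t a b = b * a - (-1) ^ t *\<^sub>k (a * b)"
proof -
  have f: "qfact' p 0 = 1" "qfact' p (Suc 0) = 1"
    using add_inverse_neq_0 by (simp_all add: qfact'_def qnum'_def inverse_minus_eq)
  show ?thesis by (simp add: serre'_def qbinom'_def f)
qed

end

lemma q_half_powi_neq_1:
  assumes "z \<noteq> 0" shows "q_half powi z \<noteq> 1"
proof (cases "z > 0")
  case True
  then show ?thesis using q_half_power_neq_1[of "nat z"] by (simp add: power_int_def)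
next
  case False
  then show ?thesis using q_half_power_neq_1[of "nat (- z)"] assms
    by (simp add: power_int_def power_inverse)
qed

lemma q_half_powi_no_root:
  assumes "z \<noteq> 0" shows "\<forall>k>0. (q_half powi z) ^ k \<noteq> 1"
proof (intro allI impI)
  fix k :: nat assume "k > 0"
  then show "(q_half powi z) ^ k \<noteq> 1"
    using q_half_powi_neq_1[of "z * int k"] assms by (simp add: power_int_mult)
qed

section \<open>The Serre relations in a Clifford module\<close>

text \<open>Here \<open>g\<close> is one of the two families \<open>e\<close> and \<open>f\<close>, and \<open>h\<close> the assignment on the generators.\<close>

locale spinor_ladder = ordered_basis m n r + free_rep scale A + ladder scale "m + n" "phi_parity" qq x y
  for m n r scale and A :: "cl_gen free \<Rightarrow> 'v \<Rightarrow> 'v::ab_group_add" and x y +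
  fixes h :: "osp_gen \<Rightarrow> cl_gen free" and g :: "nat \<Rightarrow> osp_gen free"
  assumes E_rep: "i \<in> {1..N} \<Longrightarrow> A (free_ext h (g i)) v = E i v"
begin

lemma par_E: "i \<in> {1..N} \<Longrightarrow> Defs.par m n r i = par i"
  by (simp add: par_eq par_def)

lemmas rep_simps = free_ext_simps rep_add rep_diff rep_mult rep_scal

lemma qi_inverse:
  assumes "i \<in> {1..N}" "phi_parity i = phi_parity (i + 1)"  "i < N"
  shows "qi m n r i + inverse (qi m n r i) = qq + inverse qq"
  using assms root_form_self[OF assms(1)] sq_norm_eq[OF assms(1)]
  by (auto simp: qi_eq q_half_powi_double power_int_minus)

lemma qi_inverse_last:
  shows "qi m n r N ^ 2 + inverse (qi m n r N) ^ 2 + 1 = qq + inverse qq + 1"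
proof -
  have "N \<in> {1..N}" using m by simp
  then show ?thesis
    using root_form_self[of N] sq_norm_eq[of N]
    by (simp add: qi_eq qq_def power_inverse split: if_splits)
qed

lemma E_supercommute:
  assumes "i \<in> {1..N}" "j \<in> {1..N}" "i \<noteq> j" "j \<noteq> Suc i" "i \<noteq> Suc j"
  shows "E i (E j v) = scale ((-1) ^ (par i * par j)) (E j (E i v))"
proof (cases "i < j")
  case True
  then show ?thesis using assms by (intro E_supercommute_right) auto
next
  case False
  have "E i (E j v) = scale ((-1) ^ (par i * par j)) (scale ((-1) ^ (par j * par i)) (E i (E j v)))"
    by (simp add: mult.commute flip: power_add)
  then show ?thesis using False assms E_supercommute_right[of j i v] by simp
qed

lemma serre_even:
  assumes i: "i \<in> {1..N}" and j: "j \<in> {1..N}" and iT: "i \<notin> Theta m n r" and ij: "j \<noteq> i"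
  shows "A (free_ext h (serre (qi m n r i) (nat \<lfloor>1 - cartan m n r i j\<rfloor>) (g i) (g j))) v = 0"
proof -
  have phi_parity: "phi_parity i = phi_parity (i + 1)" using iT i Theta_iff by blast
  have "(if root_form i i = 0 then - 2 else root_form i i) \<noteq> 0" by simp
  note nz = q_half_powi_no_root[OF this, folded qi_eq[OF i]]
  have qi0: "qi m n r i \<noteq> 0" by (simp add: qi_eq[OF i] q_half_neq_0)
  note serre = serre_small[of "qi m n r i", OF qi0 nz]
  have par: "par i = 0" using phi_parity by (simp add: par_def)
  have E: "A (free_ext h (g i)) w = E i w" "A (free_ext h (g j)) w = E j w" for w
    using E_rep i j by blast+
  note cartan = cartan_off_diag[OF i j ij[symmetric] disjI2[OF phi_parity]]
  consider "j = Suc i" | "i = Suc j" "i < N" | "i = Suc j" "i = N" | "j \<noteq> Suc i" "i \<noteq> Suc j"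
    using i by fastforce
  then show ?thesis
  proof cases
    case 1
    then have n: "nat \<lfloor>1 - cartan m n r i j\<rfloor> = 2" using cartan by simp
    have "i < N" using 1 j by simp
    note q = qi_inverse[OF i phi_parity this]
    have "1 \<le> i" "j \<le> N" using i j by auto
    from E_serre2_right[OF this(1) 1 this(2)] phi_parity 1 show ?thesis
      unfolding n serre q by (simp add: rep_simps E E[unfolded 1])
  next
    case 2
    then have n: "nat \<lfloor>1 - cartan m n r i j\<rfloor> = 2" using cartan by simp
    note q = qi_inverse[OF i phi_parity 2(2)]
    have "1 \<le> j" "i \<le> N" using i j by auto
    from E_serre2_left[OF this(1) 2(1) this(2)] phi_parity 2 show ?thesis
      unfolding n serre q by (simp add: rep_simps E E[unfolded 2(1)])
  next
    case 3
    then have n: "nat \<lfloor>1 - cartan m n r i j\<rfloor> = 3" using cartan by simp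
    have q: "qi m n r i ^ 2 + inverse (qi m n r i) ^ 2 + 1 = qq + inverse qq + 1"
      using qi_inverse_last 3 by simp
    have "1 \<le> j" "N = Suc j" "phi_parity N = 0" using j 3 phi_parity top(1) by auto
    from E_serre3[OF this, of v] show ?thesis
      unfolding n serre q unfolding 3(2) by (simp add: rep_simps E E[unfolded 3(2)])
  next
    case 4
    then have n: "nat \<lfloor>1 - cartan m n r i j\<rfloor> = Suc 0" using cartan by simp
    show ?thesis
      unfolding n serre using E_supercommute[OF i j ij[symmetric] 4, of v] by (simp add: rep_simps E par)
  qed
qed

text \<open>The only odd nonisotropic simple root is the last one. For an adjacent root every term of
  the relation contains the square of the last generator, which acts as 0 whatever the
  coefficients are.\<close>

lemma serre_odd:
  assumes s: "s \<in> Theta m n r" "cartan m n r s s = 2" and j: "j \<in> {1..N}" and sj: "j \<noteq> s"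
  shows "A (free_ext h (serre' (qi m n r s) (nat \<lfloor>1 - cartan m n r s j\<rfloor>) (Defs.par m n r j) (g s) (g j))) v = 0"
proof -
  have sI: "s \<in> {1..N}" using s(1) by (simp add: Theta_def Idx_def)
  have phi_parity: "phi_parity s \<noteq> phi_parity (s + 1)" using s(1) sI Theta_iff by blast
  then have sN: "s = N" using s(2) cartan_diag[OF sI] sI by (auto split: if_splits)
  have par: "par s = 1" using phi_parity by (simp add: par_def)
  have "(if root_form s s = 0 then - 2 else root_form s s) \<noteq> 0" by simp
  note nz = q_half_powi_no_root[OF this, folded qi_eq[OF sI]]
  have qi0: "qi m n r s \<noteq> 0" by (simp add: qi_eq[OF sI] q_half_neq_0)
  note cartan = cartan_off_diag[OF sI j sj[symmetric] disjI1[OF sN]]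
  have gs: "A (free_ext h (g s)) w = E s w" and gj: "A (free_ext h (g j)) w = E j w" for w
    using E_rep sI j by blast+
  have sq: "E s (E s v) = 0" for v using E_sq[of s v] sI phi_parity by simp
  show ?thesis
  proof (cases "s = Suc j")
    case True
    then have n: "nat \<lfloor>1 - cartan m n r s j\<rfloor> = Suc (Suc (Suc 0))" using cartan sN by simp
    have E0: "E i 0 = 0" for i by (simp add: E_def lin_more)
    show ?thesis unfolding n serre'_def
      by (simp add: free_ext_simps rep_add rep_mult rep_scal rep_diff gs gj sq E0)
  next
    case False
    then have n: "nat \<lfloor>1 - cartan m n r s j\<rfloor> = Suc 0" using cartan sN j by simp
    have "j \<noteq> Suc s" using j sN by simp
    from E_supercommute[OF sI j sj[symmetric] this False, of v] show ?thesis
      unfolding n serre'_small[of "qi m n r s", OF qi0 nz]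
      by (simp add: rep_simps gs gj par par_E[OF j] flip: power_add mult_2)
  qed
qed

lemma serre_isotropic:
  assumes "s \<in> {1..N}" "cartan m n r s s = 0"
  shows "A (free_ext h (g s ^ 2)) v = 0"
proof -
  have "phi_parity s \<noteq> phi_parity (Suc s)" using assms cartan_diag[of s] by (auto split: if_splits)
  then show ?thesis using E_sq[of s v] assms E_rep[OF assms(1)] by (simp add: rep_simps power2_eq_square)
qed

text \<open>All three relations of higher order have this form. In the cases where \<open>s + 1\<close> is the last
  index, the parity of the last root is 0 or 1 according to the basis vector, which accounts for
  the sign in which the two relations differ.\<close>

lemma serre_higher:
  assumes "1 < s" "s + 1 \<le> N" "cartan m n r s s = 0"
  shows "A (free_ext h (g s * higher m n r g (s - 1) s (s + 1)
    + (-1) ^ (Defs.par m n r (s - 1) + Defs.par m n r (s + 1)) *\<^sub>k (higher m n r g (s - 1) s (s + 1) * g s))) v = 0"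
proof -
  obtain i k where i: "i = s - 1" and k: "k = s + 1" by blast
  have I: "i \<in> {1..N}" "s \<in> {1..N}" "k \<in> {1..N}" and s: "s = Suc i" and k': "k = Suc s"
    using assms i k by auto
  have phi_parity: "phi_parity s \<noteq> phi_parity k" using assms(3) k' cartan_diag[OF I(2)] by (auto split: if_splits)
  have c1: "qi m n r k powi \<lfloor>cartan m n r k s\<rfloor> = (if phi_parity k = 0 then qq else inverse qq)"
    unfolding qi_powi_cartan[OF I(3,2)] using sq_norm_eq[OF I(3)] by (simp add: root_form_def k')
  have "root_form i k = 0" by (simp add: root_form_def s k')
  then have "cartan m n r i k = 0" by (simp add: cartan_def bform_alpha[OF I(1,3)])
  then have c2: "qi m n r i powi \<lfloor>cartan m n r i s + cartan m n r i k\<rfloor> = (if phi_parity s = 0 then qq else inverse qq)"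
    using qi_powi_cartan[OF I(1,2)] sq_norm_eq[OF I(2)] by (simp add: root_form_def s)
  have "1 \<le> i" "s < N" using I k' by auto
  from E_higher[OF this(1) s k' this(2) phi_parity, of v]
  show ?thesis
    unfolding i[symmetric] k[symmetric]
    by (simp add: higher_def Let_def rep_simps c1 c2 E_rep[OF I(1)] E_rep[OF I(2)] E_rep[OF I(3)] par_E[OF I(1)] par_E[OF I(3)])
qed

theorem serre_rels_vanish:
  assumes "r' \<in> serre_rels m n r g"
  shows "A (free_ext h r') v = 0"
  using assms unfolding serre_rels_def
proof (elim UnE CollectE exE conjE)
  fix i j
  assume "r' = serre (qi m n r i) (nat \<lfloor>1 - cartan m n r i j\<rfloor>) (g i) (g j)"
    "i \<in> Idx m n" "j \<in> Idx m n" "i \<notin> Theta m n r" "j \<noteq> i"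
  then show ?thesis using serre_even unfolding Idx_def by blast
next
  fix s j
  assume "r' = serre' (qi m n r s) (nat \<lfloor>1 - cartan m n r s j\<rfloor>) (Defs.par m n r j) (g s) (g j)"
    "s \<in> Theta m n r" "cartan m n r s s = 2" "j \<in> Idx m n" "j \<noteq> s"
  then show ?thesis using serre_odd unfolding Idx_def by blast
next
  fix s
  assume "r' = (g s)\<^sup>2" "s \<in> Idx m n" "cartan m n r s s = 0"
  then show ?thesis using serre_isotropic unfolding Idx_def by blast
next
  fix s
  assume *: "r' = g s * higher m n r g (s - 1) s (s + 1)
      + (-1) ^ (Defs.par m n r (s - 1) + Defs.par m n r (s + 1)) *\<^sub>k (higher m n r g (s - 1) s (s + 1) * g s)"
     "1 < s" "s + 1 < N" "cartan m n r s s = 0"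
  then show ?thesis using serre_higher[of s v] by simp
next
  fix s
  assume *: "r' = g s * higher m n r g (s - 1) s (s + 1)
      + (-1) ^ Defs.par m n r (s - 1) *\<^sub>k (higher m n r g (s - 1) s (s + 1) * g s)"
     "1 < s" "s + 1 = N" "cartan m n r s s = 0" "alpha m n r N = Poly_Mapping.single (Eps m) 1"
  have "Poly_Mapping.lookup (alpha m n r N) (Eps m) = 1" by (simp add: *(5))
  then have "Defs.par m n r N = 0" using m
    by (auto simp: alpha_def lookup_single when_def Defs.par_def Theta_def split: if_splits)
  then show ?thesis using serre_higher[of s v] * by simp
next
  fix s
  assume *: "r' = g s * higher m n r g (s - 1) s (s + 1)
      - (-1) ^ Defs.par m n r (s - 1) *\<^sub>k (higher m n r g (s - 1) s (s + 1) * g s)"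
     "1 < s" "s + 1 = N" "cartan m n r s s = 0" "alpha m n r N = Poly_Mapping.single (Del n) 1"
  have "Poly_Mapping.lookup (alpha m n r N) (Del n) = 1" by (simp add: *(5))
  then have "Defs.par m n r N = 1"
    using m n by (simp add: alpha_def lookup_single when_def Defs.par_def Theta_def Idx_def split: if_splits)
  then show ?thesis using serre_higher[of s v] * by simp
qed

end

section \<open>Modules over the deformed Clifford superalgebra\<close>

locale cl_rep = ordered_basis m n r + free_rep scale A
  for m n r scale and A :: "cl_gen free \<Rightarrow> 'v \<Rightarrow> 'v::ab_group_add" +
  assumes cl_rels_vanish: "x \<in> cl_rels m n r \<Longrightarrow> A x v = 0"
begin

text \<open>The value outside \<open>{1..m + n}\<close> provides the operators of index \<open>N + 1\<close> in \<open>ladder\<close>.\<close>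

definition X :: "nat \<Rightarrow> 'v \<Rightarrow> 'v" where "X i = A (if i \<in> {1..N} then gen (GPhi i) else 1)"
definition Y :: "nat \<Rightarrow> 'v \<Rightarrow> 'v" where "Y i = A (if i \<in> {1..N} then gen (GPhiD i) else 1)"
definition U :: "nat \<Rightarrow> 'v \<Rightarrow> 'v" where "U i = A (if i \<in> {1..N} then gen (GU i) else 1)"
definition U' :: "nat \<Rightarrow> 'v \<Rightarrow> 'v" where "U' i = A (if i \<in> {1..N} then gen (GUinv i) else 1)"

lemma XYU_gen:
  assumes "i \<in> {1..N}"
  shows "A (gen (GPhi i)) = X i" "A (gen (GPhiD i)) = Y i" "A (gen (GU i)) = U i" "A (gen (GUinv i)) = U' i"
  using assms by (simp_all add: X_def Y_def U_def U'_def)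

lemma outside_range:
  assumes "i \<notin> {1..N}"
  shows "X i = A 1" "Y i = A 1" "U i = A 1" "U' i = A 1"
  unfolding X_def Y_def U_def U'_def using assms by auto

lemma absorb [simp]:
  "A 1 (X i v) = X i v" "X i (A 1 v) = X i v" "A 1 (Y i v) = Y i v" "Y i (A 1 v) = Y i v"
  "A 1 (U i v) = U i v" "U i (A 1 v) = U i v" "A 1 (U' i v) = U' i v" "U' i (A 1 v) = U' i v"
  by (simp_all add: X_def Y_def U_def U'_def rep_one)

lemma XYU_lin:
  "X i (u + v) = X i u + X i v" "X i (scale c v) = scale c (X i v)" "X i (u - v) = X i u - X i v"
  "Y i (u + v) = Y i u + Y i v" "Y i (scale c v) = scale c (Y i v)" "Y i (u - v) = Y i u - Y i v"
  "U i (u + v) = U i u + U i v" "U i (scale c v) = scale c (U i v)" "U i (u - v) = U i u - U i v"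
  "U' i (u + v) = U' i u + U' i v" "U' i (scale c v) = scale c (U' i v)" "U' i (u - v) = U' i u - U' i v"
  by (simp_all add: X_def Y_def U_def U'_def vec_add vec_scale vec_diff)

lemma XYU_zero: "X i 0 = 0" "Y i 0 = 0" "X i (- v) = - X i v" "Y i (- v) = - Y i v"
  by (simp_all add: X_def Y_def vec_zero vec_uminus)

lemma parPhi_eq: "i \<in> {1..N} \<Longrightarrow> parPhi m n r i = phi_parity i"
  by (simp add: phi_parity_def)

lemma minus_one_parity: "i \<in> {1..N} \<Longrightarrow> (-1) ^ phi_parity i = - sq_norm i"
  by (simp add: sq_norm_def phi_parity_def)

lemma Clifford_rels_same:
  assumes i: "i \<in> {1..N}"
  shows U_U': "U i (U' i v) = A 1 v" and U'_U: "U' i (U i v) = A 1 v"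
    and XY_U': "X i (Y i v) = scale ((-1) ^ phi_parity i * qq) (Y i (X i v)) + U' i v"
    and XY_U: "X i (Y i v) = scale ((-1) ^ phi_parity i * inverse qq) (Y i (X i v)) + U i v"
proof -
  have *: "x \<in> cl_rels m n r"
    if "x \<in> {gen (GU i) * gen (GUinv i) - 1, gen (GUinv i) * gen (GU i) - 1,
        gen (GPhi i) * gen (GPhiD i)
          - ((-1) ^ parPhi m n r i * qq) *\<^sub>k (gen (GPhiD i) * gen (GPhi i)) - gen (GUinv i),
        gen (GPhi i) * gen (GPhiD i)
          - ((-1) ^ parPhi m n r i * inverse qq) *\<^sub>k (gen (GPhiD i) * gen (GPhi i)) - gen (GU i)}" for x
    unfolding cl_rels_def by (rule UnI1, rule UnI1, rule UN_I[of i]) (use i that in \<open>auto simp: Idx_def\<close>)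
  note v = cl_rels_vanish[OF *]
  show "U i (U' i v) = A 1 v" "U' i (U i v) = A 1 v"
    using v[of "gen (GU i) * gen (GUinv i) - 1" v] v[of "gen (GUinv i) * gen (GU i) - 1" v]
    by (simp_all add: rep_diff rep_mult XYU_gen[OF i])
  show "X i (Y i v) = scale ((-1) ^ phi_parity i * qq) (Y i (X i v)) + U' i v"
    using v[of "gen (GPhi i) * gen (GPhiD i)
          - ((-1) ^ parPhi m n r i * qq) *\<^sub>k (gen (GPhiD i) * gen (GPhi i)) - gen (GUinv i)" v]
    unfolding rep_diff rep_mult rep_scal XYU_gen[OF i] parPhi_eq[OF i] by (simp add: diff_eq_eq add.commute)
  show "X i (Y i v) = scale ((-1) ^ phi_parity i * inverse qq) (Y i (X i v)) + U i v"
    using v[of "gen (GPhi i) * gen (GPhiD i)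
          - ((-1) ^ parPhi m n r i * inverse qq) *\<^sub>k (gen (GPhiD i) * gen (GPhi i)) - gen (GU i)" v]
    unfolding rep_diff rep_mult rep_scal XYU_gen[OF i] parPhi_eq[OF i] by (simp add: diff_eq_eq add.commute)
qed

lemma Clifford_rels_pair:
  assumes i: "i \<in> {1..N}" and j: "j \<in> {1..N}"
  shows "U i (U j v) = U j (U i v)"
    and "U i (X j (U' i v)) = scale (qq powi (if i = j then sq_norm j else 0)) (X j v)"
    and "U i (Y j (U' i v)) = scale (qq powi (if i = j then - sq_norm j else 0)) (Y j v)"
    and "X i (X j v) = scale ((-1) ^ (phi_parity i * phi_parity j)) (X j (X i v))"
    and "Y i (Y j v) = scale ((-1) ^ (phi_parity i * phi_parity j)) (Y j (Y i v))"
    and "i \<noteq> j \<Longrightarrow> X i (Y j v) = scale ((-1) ^ (phi_parity i * phi_parity j)) (Y j (X i v))"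
proof -
  have *: "x \<in> cl_rels m n r"
    if "x \<in> {gen (GU i) * gen (GU j) - gen (GU j) * gen (GU i),
         gen (GU i) * gen (GPhi j) * gen (GUinv i)
           - qq powi (if i = j then - ((-1) ^ parPhi m n r j) else 0) *\<^sub>k gen (GPhi j),
         gen (GU i) * gen (GPhiD j) * gen (GUinv i)
           - qq powi (if i = j then (-1) ^ parPhi m n r j else 0) *\<^sub>k gen (GPhiD j),
         gen (GPhi i) * gen (GPhi j)
           - (-1) ^ (parPhi m n r i * parPhi m n r j) *\<^sub>k (gen (GPhi j) * gen (GPhi i)),
         gen (GPhiD i) * gen (GPhiD j)
           - (-1) ^ (parPhi m n r i * parPhi m n r j) *\<^sub>k (gen (GPhiD j) * gen (GPhiD i))}" for x
    unfolding cl_rels_def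
    by (rule UnI1, rule UnI2, rule UN_I[of i], use i in \<open>simp add: Idx_def\<close>, rule UN_I[of j])
       (use j that in \<open>auto simp: Idx_def\<close>)
  note v = cl_rels_vanish[OF *]
  note s = rep_diff rep_mult rep_scal XYU_gen[OF i] XYU_gen[OF j] parPhi_eq[OF i] parPhi_eq[OF j]
  show "U i (U j v) = U j (U i v)"
    using v[of "gen (GU i) * gen (GU j) - gen (GU j) * gen (GU i)" v] by (simp add: s)
  show "U i (X j (U' i v)) = scale (qq powi (if i = j then sq_norm j else 0)) (X j v)"
    using v[of "gen (GU i) * gen (GPhi j) * gen (GUinv i)
           - qq powi (if i = j then - ((-1) ^ parPhi m n r j) else 0) *\<^sub>k gen (GPhi j)" v]
    unfolding s by (simp add: minus_one_parity[OF j])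
  show "U i (Y j (U' i v)) = scale (qq powi (if i = j then - sq_norm j else 0)) (Y j v)"
    using v[of "gen (GU i) * gen (GPhiD j) * gen (GUinv i)
           - qq powi (if i = j then (-1) ^ parPhi m n r j else 0) *\<^sub>k gen (GPhiD j)" v]
    unfolding s by (simp add: minus_one_parity[OF j])
  show "X i (X j v) = scale ((-1) ^ (phi_parity i * phi_parity j)) (X j (X i v))"
    using v[of "gen (GPhi i) * gen (GPhi j)
           - (-1) ^ (parPhi m n r i * parPhi m n r j) *\<^sub>k (gen (GPhi j) * gen (GPhi i))" v]
    unfolding s by simp
  show "Y i (Y j v) = scale ((-1) ^ (phi_parity i * phi_parity j)) (Y j (Y i v))"
    using v[of "gen (GPhiD i) * gen (GPhiD j)
           - (-1) ^ (parPhi m n r i * parPhi m n r j) *\<^sub>k (gen (GPhiD j) * gen (GPhiD i))" v]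
    unfolding s by simp
  show "X i (Y j v) = scale ((-1) ^ (phi_parity i * phi_parity j)) (Y j (X i v))" if "i \<noteq> j"
  proof -
    have "gen (GPhi i) * gen (GPhiD j)
        - (-1) ^ (parPhi m n r i * parPhi m n r j) *\<^sub>k (gen (GPhiD j) * gen (GPhi i)) \<in> cl_rels m n r"
      unfolding cl_rels_def using i j that by (intro UnI2) (auto simp: Idx_def)
    from cl_rels_vanish[OF this, of v] show ?thesis unfolding s by simp
  qed
qed

lemma XY_supercommute_less:
  assumes "1 \<le> i" "i < j" "j \<le> N + 1"
  shows "X j (X i v) = scale ((-1) ^ (phi_parity i * phi_parity j)) (X i (X j v))"
    and "X j (Y i v) = scale ((-1) ^ (phi_parity i * phi_parity j)) (Y i (X j v))"
    and "Y j (X i v) = scale ((-1) ^ (phi_parity i * phi_parity j)) (X i (Y j v))"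
    and "Y j (Y i v) = scale ((-1) ^ (phi_parity i * phi_parity j)) (Y i (Y j v))"
proof -
  have i: "i \<in> {1..N}" using assms by simp
  have "phi_parity j = 0" if "j \<notin> {1..N}" using that by (simp only: phi_parity_def if_False)
  note out_j = this
  then have "X j (X i v) = scale ((-1) ^ (phi_parity i * phi_parity j)) (X i (X j v)) \<and>
    X j (Y i v) = scale ((-1) ^ (phi_parity i * phi_parity j)) (Y i (X j v)) \<and>
    Y j (X i v) = scale ((-1) ^ (phi_parity i * phi_parity j)) (X i (Y j v)) \<and>
    Y j (Y i v) = scale ((-1) ^ (phi_parity i * phi_parity j)) (Y i (Y j v))"
  proof (cases "j \<in> {1..N}")
    case 1: True
    have ne: "j \<noteq> i" "i \<noteq> j" using assms by auto
    have "X i (Y j v) = scale ((-1) ^ (phi_parity i * phi_parity j)) (Y j (X i v))"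
      by (rule Clifford_rels_pair(6)[OF i 1 ne(2)])
    then have "Y j (X i v) = scale ((-1) ^ (phi_parity i * phi_parity j)) (X i (Y j v))"
      by (simp flip: power_add)
    then show ?thesis
      using Clifford_rels_pair(4)[OF 1 i, of v] Clifford_rels_pair(5)[OF 1 i, of v] Clifford_rels_pair(6)[OF 1 i ne(1), of v]
      by (simp add: mult.commute)
  next
    case False
    then show ?thesis using out_j by (simp add: outside_range[OF False])
  qed
  then show "X j (X i v) = scale ((-1) ^ (phi_parity i * phi_parity j)) (X i (X j v))"
    and "X j (Y i v) = scale ((-1) ^ (phi_parity i * phi_parity j)) (Y i (X j v))"
    and "Y j (X i v) = scale ((-1) ^ (phi_parity i * phi_parity j)) (X i (Y j v))"
    and "Y j (Y i v) = scale ((-1) ^ (phi_parity i * phi_parity j)) (Y i (Y j v))" by blast+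
qed

text \<open>The \<open>q\<close>-power picked up when \<open>U i\<close> moves past \<open>X j\<close>.\<close>

definition U_weight :: "nat \<Rightarrow> nat \<Rightarrow> kq" where "U_weight i j = qq powi (if i = j then sq_norm j else 0)"

lemma U_weight_neq_0: "U_weight i j \<noteq> 0"
  by (simp add: U_weight_def qq_neq_0)

lemma U_XY:
  assumes i: "i \<in> {1..N + 1}" and j: "j \<in> {1..N + 1}"
  shows "U i (X j v) = scale (U_weight i j) (X j (U i v))"
    and "U i (Y j v) = scale (inverse (U_weight i j)) (Y j (U i v))"
    and "U' i (X j v) = scale (inverse (U_weight i j)) (X j (U' i v))"
    and "U' i (Y j v) = scale (U_weight i j) (Y j (U' i v))"
proof -
  have "U i (X j v) = scale (U_weight i j) (X j (U i v)) \<and> U i (Y j v) = scale (inverse (U_weight i j)) (Y j (U i v))"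
    for v
  proof (cases "i \<in> {1..N} \<and> j \<in> {1..N}")
    case True
    then have ij: "i \<in> {1..N}" "j \<in> {1..N}" by blast+
    have "inverse (U_weight i j) = qq powi (if i = j then - sq_norm j else 0)"
      by (simp add: U_weight_def power_int_minus)
    then show ?thesis
      using Clifford_rels_pair(2,3)[OF ij, of "U i v"] U'_U[OF ij(1), of v] by (simp add: U_weight_def)
  next
    case False
    then have "i \<notin> {1..N} \<or> j \<notin> {1..N}" by blast
    then show ?thesis
      using sq_norm_out[of j] by (auto simp: outside_range U_weight_def simp del: atLeastAtMost_iff)
  qed
  note U = conjunct1[OF this] conjunct2[OF this]
  show "U i (X j v) = scale (U_weight i j) (X j (U i v))" "U i (Y j v) = scale (inverse (U_weight i j)) (Y j (U i v))"
    by (rule U)+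
  have inv: "U i (U' i w) = A 1 w" "U' i (U i w) = A 1 w" for w
    using U_U'[of i w] U'_U[of i w] outside_range[of i] rep_one by (cases "i \<in> {1..N}"; simp)+
  have "U' i (X j (U i (U' i v))) = scale (inverse (U_weight i j)) (U' i (U i (X j (U' i v))))"
    by (simp add: U XYU_lin U_weight_neq_0)
  then show "U' i (X j v) = scale (inverse (U_weight i j)) (X j (U' i v))"
    by (simp add: inv)
  have "U' i (Y j (U i (U' i v))) = scale (U_weight i j) (U' i (U i (Y j (U' i v))))"
    by (simp add: U XYU_lin U_weight_neq_0)
  then show "U' i (Y j v) = scale (U_weight i j) (Y j (U' i v))"
    by (simp add: inv)
qed

text \<open>The relation \<open>X i \<circ> Y i = q Y i \<circ> X i + U' i\<close> expresses \<open>U' i\<close> by \<open>X i\<close> and \<open>Y i\<close>;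
  substituting this in \<open>X i \<circ> U' i = q\<^sup>-\<^sup>1 U' i \<circ> X i\<close> gives the first identity, and the commutation
  of \<open>U' i\<close> with \<open>Y i\<close> gives the second.\<close>

lemma XY_boson:
  assumes i: "i \<in> {1..N}" and "phi_parity i = 0"
  shows "X i (X i (Y i v)) = scale (qq + inverse qq) (X i (Y i (X i v))) - Y i (X i (X i v))"
    and "X i (Y i (Y i v)) = scale (qq + inverse qq) (Y i (X i (Y i v))) - Y i (Y i (X i v))"
proof -
  have i': "i \<in> {1..N + 1}" using i by simp
  have w: "U_weight i i = inverse qq" using assms sq_norm_eq[OF i] by (simp add: U_weight_def power_int_minus)
  have XY: "X i (Y i v) = scale qq (Y i (X i v)) + U' i v" for v
    using XY_U'[OF i, of v] assms by simp
  then have U': "U' i v = X i (Y i v) - scale qq (Y i (X i v))" for v by simp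
  have "X i (X i (Y i v)) = scale qq (X i (Y i (X i v))) + X i (U' i v)"
    by (simp only: XY XYU_lin)
  also have "X i (U' i v) = scale (inverse qq) (U' i (X i v))"
    using U_XY(3)[OF i' i', of v] by (simp add: w qq_neq_0)
  also have "\<dots> = scale (inverse qq) (X i (Y i (X i v))) - Y i (X i (X i v))"
    by (simp add: U' scale_right_diff_distrib qq_neq_0)
  finally show "X i (X i (Y i v)) = scale (qq + inverse qq) (X i (Y i (X i v))) - Y i (X i (X i v))"
    by (simp add: scale_left_distrib)
  have "X i (Y i (Y i v)) = scale qq (Y i (X i (Y i v))) + U' i (Y i v)"
    by (rule XY)
  also have "U' i (Y i v) = scale (inverse qq) (Y i (U' i v))"
    using U_XY(4)[OF i' i', of v] by (simp add: w)
  also have "\<dots> = scale (inverse qq) (Y i (X i (Y i v))) - Y i (Y i (X i v))"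
    by (simp add: U' XYU_lin scale_right_diff_distrib qq_neq_0)
  finally show "X i (Y i (Y i v)) = scale (qq + inverse qq) (Y i (X i (Y i v))) - Y i (Y i (X i v))"
    by (simp add: scale_left_distrib)
qed

lemma fermion_sq:
  assumes i: "i \<in> {1..N}" and "phi_parity i = Suc 0"
  shows "X i (X i v) = 0" "Y i (Y i v) = 0"
proof -
  have *: "w = 0" if "w = - w" for w :: 'v
  proof -
    have "scale 2 w = w + w" using scale_left_distrib[of 1 1 w] by simp
    also have "\<dots> = 0" using that by (simp add: eq_neg_iff_add_eq_0)
    finally show ?thesis using two_neq_0 scale_eq_0_iff by blast
  qed
  show "X i (X i v) = 0" "Y i (Y i v) = 0"
    using Clifford_rels_pair(4,5)[OF i i, of v] assms * by simp_all
qed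

lemma ladder_XY: "ladder scale N phi_parity qq X Y"
proof (intro ladder.intro ladder_axioms.intro)
  show "vector_space scale" by (rule vector_space_axioms)
  show "phi_parity i = 0 \<or> phi_parity i = Suc 0" for i by (rule phi_parity_cases)
  show "phi_parity (Suc N) = 0" by (simp add: phi_parity_def)
  have *: "X (Suc N) = A 1" "Y (Suc N) = A 1" using outside_range[of "Suc N"] by simp_all
  show "X (Suc N) (X i v) = X i v" "X (Suc N) (Y i v) = Y i v" "Y (Suc N) = X (Suc N)" for i v
    by (simp_all add: *)
  fix i j v assume "1 \<le> i" "i < j" "j \<le> N + 1"
  then show "X j (X i v) = scale ((-1) ^ (phi_parity i * phi_parity j)) (X i (X j v))"
    and "X j (Y i v) = scale ((-1) ^ (phi_parity i * phi_parity j)) (Y i (X j v))"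
    and "Y j (X i v) = scale ((-1) ^ (phi_parity i * phi_parity j)) (X i (Y j v))"
    and "Y j (Y i v) = scale ((-1) ^ (phi_parity i * phi_parity j)) (Y i (Y j v))"
    by (rule XY_supercommute_less)+
next
  fix i v assume "1 \<le> i" "i \<le> N" "phi_parity i = 0"
  then show "X i (X i (Y i v)) = scale (qq + inverse qq) (X i (Y i (X i v))) - Y i (X i (X i v))"
    and "X i (Y i (Y i v)) = scale (qq + inverse qq) (Y i (X i (Y i v))) - Y i (Y i (X i v))"
    using XY_boson[of i v] by simp_all
next
  fix i v assume "1 \<le> i" "i \<le> N" "phi_parity i = Suc 0"
  then show "X i (X i v) = 0" "Y i (Y i v) = 0"
    using fermion_sq[of i v] by simp_all
qed (simp_all add: qq_neq_0 XYU_lin)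

text \<open>With \<open>e_coeff\<close> and \<open>k_coeff\<close> the images of \<open>e\<^sub>i\<close> and \<open>k\<^sub>i\<close> have the same shape for all
  \<open>i\<close>, including the last; see \<open>img_GE\<close> and \<open>img_GK\<close>. The sign \<open>f_sign\<close> arises from writing the
  image of \<open>f\<^sub>i\<close> as \<open>Y i \<circ> X (i + 1)\<close>.\<close>

definition e_coeff :: "nat \<Rightarrow> kq" where
  "e_coeff i = (if i = N then im_unit * inverse (q_half - inverse q_half) else 1)"

definition f_sign :: "nat \<Rightarrow> kq" where
  "f_sign i = (-1) ^ (phi_parity i * phi_parity (Suc i))"

definition k_coeff :: "nat \<Rightarrow> kq" where
  "k_coeff i = (if i = N then im_unit * q_half else - ((-1) ^ phi_parity (Suc i)))"

abbreviation "img \<equiv> spinor_img m n r"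

lemma img_GE:
  assumes "i \<in> {1..N}"
  shows "A (img (GE i)) v = scale (e_coeff i) (X i (Y (Suc i) v))"
proof (cases "i < N")
  case True
  then have "Suc i \<in> {1..N}" by simp
  then show ?thesis
    using True assms by (simp add: rep_mult XYU_gen[OF assms] XYU_gen[OF \<open>Suc i \<in> _\<close>] e_coeff_def)
next
  case False
  then have "Suc i \<notin> {1..N}" "i = N" using assms by simp_all
  then show ?thesis by (simp add: rep_scal XYU_gen[OF assms, unfolded \<open>i = N\<close>] outside_range[OF \<open>Suc i \<notin> _\<close>, unfolded \<open>i = N\<close>] e_coeff_def)
qed

lemma img_GF:
  assumes "i \<in> {1..N}"
  shows "A (img (GF i)) v = X (Suc i) (Y i v)"
proof (cases "i < N")
  case True
  then have "Suc i \<in> {1..N}" by simp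
  then show ?thesis
    using True assms by (simp add: rep_mult XYU_gen[OF assms] XYU_gen[OF \<open>Suc i \<in> _\<close>])
next
  case False
  then have "Suc i \<notin> {1..N}" "i = N" using assms by simp_all
  then show ?thesis by (simp add: XYU_gen[OF assms, unfolded \<open>i = N\<close>] outside_range[OF \<open>Suc i \<notin> _\<close>, unfolded \<open>i = N\<close>])
qed

lemma img_GK:
  assumes "i \<in> {1..N}"
  shows "A (img (GK i)) v = scale (k_coeff i) (U i (U' (Suc i) v))"
    and "A (img (GKinv i)) v = scale (inverse (k_coeff i)) (U (Suc i) (U' i v))"
proof -
  have "A (img (GK i)) v = scale (k_coeff i) (U i (U' (Suc i) v)) \<and>
    A (img (GKinv i)) v = scale (inverse (k_coeff i)) (U (Suc i) (U' i v))"
  proof (cases "i < N")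
    case True
    then have S: "Suc i \<in> {1..N}" by simp
    have "inverse (k_coeff i) = k_coeff i"
      using True phi_parity_cases[of "Suc i"] by (auto simp: k_coeff_def)
    then show ?thesis
      using True assms
      by (simp add: rep_mult rep_scal rep_uminus XYU_gen[OF assms] XYU_gen[OF S] k_coeff_def parPhi_eq[OF S])
  next
    case False
    then have S: "Suc i \<notin> {1..N}" and iN: "i = N" using assms by simp_all
    then show ?thesis
      by (simp add: rep_scal XYU_gen[OF assms, unfolded iN] outside_range[OF S, unfolded iN] k_coeff_def)
  qed
  then show "A (img (GK i)) v = scale (k_coeff i) (U i (U' (Suc i) v))"
    and "A (img (GKinv i)) v = scale (inverse (k_coeff i)) (U (Suc i) (U' i v))" by blast+
qed

lemma serre_e:
  assumes "x \<in> serre_rels m n r (\<lambda>i. gen (GE i))"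
  shows "A (free_ext img x) v = 0"
proof -
  interpret L: ladder scale N phi_parity qq X Y by (rule ladder_XY)
  let ?c = "\<lambda>i. if i = Suc N then 1 else e_coeff i"
  interpret L': ladder scale N phi_parity qq "\<lambda>i v. scale (?c i) (X i v)" Y
    by (rule L.ladder_rescale) simp
  interpret spinor_ladder m n r scale A "\<lambda>i v. scale (?c i) (X i v)" Y img "\<lambda>i. gen (GE i)"
    by unfold_locales (auto simp: L'.E_def img_GE simp del: spinor_img.simps)
  show ?thesis using assms by (rule serre_rels_vanish)
qed

lemma serre_f:
  assumes "x \<in> serre_rels m n r (\<lambda>i. gen (GF i))"
  shows "A (free_ext img x) v = 0"
proof -
  interpret L: ladder scale N phi_parity qq X Y by (rule ladder_XY)
  interpret L1: ladder scale N phi_parity qq Y X by (rule L.ladder_swap)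
  interpret L': ladder scale N phi_parity qq "\<lambda>i v. scale (f_sign i) (Y i v)" X
    by (rule L1.ladder_rescale) (simp add: f_sign_def phi_parity_def)
  interpret spinor_ladder m n r scale A "\<lambda>i v. scale (f_sign i) (Y i v)" X img "\<lambda>i. gen (GF i)"
  proof unfold_locales
    fix i v assume "i \<in> {1..N}"
    then show "A (free_ext img (gen (GF i))) v = L'.E i v"
      using XY_supercommute_less(2)[of i "Suc i" v]
      unfolding L'.E_def free_ext_gen by (simp add: img_GF f_sign_def del: spinor_img.simps)
  qed
  show ?thesis using assms by (rule serre_rels_vanish)
qed

lemma U_inverse: "U i (U' i v) = A 1 v" "U' i (U i v) = A 1 v"
proof -
  have "U i (U' i v) = A 1 v \<and> U' i (U i v) = A 1 v"
  proof (cases "i \<in> {1..N}")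
    case True
    then show ?thesis using U_U' U'_U by blast
  next
    case False
    show ?thesis by (simp add: outside_range[OF False] rep_one)
  qed
  then show "U i (U' i v) = A 1 v" "U' i (U i v) = A 1 v" by blast+
qed

lemma UU_comm: "U i (U j v) = U j (U i v)"
proof (cases "i \<in> {1..N} \<and> j \<in> {1..N}")
  case True
  then show ?thesis using Clifford_rels_pair(1) by blast
next
  case False
  then have "i \<notin> {1..N} \<or> j \<notin> {1..N}" by blast
  then show ?thesis by (elim disjE) (simp_all add: outside_range)
qed

lemma U'U_comm: "U' i (U j v) = U j (U' i v)"
proof -
  have "U' i (U j (U i (U' i v))) = U' i (U i (U j (U' i v)))" by (simp only: UU_comm)
  then show ?thesis by (simp add: U_inverse)
qed

lemma U'U'_comm: "U' i (U' j v) = U' j (U' i v)"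
proof -
  have "U' i (U' j (U i (U' i v))) = U' i (U i (U' j (U' i v)))" by (simp only: U'U_comm)
  then show ?thesis by (simp add: U_inverse)
qed

lemma U_cancel:
  "U i (U' (Suc i) (U (Suc i) (U' i v))) = A 1 v"
  "U (Suc i) (U' i (U i (U' (Suc i) v))) = A 1 v"
  by (simp_all add: U_inverse)

lemma k_coeff_neq_0: "k_coeff i \<noteq> 0"
proof -
  have "im_unit * im_unit = -1"
    by (simp add: im_unit_def One_fract_def one_pCons)
  then have "im_unit \<noteq> 0" by auto
  then show ?thesis by (simp add: k_coeff_def q_half_neq_0)
qed

text \<open>The four factors are the powers of \<open>q\<close> from the four pairs of basis vectors in
  \<open>(\<E>\<^sub>i - \<E>\<^sub>i\<^sub>+\<^sub>1, \<E>\<^sub>j - \<E>\<^sub>j\<^sub>+\<^sub>1)\<close>.\<close>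

lemma K_conj_weights:
  assumes i: "i \<in> {1..N}" and j: "j \<in> {1..N}"
  shows "U_weight i j * inverse (U_weight i (Suc j)) * (inverse (U_weight (Suc i) j) * U_weight (Suc i) (Suc j)) = qq powi root_form i j"
proof -
  consider "i = j" | "i = Suc j" | "j = Suc i" | "i \<noteq> j" "i \<noteq> Suc j" "j \<noteq> Suc i" by blast
  then show ?thesis
    by cases (simp_all add: U_weight_def root_form_def power_int_add power_int_minus qq_neq_0)
qed

lemma K_conj_E:
  assumes i: "i \<in> {1..N}" and j: "j \<in> {1..N}"
  shows "A (img (GK i)) (A (img (GE j)) (A (img (GKinv i)) v)) = scale (qq powi root_form i j) (A (img (GE j)) v)"
proof -
  have I: "i \<in> {1..N + 1}" "Suc i \<in> {1..N + 1}" "j \<in> {1..N + 1}" "Suc j \<in> {1..N + 1}"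
    using i j by auto
  show ?thesis
    unfolding img_GE[OF j] img_GK[OF i] K_conj_weights[OF i j, symmetric]
    by (simp add: XYU_lin U_XY[OF I(1) I(3)] U_XY[OF I(1) I(4)] U_XY[OF I(2) I(3)] U_XY[OF I(2) I(4)] U_cancel
      k_coeff_neq_0 mult_ac del: One_nat_def)
qed

lemma K_conj_F:
  assumes i: "i \<in> {1..N}" and j: "j \<in> {1..N}"
  shows "A (img (GK i)) (A (img (GF j)) (A (img (GKinv i)) v)) = scale (qq powi (- root_form i j)) (A (img (GF j)) v)"
proof -
  have I: "i \<in> {1..N + 1}" "Suc i \<in> {1..N + 1}" "j \<in> {1..N + 1}" "Suc j \<in> {1..N + 1}"
    using i j by auto
  show ?thesis
    unfolding img_GF[OF j] img_GK[OF i] power_int_minus K_conj_weights[OF i j, symmetric]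
    by (simp add: XYU_lin U_XY[OF I(1) I(3)] U_XY[OF I(1) I(4)] U_XY[OF I(2) I(3)] U_XY[OF I(2) I(4)] U_cancel
      k_coeff_neq_0 mult_ac del: One_nat_def)
qed

lemma XY_supercommute:
  assumes i: "i \<in> {1..N + 1}" and j: "j \<in> {1..N + 1}" and ij: "i \<noteq> j"
  shows "X i (X j v) = scale ((-1) ^ (phi_parity i * phi_parity j)) (X j (X i v))"
    and "X i (Y j v) = scale ((-1) ^ (phi_parity i * phi_parity j)) (Y j (X i v))"
    and "Y i (X j v) = scale ((-1) ^ (phi_parity i * phi_parity j)) (X j (Y i v))"
    and "Y i (Y j v) = scale ((-1) ^ (phi_parity i * phi_parity j)) (Y j (Y i v))"
proof -
  have "X i (X j v) = scale ((-1) ^ (phi_parity i * phi_parity j)) (X j (X i v)) \<and>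
    X i (Y j v) = scale ((-1) ^ (phi_parity i * phi_parity j)) (Y j (X i v)) \<and>
    Y i (X j v) = scale ((-1) ^ (phi_parity i * phi_parity j)) (X j (Y i v)) \<and>
    Y i (Y j v) = scale ((-1) ^ (phi_parity i * phi_parity j)) (Y j (Y i v))"
  proof (cases "i < j")
    case True
    have "1 \<le> i" "j \<le> N + 1" using i j by auto
    note c = XY_supercommute_less[OF this(1) True this(2), of v]
    show ?thesis unfolding c by (simp flip: power_add)
  next
    case False
    then have "j < i" "1 \<le> j" "i \<le> N + 1" using i j ij by auto
    from XY_supercommute_less[OF this(2,1,3), of v] show ?thesis by (simp add: mult.commute)
  qed
  then show "X i (X j v) = scale ((-1) ^ (phi_parity i * phi_parity j)) (X j (X i v))"
    and "X i (Y j v) = scale ((-1) ^ (phi_parity i * phi_parity j)) (Y j (X i v))"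
    and "Y i (X j v) = scale ((-1) ^ (phi_parity i * phi_parity j)) (X j (Y i v))"
    and "Y i (Y j v) = scale ((-1) ^ (phi_parity i * phi_parity j)) (Y j (Y i v))" by blast+
qed

text \<open>If the four indices involved are distinct, all factors supercommute. Otherwise one operator
  occurs twice: for a boson it commutes with itself, for a fermion both sides vanish.\<close>

lemma EF_supercommute:
  assumes i: "i \<in> {1..N}" and j: "j \<in> {1..N}" and "i \<noteq> j"
  shows "A (img (GE i)) (A (img (GF j)) v) =
    scale ((-1) ^ (par m n r i * par m n r j)) (A (img (GF j)) (A (img (GE i)) v))"
proof -
  obtain k l where k: "k = Suc i" and l: "l = Suc j" by blast
  have I: "i \<in> {1..N + 1}" "j \<in> {1..N + 1}" "k \<in> {1..N + 1}" "l \<in> {1..N + 1}"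
    using i j k l by auto
  have par: "par m n r i = (if phi_parity i = phi_parity k then 0 else 1)" "par m n r j = (if phi_parity j = phi_parity l then 0 else 1)"
    using par_eq[OF i] par_eq[OF j] by (simp_all add: k l)
  have ne: "i \<noteq> k" "j \<noteq> l" "k \<noteq> l" using k l \<open>i \<noteq> j\<close> by auto
  have "X i (Y k (X l (Y j v))) = scale ((-1) ^ (par m n r i * par m n r j)) (X l (Y j (X i (Y k v))))"
  proof -
    consider "k = j" | "i = l" | "k \<noteq> j" "i \<noteq> l" by blast
    then show ?thesis
    proof cases
      case 1
      have il: "i \<noteq> l" "j \<noteq> i" "l \<noteq> i" using 1 k l by auto
      note c = XY_supercommute(3)[OF I(2,4) ne(2)] XY_supercommute(3)[OF I(2,1) il(2)] XY_supercommute(1)[OF I(4,1) il(3)]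
      have f: "Y j (Y j w) = 0" if "phi_parity j = Suc 0" for w using fermion_sq[OF j that] by blast
      show ?thesis unfolding par 1 using phi_parity_cases[of i] phi_parity_cases[of j] phi_parity_cases[of l]
        by (elim disjE; simp add: c f XYU_lin XYU_zero del: One_nat_def)
    next
      case 2
      have kj: "k \<noteq> i" "j \<noteq> i" "k \<noteq> j" using 2 k l by auto
      note c = XY_supercommute(3)[OF I(3,1) kj(1)] XY_supercommute(3)[OF I(2,1) kj(2)] XY_supercommute(4)[OF I(3,2) kj(3)]
      have f: "X i (X i w) = 0" if "phi_parity i = Suc 0" for w using fermion_sq[OF i that] by blast
      show ?thesis unfolding par 2[symmetric] using phi_parity_cases[of i] phi_parity_cases[of j] phi_parity_cases[of k]
        by (elim disjE; simp add: c f XYU_lin XYU_zero del: One_nat_def)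
    next
      case 3
      note c = XY_supercommute(1)[OF I(1,4) 3(2)] XY_supercommute(2)[OF I(1,2) \<open>i \<noteq> j\<close>]
        XY_supercommute(3)[OF I(3,4) ne(3)] XY_supercommute(4)[OF I(3,2) 3(1)]
      have "X i (Y k (X l (Y j v))) =
          scale ((-1) ^ (phi_parity i * phi_parity l) * (-1) ^ (phi_parity i * phi_parity j) * (-1) ^ (phi_parity k * phi_parity l) * (-1) ^ (phi_parity k * phi_parity j))
            (X l (Y j (X i (Y k v))))"
        by (simp only: c XYU_lin scale_scale mult_ac)
      also have "(-1) ^ (phi_parity i * phi_parity l) * (-1) ^ (phi_parity i * phi_parity j) * (-1) ^ (phi_parity k * phi_parity l) * (-1) ^ (phi_parity k * phi_parity j) =
          ((-1) ^ (par m n r i * par m n r j) :: kq)"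
        unfolding par using phi_parity_cases[of i] phi_parity_cases[of j] phi_parity_cases[of k] phi_parity_cases[of l]
        by (elim disjE) simp_all
      finally show ?thesis .
    qed
  qed
  then show ?thesis
    unfolding img_GE[OF i] img_GF[OF j] XYU_lin k[symmetric] l[symmetric] by (simp add: mult.commute)
qed

lemma qq_diff_neq_0: "qq - inverse qq \<noteq> 0"
proof (rule diff_inverse_neq_0)
  show "qq \<noteq> 0" by (rule qq_neq_0)
  show "\<forall>k>0. qq ^ k \<noteq> 1"
    using q_half_powi_no_root[of 2] by (simp add: qq_def)
qed

text \<open>The two relations for \<open>X i \<circ> Y i\<close> form a linear system with the unknowns \<open>X i \<circ> Y i\<close> and
  \<open>Y i \<circ> X i\<close> and determinant \<open>q - q\<^sup>-\<^sup>1\<close> up to sign.\<close>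

lemma YX_XY:
  assumes i: "i \<in> {1..N}"
  shows "scale (qq - inverse qq) (Y i (X i v)) = scale ((-1) ^ phi_parity i) (U i v - U' i v)"
    and "scale (qq - inverse qq) (X i (Y i v)) = scale qq (U i v) - scale (inverse qq) (U' i v)"
proof -
  let ?s = "(-1) ^ phi_parity i :: kq"
  have s: "?s * ?s = 1" by (simp flip: power_add)
  have 1: "X i (Y i v) = scale (?s * qq) (Y i (X i v)) + U' i v"
    and 2: "X i (Y i v) = scale (?s * inverse qq) (Y i (X i v)) + U i v"
    using XY_U'[OF i] XY_U[OF i] by blast+
  have "scale (?s * (qq - inverse qq)) (Y i (X i v)) = U i v - U' i v"
    using trans[OF 1[symmetric] 2] by (simp add: algebra_simps)
  then have "scale (?s * (?s * (qq - inverse qq))) (Y i (X i v)) = scale ?s (U i v - U' i v)"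
    by (metis scale_scale)
  then show "scale (qq - inverse qq) (Y i (X i v)) = scale ?s (U i v - U' i v)"
    using s by (simp flip: mult.assoc)
  have "scale qq (X i (Y i v)) = scale ?s (Y i (X i v)) + scale qq (U i v)"
    by (subst 2) (simp add: scale_right_distrib qq_neq_0)
  moreover have "scale (inverse qq) (X i (Y i v)) = scale ?s (Y i (X i v)) + scale (inverse qq) (U' i v)"
    by (subst 1) (simp add: scale_right_distrib qq_neq_0)
  ultimately show "scale (qq - inverse qq) (X i (Y i v)) = scale qq (U i v) - scale (inverse qq) (U' i v)"
    by (simp add: scale_left_diff_distrib)
qed

text \<open>By \<open>YX_XY\<close> both products are polynomials in the commuting operators \<open>U\<close> and \<open>U'\<close>. For
  \<open>i < N\<close> the terms in \<open>U i \<circ> U k\<close> and \<open>U' i \<circ> U' k\<close> cancel. For \<open>i = N\<close> the coefficients are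
  \<open>q - 1\<close> and \<open>q\<^sup>-\<^sup>1 - 1\<close>, whose common factor \<open>q\<^sup>1\<^sup>/\<^sup>2 - q\<^sup>-\<^sup>1\<^sup>/\<^sup>2\<close> the normalisation of the last \<open>e\<close> removes,
  and \<open>\<i>\<^sup>-\<^sup>1 = - \<i>\<close> turns the difference on the right into the required sum.\<close>

lemma EF_same:
  assumes i: "i \<in> {1..N}"
  shows "A (img (GE i)) (A (img (GF i)) v) - scale ((-1) ^ (par m n r i * par m n r i)) (A (img (GF i)) (A (img (GE i)) v))
    = scale (inverse (qq - inverse qq)) (A (img (GK i)) v - A (img (GKinv i)) v)"
proof (cases "i = N")
  case False
  obtain k where k: "k = Suc i" by blast
  have kN: "k \<in> {1..N}" and ik: "i \<noteq> k" and I: "i \<in> {1..N + 1}" "k \<in> {1..N + 1}" using False i k by auto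
  have par: "par m n r i = (if phi_parity i = phi_parity k then 0 else 1)" using par_eq[OF i] by (simp add: k)
  let ?d = "qq - inverse qq"
  let ?s = "(-1) ^ phi_parity k :: kq"
  let ?t = "(-1) ^ (par m n r i * par m n r i) :: kq"
  have k_coeff: "k_coeff i = - ?s" "inverse (k_coeff i) = - ?s"
    using False phi_parity_cases[of k] by (auto simp: k_coeff_def k)
  have P: "X i (Y k (X k (Y i v))) = X i (Y i (Y k (X k v)))"
    using phi_parity_cases[of i] phi_parity_cases[of k]
    by (elim disjE; simp add: XY_supercommute[OF I(2,1) ik[symmetric]] XYU_lin XYU_zero del: One_nat_def)
  have Q: "X k (Y i (X i (Y k v))) = X k (Y k (Y i (X i v)))"
    using phi_parity_cases[of i] phi_parity_cases[of k]
    by (elim disjE; simp add: XY_supercommute[OF I(1,2) ik] XYU_lin XYU_zero del: One_nat_def)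
  have dP: "scale (?d * ?d) (X i (Y i (Y k (X k v)))) = scale ?s
      (scale qq (U i (U k v) - U i (U' k v)) - scale (inverse qq) (U' i (U k v) - U' i (U' k v)))"
  proof -
    have "scale (?d * ?d) (X i (Y i (Y k (X k v)))) = scale ?d (X i (Y i (scale ?d (Y k (X k v)))))"
      by (simp only: XYU_lin scale_scale)
    also have "\<dots> = scale ?s (scale ?d (X i (Y i (U k v - U' k v))))"
      by (simp only: YX_XY[OF kN] XYU_lin scale_scale mult.commute)
    also have "\<dots> = scale ?s
      (scale qq (U i (U k v) - U i (U' k v)) - scale (inverse qq) (U' i (U k v) - U' i (U' k v)))"
      by (simp only: YX_XY[OF i], simp only: XYU_lin)
    finally show ?thesis .
  qed
  have dQ: "scale (?d * ?d) (X k (Y k (Y i (X i v)))) = scale ((-1) ^ phi_parity i)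
      (scale qq (U k (U i v) - U k (U' i v)) - scale (inverse qq) (U' k (U i v) - U' k (U' i v)))"
  proof -
    have "scale (?d * ?d) (X k (Y k (Y i (X i v)))) = scale ?d (X k (Y k (scale ?d (Y i (X i v)))))"
      by (simp only: XYU_lin scale_scale)
    also have "\<dots> = scale ((-1) ^ phi_parity i) (scale ?d (X k (Y k (U i v - U' i v))))"
      by (simp only: YX_XY[OF i] XYU_lin scale_scale mult.commute)
    also have "\<dots> = scale ((-1) ^ phi_parity i)
      (scale qq (U k (U i v) - U k (U' i v)) - scale (inverse qq) (U' k (U i v) - U' k (U' i v)))"
      by (simp only: YX_XY[OF kN], simp only: XYU_lin)
    finally show ?thesis .
  qed
  have ts: "?t * (-1) ^ phi_parity i = ?s" unfolding par using phi_parity_cases[of i] phi_parity_cases[of k] by auto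
  have "scale (?d * ?d) (X i (Y k (X k (Y i v))) - scale ?t (X k (Y i (X i (Y k v))))) =
      scale (?d * ?d) (X i (Y i (Y k (X k v)))) - scale ?t (scale (?d * ?d) (X k (Y k (Y i (X i v)))))"
    unfolding P Q by (simp only: scale_right_diff_distrib scale_scale mult.commute)
  also have "\<dots> = scale ?s ((scale qq (U i (U k v) - U i (U' k v)) - scale (inverse qq) (U' i (U k v) - U' i (U' k v)))
     - (scale qq (U k (U i v) - U k (U' i v)) - scale (inverse qq) (U' k (U i v) - U' k (U' i v))))"
    unfolding dP dQ by (simp only: scale_scale[of ?t] ts scale_right_diff_distrib)
  also have "\<dots> = scale ?s (scale ?d (U k (U' i v) - U i (U' k v)))"
    by (simp add: UU_comm[of k i] U'U'_comm[of k i] U'U_comm scale_right_diff_distrib scale_left_diff_distrib)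
  also have "\<dots> = scale (?d * ?d) (scale (inverse ?d) (scale (k_coeff i) (U i (U' k v)) - scale (inverse (k_coeff i)) (U k (U' i v))))"
  proof -
    have "scale (k_coeff i) a - scale (inverse (k_coeff i)) b = scale ?s (b - a)" for a b
      unfolding k_coeff(2) unfolding k_coeff(1) by (simp add: scale_right_diff_distrib)
    moreover have "?d * ?d * (inverse ?d * ?s) = ?s * ?d"
    proof -
      have "?d * ?d * (inverse ?d * ?s) = ?s * ?d * (?d * inverse ?d)" by (simp only: mult_ac)
      then show ?thesis by (simp only: right_inverse[OF qq_diff_neq_0] mult_1_right)
    qed
    ultimately show ?thesis by (simp only: scale_scale)
  qed
  finally have "scale (?d * ?d) (X i (Y k (X k (Y i v))) - scale ?t (X k (Y i (X i (Y k v))))) =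
    scale (?d * ?d) (scale (inverse ?d) (scale (k_coeff i) (U i (U' k v)) - scale (inverse (k_coeff i)) (U k (U' i v))))" .
  moreover have "?d * ?d \<noteq> 0" using qq_diff_neq_0 by simp
  ultimately have "X i (Y k (X k (Y i v))) - scale ?t (X k (Y i (X i (Y k v)))) =
    scale (inverse ?d) (scale (k_coeff i) (U i (U' k v)) - scale (inverse (k_coeff i)) (U k (U' i v)))"
    using scale_left_imp_eq by blast
  then show ?thesis
    using False unfolding img_GE[OF i] img_GF[OF i] img_GK[OF i] k[symmetric] by (simp add: e_coeff_def)
next
  case True
  have k: "Suc N \<notin> {1..N}" by simp
  have par: "par m n r N * par m n r N = phi_parity N"
    using par_eq[of N] i phi_parity_cases[of N] True by (auto simp: phi_parity_def)
  let ?d = "qq - inverse qq"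
  let ?h = "q_half - inverse q_half"
  have im: "im_unit * im_unit = -1"
    by (simp add: im_unit_def One_fract_def one_pCons)
  then have im': "inverse im_unit = - im_unit"
    by (metis inverse_unique mult_minus_right minus_minus)
  have h: "?h \<noteq> 0"
    by (rule diff_inverse_neq_0) (use q_half_neq_0 q_half_power_neq_1 in auto)
  have qh: "qq - 1 = q_half * ?h" "inverse qq - 1 = - (inverse q_half * ?h)"
    by (simp_all add: qq_def algebra_simps power2_eq_square q_half_neq_0)
  have N: "N \<in> {1..N}" using i True by simp
  have s: "(-1) ^ phi_parity N * (-1) ^ phi_parity N = (1 :: kq)" by (simp flip: power_add)
  have "scale ?d (X N (Y N v) - scale ((-1) ^ phi_parity N) (Y N (X N v))) =
      scale ?d (X N (Y N v)) - scale ((-1) ^ phi_parity N) (scale ?d (Y N (X N v)))"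
    by (simp only: scale_right_diff_distrib scale_scale mult.commute)
  also have "\<dots> = scale (qq - 1) (U N v) - scale (inverse qq - 1) (U' N v)"
    unfolding YX_XY[OF N] by (simp add: s scale_left_diff_distrib scale_right_diff_distrib)
  also have "\<dots> = scale ?h (scale q_half (U N v) + scale (inverse q_half) (U' N v))"
    unfolding qh by (simp add: scale_right_distrib mult.commute)
  finally have *: "scale ?d (X N (Y N v) - scale ((-1) ^ phi_parity N) (Y N (X N v))) =
      scale ?h (scale q_half (U N v) + scale (inverse q_half) (U' N v))" .
  have "scale ?d (scale (e_coeff N) (X N (Y N v) - scale ((-1) ^ phi_parity N) (Y N (X N v)))) =
      scale (e_coeff N) (scale ?h (scale q_half (U N v) + scale (inverse q_half) (U' N v)))"
    unfolding *[symmetric] by (simp only: scale_scale mult.commute)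
  also have "\<dots> = scale im_unit (scale q_half (U N v) + scale (inverse q_half) (U' N v))"
    using h by (simp add: e_coeff_def)
  also have "\<dots> = scale (k_coeff N) (U N v) - scale (inverse (k_coeff N)) (U' N v)"
    by (simp add: k_coeff_def im' scale_right_distrib)
  finally have "scale (e_coeff N) (X N (Y N v) - scale ((-1) ^ phi_parity N) (Y N (X N v))) =
      scale (inverse ?d) (scale (k_coeff N) (U N v) - scale (inverse (k_coeff N)) (U' N v))"
    using qq_diff_neq_0 by (metis scale_scale left_inverse scale_one)
  then show ?thesis
    unfolding True img_GE[OF N] img_GF[OF N] img_GK[OF N]
    by (simp add: outside_range[OF k] par XYU_lin vec_scale scale_right_diff_distrib mult.commute)
qed

theorem osp_rels_vanish:
  assumes "x \<in> osp_rels m n r"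
  shows "A (free_ext img x) v = 0"
proof -
  note simps = free_ext_simps rep_diff rep_mult rep_scal
  have KK: "A (free_ext img x) v = 0"
    if "i \<in> {1..N}" "x \<in> {gen (GK i) * gen (GKinv i) - 1, gen (GKinv i) * gen (GK i) - 1}" for i
  proof -
    have i: "i \<in> {1..N}" by fact
    show ?thesis
      using that(2) by (auto simp: simps img_GK[OF i] XYU_lin U_cancel k_coeff_neq_0 simp del: spinor_img.simps)
  qed
  have R1: "A (free_ext img x) v = 0"
    if "i \<in> {1..N}" "j \<in> {1..N}"
      "x \<in> {gen (GK i) * gen (GK j) - gen (GK j) * gen (GK i),
         gen (GK i) * gen (GE j) * gen (GKinv i) - qi m n r i powi \<lfloor>cartan m n r i j\<rfloor> *\<^sub>k gen (GE j),
         gen (GK i) * gen (GF j) * gen (GKinv i) - qi m n r i powi (- \<lfloor>cartan m n r i j\<rfloor>) *\<^sub>k gen (GF j),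
         gen (GE i) * gen (GF j) - (-1) ^ (par m n r i * par m n r j) *\<^sub>k (gen (GF j) * gen (GE i))
           - (if i = j then inverse (qq - inverse qq) *\<^sub>k (gen (GK i) - gen (GKinv i)) else 0)}" for i j
  proof -
    have i: "i \<in> {1..N}" and j: "j \<in> {1..N}" by fact+
    have q: "qi m n r i powi (- \<lfloor>cartan m n r i j\<rfloor>) = qq powi (- root_form i j)"
      by (simp add: power_int_minus qi_powi_cartan[OF i j])
    from that(3) show ?thesis
    proof (elim insertE emptyE)
      assume "x = gen (GK i) * gen (GK j) - gen (GK j) * gen (GK i)"
      then show ?thesis
        using UU_comm U'U_comm U'U'_comm
        by (simp add: simps img_GK[OF i] img_GK[OF j] XYU_lin mult.commute del: spinor_img.simps)
    next
      assume "x = gen (GK i) * gen (GE j) * gen (GKinv i) - qi m n r i powi \<lfloor>cartan m n r i j\<rfloor> *\<^sub>k gen (GE j)"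
      then show ?thesis
        using K_conj_E[OF i j, of v] unfolding qi_powi_cartan[OF i j] by (simp add: simps del: spinor_img.simps)
    next
      assume "x = gen (GK i) * gen (GF j) * gen (GKinv i) - qi m n r i powi (- \<lfloor>cartan m n r i j\<rfloor>) *\<^sub>k gen (GF j)"
      then show ?thesis
        using K_conj_F[OF i j, of v] unfolding q by (simp add: simps del: spinor_img.simps)
    next
      assume "x = gen (GE i) * gen (GF j) - (-1) ^ (par m n r i * par m n r j) *\<^sub>k (gen (GF j) * gen (GE i))
           - (if i = j then inverse (qq - inverse qq) *\<^sub>k (gen (GK i) - gen (GKinv i)) else 0)"
      then show ?thesis
        using EF_same[OF i, of v] EF_supercommute[OF i j, of v]
        by (cases "i = j") (simp_all add: simps rep_zero del: spinor_img.simps)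
    qed
  qed
  from assms show ?thesis
    unfolding osp_rels_def
  proof (elim UnE UN_E)
    fix i assume "i \<in> Idx m n" "x \<in> {gen (GK i) * gen (GKinv i) - 1, gen (GKinv i) * gen (GK i) - 1}"
    then show ?thesis using KK[of i] unfolding Idx_def by blast
  next
    fix i j assume "i \<in> Idx m n" "j \<in> Idx m n" "x \<in> {gen (GK i) * gen (GK j) - gen (GK j) * gen (GK i),
         gen (GK i) * gen (GE j) * gen (GKinv i) - qi m n r i powi \<lfloor>cartan m n r i j\<rfloor> *\<^sub>k gen (GE j),
         gen (GK i) * gen (GF j) * gen (GKinv i) - qi m n r i powi (- \<lfloor>cartan m n r i j\<rfloor>) *\<^sub>k gen (GF j),
         gen (GE i) * gen (GF j) - (-1) ^ (par m n r i * par m n r j) *\<^sub>k (gen (GF j) * gen (GE i))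
           - (if i = j then inverse (qq - inverse qq) *\<^sub>k (gen (GK i) - gen (GKinv i)) else 0)}"
    then show ?thesis using R1[of i j] unfolding Idx_def by blast
  next
    assume "x \<in> serre_rels m n r (\<lambda>i. gen (GE i))"
    then show ?thesis by (rule serre_e)
  next
    assume "x \<in> serre_rels m n r (\<lambda>i. gen (GF i))"
    then show ?thesis by (rule serre_f)
  qed
qed

end

section \<open>Invariant subspaces of Fock space\<close>

locale fock = cl_rep +
  fixes vac :: 'a
  assumes A_one: "A 1 v = v"
    and X_vac: "i \<in> {1..N} \<Longrightarrow> X i vac = 0"
    and U_vac: "i \<in> {1..N} \<Longrightarrow> U i vac = vac"
begin

definition creation_word :: "nat list \<Rightarrow> (nat \<Rightarrow> nat) \<Rightarrow> 'a \<Rightarrow> 'a" where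
  "creation_word L t = foldr (\<lambda>i. Y i ^^ t i) L"

definition lower :: "nat \<Rightarrow> (nat \<Rightarrow> nat) \<Rightarrow> nat \<Rightarrow> nat" where
  "lower i t = t(i := t i - 1)"

lemma creation_word_simps [simp]: "creation_word [] t v = v" "creation_word (i # L) t v = (Y i ^^ t i) (creation_word L t v)"
  by (simp_all add: creation_word_def)

lemma Y_pow_scale: "(Y i ^^ k) (scale c v) = scale c ((Y i ^^ k) v)"
  by (induction k) (simp_all add: XYU_lin)

lemma Y_pow_zero: "(Y i ^^ k) 0 = 0"
  by (induction k) (simp_all add: XYU_zero)

lemma X_Y_pow:
  assumes "i \<in> {1..N}" "j \<in> {1..N}" "i \<noteq> j"
  shows "X i ((Y j ^^ k) v) = scale ((-1) ^ (phi_parity i * phi_parity j * k)) ((Y j ^^ k) (X i v))"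
proof (induction k)
  case (Suc k)
  have "X i (Y j w) = scale ((-1) ^ (phi_parity i * phi_parity j)) (Y j (X i w))" for w
    using XY_supercommute(2)[of i j] assms by simp
  then show ?case using Suc by (simp add: XYU_lin power_add)
qed simp

lemma U_Y_pow:
  assumes i: "i \<in> {1..N}" and j: "j \<in> {1..N}"
  shows "U i ((Y j ^^ k) v) = scale (inverse (U_weight i j) ^ k) ((Y j ^^ k) (U i v))"
proof (induction k)
  case (Suc k)
  have "U i (Y j w) = scale (inverse (U_weight i j)) (Y j (U i w))" for w
    using U_XY(2)[of i j] i j by simp
  then show ?case using Suc by (simp add: XYU_lin)
qed simp

lemma U_eigen_inverse:
  assumes "i \<in> {1..N}" "U i v = scale c v" "c \<noteq> 0"
  shows "U' i v = scale (inverse c) v"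
proof -
  have "U' i (U i v) = scale c (U' i v)" by (simp add: assms(2) XYU_lin)
  then have "v = scale c (U' i v)" using U'_U[OF assms(1), of v] by (simp add: A_one)
  then have "scale (inverse c) v = scale (inverse c) (scale c (U' i v))" by (rule arg_cong)
  also have "\<dots> = U' i v" using assms(3) by simp
  finally show ?thesis ..
qed

text \<open>On \<open>(Y i)\<^sup>l v\<close> the operator \<open>U i\<close> acts by \<open>q\<^sup>l\<close>: for a boson by the commutation rule, and for a
  fermion because only \<open>l = 0\<close> occurs. Then \<open>YX_XY\<close> yields the coefficient
  \<open>(q\<^sup>k - q\<^sup>-\<^sup>k) / (q - q\<^sup>-\<^sup>1)\<close> in both cases.\<close>

lemma X_Y_pow_same:
  assumes i: "i \<in> {1..N}" and v: "X i v = 0" "U i v = v" and k: "k > 0" "phi_parity i = Suc 0 \<Longrightarrow> k \<le> 1"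
  shows "\<exists>c. c \<noteq> 0 \<and> X i ((Y i ^^ k) v) = scale c ((Y i ^^ (k - 1)) v)"
proof -
  \<comment> \<open>With \<open>k = l + 1\<close>, the outermost \<open>Y i\<close> is the one that meets \<open>X i\<close>.\<close>
  obtain l where l: "k = Suc l" using k by (cases k) auto
  let ?d = "qq - inverse qq"
  have "inverse (U_weight i i) ^ l = qq ^ l"
    using phi_parity_cases[of i] k(2) sq_norm_eq[OF i] by (auto simp: U_weight_def l power_int_minus)
  then have U: "U i ((Y i ^^ l) v) = scale (qq ^ l) ((Y i ^^ l) v)"
    using U_Y_pow[OF i i, of l v] v by simp
  have U': "U' i ((Y i ^^ l) v) = scale (inverse (qq ^ l)) ((Y i ^^ l) v)"
    by (rule U_eigen_inverse[OF i U]) (simp add: qq_neq_0)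
  have "scale ?d (X i (Y i ((Y i ^^ l) v))) = scale (qq ^ k - inverse qq ^ k) ((Y i ^^ l) v)"
    unfolding YX_XY(2)[OF i] U U' by (simp add: l scale_left_diff_distrib power_inverse)
  then have "scale (inverse ?d) (scale ?d (X i ((Y i ^^ k) v))) =
      scale (inverse ?d * (qq ^ k - inverse qq ^ k)) ((Y i ^^ l) v)"
    by (simp add: l)
  then have "X i ((Y i ^^ k) v) = scale (inverse ?d * (qq ^ k - inverse qq ^ k)) ((Y i ^^ (k - 1)) v)"
    using qq_diff_neq_0 by (simp only: scale_scale left_inverse scale_one) (simp add: l)
  moreover have "qq ^ k \<noteq> inverse qq ^ k"
  proof
    assume "qq ^ k = inverse qq ^ k"
    then have "qq ^ k * qq ^ k = inverse qq ^ k * qq ^ k" by (rule arg_cong)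
    also have "\<dots> = 1" by (simp add: qq_neq_0 flip: power_mult_distrib)
    finally have "qq ^ k * qq ^ k = 1" .
    then have "q_half ^ (4 * k) = 1"
      by (simp add: qq_def power_mult[symmetric] power_add[symmetric])
    then show False using q_half_power_neq_1[of "4 * k"] k(1) by simp
  qed
  ultimately show ?thesis
    using qq_diff_neq_0 by (intro exI[of _ "inverse ?d * (qq ^ k - inverse qq ^ k)"]) simp
qed

lemma creation_word_fresh:
  assumes "set L \<subseteq> {1..N}" "i \<in> {1..N}" "i \<notin> set L"
  shows "X i (creation_word L t vac) = 0" "U i (creation_word L t vac) = creation_word L t vac"
proof -
  have "X i (creation_word L t vac) = 0 \<and> U i (creation_word L t vac) = creation_word L t vac"
    using assms
  proof (induction L)
    case Nil
    then show ?case using X_vac U_vac by simp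
  next
    case (Cons j L)
    then have j: "j \<in> {1..N}" "i \<noteq> j" by auto
    then have "U_weight i j = 1" by (simp add: U_weight_def)
    then show ?case
      using Cons X_Y_pow[OF Cons.prems(2) j] U_Y_pow[OF Cons.prems(2) j(1)] by (simp add: Y_pow_zero)
  qed
  then show "X i (creation_word L t vac) = 0" "U i (creation_word L t vac) = creation_word L t vac" by blast+
qed

lemma X_creation_word:
  assumes "set L \<subseteq> {1..N}" "distinct L" "i \<in> set L" "t \<in> occ m n r"
  shows "t i = 0 \<Longrightarrow> X i (creation_word L t vac) = 0"
    and "t i > 0 \<Longrightarrow> \<exists>c. c \<noteq> 0 \<and> X i (creation_word L t vac) = scale c (creation_word L (lower i t) vac)"
proof -
  have i: "i \<in> {1..N}" using assms by auto
  have cong: "creation_word L' (lower i t) v = creation_word L' t v" if "i \<notin> set L'" for L' v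
    using that by (induction L') (auto simp: lower_def)
  have lower: "lower i t i = t i - 1" "j \<noteq> i \<Longrightarrow> lower i t j = t j" for j
    by (simp_all add: lower_def)
  have pp1: "t i \<le> 1" if "phi_parity i = Suc 0"
    using assms(4) that i parPhi_eq[OF i] by (auto simp: occ_def Idx_def)
  show "X i (creation_word L t vac) = 0" if "t i = 0"
    using assms(1-3)
  proof (induction L)
    case (Cons j L)
    show ?case
    proof (cases "j = i")
      case True
      then show ?thesis using that Cons.prems creation_word_fresh(1)[of L i t] i by simp
    next
      case False
      then show ?thesis using Cons X_Y_pow[OF i, of j "t j"] by (simp add: Y_pow_zero)
    qed
  qed simp
  show "\<exists>c. c \<noteq> 0 \<and> X i (creation_word L t vac) = scale c (creation_word L (lower i t) vac)" if "t i > 0"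
    using assms(1-3)
  proof (induction L)
    case (Cons j L)
    show ?case
    proof (cases "j = i")
      case True
      then have "i \<notin> set L" "set L \<subseteq> {1..N}" using Cons.prems by auto
      then show ?thesis
        using X_Y_pow_same[OF i creation_word_fresh[OF _ i] that pp1] True by (simp add: cong lower)
    next
      case False
      then have j: "j \<in> {1..N}" and "i \<in> set L" "set L \<subseteq> {1..N}" "distinct L" using Cons.prems by auto
      then obtain c where c: "c \<noteq> 0" "X i (creation_word L t vac) = scale c (creation_word L (lower i t) vac)"
        using Cons.IH by blast
      then show ?thesis
        using X_Y_pow[OF i j, of "t j"] False
        by (intro exI[of _ "(-1) ^ (phi_parity i * phi_parity j * t j) * c"]) (simp add: Y_pow_scale lower(2))
    qed
  qed simp
qed

definition fock_vec :: "(nat \<Rightarrow> nat) \<Rightarrow> 'a" where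
  "fock_vec t = creation_word [1..<N + 1] t vac"

lemma X_fock_vec:
  assumes "i \<in> {1..N}" "t \<in> occ m n r"
  shows "t i = 0 \<Longrightarrow> X i (fock_vec t) = 0"
    and "t i > 0 \<Longrightarrow> \<exists>c. c \<noteq> 0 \<and> X i (fock_vec t) = scale c (fock_vec (lower i t))"
  unfolding fock_vec_def using assms by (intro X_creation_word; auto)+

lemma fock_vec_zero: "fock_vec (\<lambda>_. 0) = vac"
proof -
  have "creation_word L (\<lambda>_. 0) vac = vac" for L by (induction L) auto
  then show ?thesis by (simp add: fock_vec_def)
qed

text \<open>Induction on the total degree of the monomials. If some monomial contains \<open>Y i\<close>, then
  \<open>X i\<close> removes the monomials without \<open>Y i\<close> and shortens the others, keeping them distinct and their
  coefficients nonzero; otherwise only the vacuum is left. The argument is about formal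
  combinations of monomials.\<close>

lemma vac_mem:
  assumes W: "subspace W" and XW: "\<And>i w. i \<in> {1..N} \<Longrightarrow> w \<in> W \<Longrightarrow> X i w \<in> W"
    and T: "finite T" "T \<subseteq> occ m n r" "T \<noteq> {}" "\<And>t. t \<in> T \<Longrightarrow> c t \<noteq> 0"
    and mem: "(\<Sum>t\<in>T. scale (c t) (fock_vec t)) \<in> W"
  shows "vac \<in> W"
  using T mem
proof (induction "\<Sum>t\<in>T. \<Sum>i=1..N. t i" arbitrary: T c rule: less_induct)
  case less
  show ?case
  proof (cases "\<exists>t\<in>T. \<exists>i. t i > 0")
    case False
    then have "t = (\<lambda>_. 0)" if "t \<in> T" for t using that by auto
    then have "T = {\<lambda>_. 0}" using less.prems(3) by blast
    then have *: "scale (c (\<lambda>_. 0)) vac \<in> W" "c (\<lambda>_. 0) \<noteq> 0"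
      using less.prems(4,5) by (auto simp: fock_vec_zero)
    then have "scale (inverse (c (\<lambda>_. 0))) (scale (c (\<lambda>_. 0)) vac) \<in> W"
      using W subspace_scale by blast
    then show ?thesis using * by simp
  next
    case True
    then obtain t0 i where t0: "t0 \<in> T" "t0 i > 0" by blast
    have occ: "t \<in> occ m n r" if "t \<in> T" for t using that less.prems(2) by blast
    have i: "i \<in> {1..N}" using occ[OF t0(1)] t0(2) by (force simp: occ_def Idx_def)
    define T' where "T' = {t \<in> T. t i > 0}"
    have fin: "finite T'" "T' \<subseteq> T" "T' \<noteq> {}" using less.prems(1) t0 by (auto simp: T'_def)
    have "\<exists>\<gamma>. \<forall>t\<in>T'. \<gamma> t \<noteq> 0 \<and> X i (fock_vec t) = scale (\<gamma> t) (fock_vec (lower i t))"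
      using X_fock_vec(2)[OF i occ] by (intro bchoice) (auto simp: T'_def)
    then obtain \<gamma> where \<gamma>: "\<And>t. t \<in> T' \<Longrightarrow> \<gamma> t \<noteq> 0"
      "\<And>t. t \<in> T' \<Longrightarrow> X i (fock_vec t) = scale (\<gamma> t) (fock_vec (lower i t))" by blast
    have inj: "inj_on (lower i) T'"
    proof (rule inj_onI)
      fix s t assume st: "s \<in> T'" "t \<in> T'" "lower i s = lower i t"
      show "s = t"
      proof
        fix j
        show "s j = t j"
        proof (cases "j = i")
          case True
          have "s i - 1 = t i - 1" using fun_cong[OF st(3), of i] by (simp add: lower_def)
          moreover have "0 < s i" "0 < t i" using st(1,2) by (simp_all add: T'_def)
          ultimately show ?thesis unfolding True by linarith
        next
          case False
          then show ?thesis using fun_cong[OF st(3), of j] by (simp add: lower_def)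
        qed
      qed
    qed
    define c' where "c' s = c (the_inv_into T' (lower i) s) * \<gamma> (the_inv_into T' (lower i) s)" for s
    have c': "c' (lower i t) = c t * \<gamma> t" if "t \<in> T'" for t
      by (simp add: c'_def the_inv_into_f_f[OF inj that])
    have Xsum: "X i (\<Sum>t\<in>S. scale (c t) (fock_vec t)) = (\<Sum>t\<in>S. scale (c t) (X i (fock_vec t)))" if "finite S" for S
      using that by induction (simp_all add: XYU_lin XYU_zero)
    have "X i (\<Sum>t\<in>T. scale (c t) (fock_vec t)) = (\<Sum>t\<in>T. scale (c t) (X i (fock_vec t)))"
      by (rule Xsum[OF less.prems(1)])
    also have "\<dots> = (\<Sum>t\<in>T'. scale (c t) (X i (fock_vec t)))"
      by (rule sum.mono_neutral_right[OF less.prems(1) fin(2)])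
         (use X_fock_vec(1)[OF i occ] in \<open>auto simp: T'_def\<close>)
    also have "\<dots> = (\<Sum>t\<in>T'. scale (c' (lower i t)) (fock_vec (lower i t)))"
      by (rule sum.cong) (simp_all add: \<gamma> c')
    also have "\<dots> = (\<Sum>s\<in>lower i ` T'. scale (c' s) (fock_vec s))"
      by (simp add: sum.reindex[OF inj])
    finally have mem': "(\<Sum>s\<in>lower i ` T'. scale (c' s) (fock_vec s)) \<in> W"
      using XW[OF i less.prems(5)] by simp
    have deg: "(\<Sum>j=1..N. lower i t j) < (\<Sum>j=1..N. t j)" if "t \<in> T'" for t
      by (rule sum_strict_mono_ex1) (use that i in \<open>auto simp: lower_def T'_def\<close>)
    have "(\<Sum>s\<in>lower i ` T'. \<Sum>j=1..N. s j) = (\<Sum>t\<in>T'. \<Sum>j=1..N. lower i t j)"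
      by (simp add: sum.reindex[OF inj])
    also have "\<dots> < (\<Sum>t\<in>T'. \<Sum>j=1..N. t j)"
      by (rule sum_strict_mono[OF fin(1,3) deg])
    also have "\<dots> \<le> (\<Sum>t\<in>T. \<Sum>j=1..N. t j)"
      by (rule sum_mono2[OF less.prems(1) fin(2)]) simp
    finally have "(\<Sum>s\<in>lower i ` T'. \<Sum>j=1..N. s j) < (\<Sum>t\<in>T. \<Sum>j=1..N. t j)" .
    moreover have "lower i ` T' \<subseteq> occ m n r"
      using occ by (force simp: occ_def lower_def T'_def)
    moreover have "c' s \<noteq> 0" if "s \<in> lower i ` T'" for s
      using that c' \<gamma>(1) less.prems(4) by (auto simp: T'_def)
    ultimately show ?thesis
      using less.hyps[of "lower i ` T'" c'] fin mem' by simp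
  qed
qed

text \<open>Downward induction on \<open>i\<close>, starting from the index \<open>N + 1\<close>, where all four operators are the
  identity. With \<open>k = i + 1\<close>, the subspace is stable under \<open>X i \<circ> Y k\<close> (from \<open>e\<^sub>i\<close>) and under
  \<open>X k\<close>; since \<open>U k\<close> is a combination of \<open>X k \<circ> Y k\<close> and \<open>Y k \<circ> X k\<close>, it is stable under
  \<open>X i \<circ> U k\<close>, and \<open>U k\<close> is invertible on it. The operator \<open>Y i\<close> is obtained from \<open>f\<^sub>i\<close> in the same
  way, and \<open>U i\<close> from \<open>k\<^sub>i\<close>.\<close>

lemma Clifford_invariant:
  assumes W: "subspace W"
    and inv: "\<And>i w. i \<in> {1..N} \<Longrightarrow> w \<in> W \<Longrightarrow>
      A (img (GE i)) w \<in> W \<and> A (img (GF i)) w \<in> W \<and> A (img (GK i)) w \<in> W \<and> A (img (GKinv i)) w \<in> W"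
    and i: "i \<in> {1..N + 1}"
  shows "\<forall>w\<in>W. X i w \<in> W \<and> Y i w \<in> W \<and> U i w \<in> W \<and> U' i w \<in> W"
proof -
  have "i \<le> N + 1" using i by simp
  then show ?thesis using i
  proof (induction rule: inc_induct)
    case base
    have "N + 1 \<notin> {1..N}" by simp
    then show ?case using outside_range[of "N + 1"] by (simp add: A_one)
  next
    case (step i)
    obtain k where k: "k = Suc i" by blast
    have iN: "i \<in> {1..N}" and I: "i \<in> {1..N + 1}" "k \<in> {1..N + 1}" and ik: "i \<noteq> k" using step k by auto
    have kW: "X k w \<in> W" "Y k w \<in> W" "U k w \<in> W" "U' k w \<in> W" if "w \<in> W" for w
      using step.IH I that k by blast+
    have sc: "scale c w \<in> W" if "w \<in> W" for c w using W that by (rule subspace_scale)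
    have unsc: "w \<in> W" if "scale c w \<in> W" "c \<noteq> 0" for c w
      using sc[OF that(1), of "inverse c"] that(2) by simp
    have e_coeff: "e_coeff i \<noteq> 0"
    proof -
      have "q_half - inverse q_half \<noteq> 0"
        by (rule diff_inverse_neq_0) (use q_half_neq_0 q_half_power_neq_1 in auto)
      moreover have "im_unit \<noteq> 0" using k_coeff_neq_0[of N] by (auto simp: k_coeff_def)
      ultimately show ?thesis by (simp add: e_coeff_def)
    qed
    have EFK: "scale (e_coeff i) (X i (Y k w)) \<in> W" "X k (Y i w) \<in> W"
      "scale (k_coeff i) (U i (U' k w)) \<in> W" "scale (inverse (k_coeff i)) (U k (U' i w)) \<in> W"
      if "w \<in> W" for w
      using inv[OF iN that] unfolding img_GE[OF iN] img_GF[OF iN] img_GK[OF iN] k by blast+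
    have E: "X i (Y k w) \<in> W" and F: "X k (Y i w) \<in> W" if "w \<in> W" for w
      using unsc[OF EFK(1)[OF that] e_coeff] EFK(2)[OF that] by blast+
    have K: "U i (U' k w) \<in> W" "U k (U' i w) \<in> W" if "w \<in> W" for w
      using unsc[OF EFK(3)[OF that] k_coeff_neq_0] unsc[OF EFK(4)[OF that]] k_coeff_neq_0[of i] by auto
    have cancel: "U k (U' k w) = w" "U' k (U k w) = w" for w by (simp_all add: U_inverse A_one)
    have X: "X i w \<in> W" if w: "w \<in> W" for w
    proof (cases "k \<in> {1..N}")
      case False
      then show ?thesis using E[OF w] by (simp add: outside_range[OF False] A_one)
    next
      case True
      let ?w = "U' k w"
      have w': "?w \<in> W" using kW w by blast
      have "X k (X i (Y k ?w)) \<in> W" using kW(1) E w' by blast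
      moreover have "X i (X k (Y k ?w)) = scale ((-1) ^ (phi_parity i * phi_parity k)) (X k (X i (Y k ?w)))"
        by (rule XY_supercommute(1)[OF I ik])
      ultimately have 1: "X i (X k (Y k ?w)) \<in> W" using sc by simp
      have 2: "X i (Y k (X k ?w)) \<in> W" using E kW(1) w' by blast
      have "U k ?w = X k (Y k ?w) - scale ((-1) ^ phi_parity k * inverse qq) (Y k (X k ?w))"
        using XY_U[OF True, of ?w] by simp
      then have "X i (U k ?w) = X i (X k (Y k ?w)) - scale ((-1) ^ phi_parity k * inverse qq) (X i (Y k (X k ?w)))"
        by (simp only: XYU_lin)
      also have "\<dots> \<in> W" using subspace_diff[OF W 1 sc[OF 2]] .
      finally show ?thesis by (simp only: cancel)
    qed
    have Y: "Y i w \<in> W" if w: "w \<in> W" for w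
    proof (cases "k \<in> {1..N}")
      case False
      then show ?thesis using F[OF w] by (simp add: outside_range[OF False] A_one)
    next
      case True
      let ?w = "U' k w"
      have w': "?w \<in> W" using kW w by blast
      have "X k (Y i (Y k ?w)) \<in> W" using F kW(2) w' by blast
      moreover have "Y i (X k (Y k ?w)) = scale ((-1) ^ (phi_parity i * phi_parity k)) (X k (Y i (Y k ?w)))"
        by (rule XY_supercommute(3)[OF I ik])
      ultimately have 1: "Y i (X k (Y k ?w)) \<in> W" using sc by simp
      have "Y k (X k (Y i ?w)) \<in> W" using F kW(2) w' by blast
      moreover have "Y i (Y k (X k ?w)) = Y k (X k (Y i ?w))"
        unfolding XY_supercommute(4)[OF I ik] XY_supercommute(3)[OF I ik] XYU_lin by (simp flip: power_add)
      ultimately have 2: "Y i (Y k (X k ?w)) \<in> W" by simp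
      have "U k ?w = X k (Y k ?w) - scale ((-1) ^ phi_parity k * inverse qq) (Y k (X k ?w))"
        using XY_U[OF True, of ?w] by simp
      then have "Y i (U k ?w) = Y i (X k (Y k ?w)) - scale ((-1) ^ phi_parity k * inverse qq) (Y i (Y k (X k ?w)))"
        by (simp only: XYU_lin)
      also have "\<dots> \<in> W" using subspace_diff[OF W 1 sc[OF 2]] .
      finally show ?thesis by (simp only: cancel)
    qed
    have U: "U i w \<in> W" if w: "w \<in> W" for w
      using K(1)[OF kW(3)[OF w]] by (simp only: cancel)
    have U': "U' i w \<in> W" if w: "w \<in> W" for w
      using kW(4)[OF K(2)[OF w]] by (simp only: cancel)
    show ?case using X Y U U' by blast
  qed
qed

theorem invariant_subspace_trivial:
  assumes W: "subspace W"
    and inv: "\<And>i w. i \<in> {1..N} \<Longrightarrow> w \<in> W \<Longrightarrow>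
      A (img (GE i)) w \<in> W \<and> A (img (GF i)) w \<in> W \<and> A (img (GK i)) w \<in> W \<and> A (img (GKinv i)) w \<in> W"
    and span: "span (fock_vec ` occ m n r) = UNIV"
  shows "W = {0} \<or> W = UNIV"
proof (cases "W = {0}")
  case False
  have XYW: "X i w \<in> W" "Y i w \<in> W" if "i \<in> {1..N}" "w \<in> W" for i w
    using Clifford_invariant[OF W inv, of i] that by auto
  obtain w where w: "w \<in> W" "w \<noteq> 0" using False subspace_0[OF W] by blast
  have "w \<in> span (fock_vec ` occ m n r)" by (simp add: span)
  then obtain S u where S: "finite S" "S \<subseteq> fock_vec ` occ m n r" "w = (\<Sum>a\<in>S. scale (u a) a)"
    unfolding span_explicit by blast
  obtain T0 where T0: "T0 \<subseteq> occ m n r" "inj_on fock_vec T0" "S = fock_vec ` T0"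
    using S(2) by (metis subset_image_inj)
  have fin: "finite T0" using S(1) T0 finite_imageD by blast
  define T where "T = {t \<in> T0. u (fock_vec t) \<noteq> 0}"
  have "w = (\<Sum>t\<in>T0. scale (u (fock_vec t)) (fock_vec t))"
    by (simp add: S(3) T0(3) sum.reindex[OF T0(2)])
  also have "\<dots> = (\<Sum>t\<in>T. scale (u (fock_vec t)) (fock_vec t))"
    by (rule sum.mono_neutral_right[OF fin]) (auto simp: T_def)
  finally have wT: "w = (\<Sum>t\<in>T. scale (u (fock_vec t)) (fock_vec t))" .
  have "T \<noteq> {}" using w(2) unfolding wT by fastforce
  moreover have "(\<Sum>t\<in>T. scale (u (fock_vec t)) (fock_vec t)) \<in> W" using w(1) by (simp only: wT)
  moreover have "finite T" "T \<subseteq> occ m n r" using fin T0(1) by (auto simp: T_def)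
  moreover have "u (fock_vec t) \<noteq> 0" if "t \<in> T" for t using that by (simp add: T_def)
  ultimately have vac: "vac \<in> W"
    using vac_mem[of W T "\<lambda>t. u (fock_vec t)"] W XYW(1) by blast
  have "creation_word L t vac \<in> W" if "set L \<subseteq> {1..N}" for L t
    using that
  proof (induction L)
    case (Cons i L)
    have "(Y i ^^ k) v \<in> W" if "v \<in> W" for k v
      using that Cons.prems XYW(2) by (induction k) auto
    then show ?case using Cons by simp
  qed (simp add: vac)
  moreover have "set [1..<N + 1] \<subseteq> {1..N}" by auto
  ultimately have "fock_vec t \<in> W" for t unfolding fock_vec_def by blast
  then have "fock_vec ` occ m n r \<subseteq> W" by blast
  then have "W = UNIV" using span_minimal[OF _ W] span by blast
  then show ?thesis ..
qed simp

end

section \<open>The spinor representation\<close>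

lemma presentation_cl: "presentation (cl_gens m n) (cl_rels m n r)"
proof
  show "cl_rels m n r \<subseteq> carrier (free_alg (cl_gens m n))"
    unfolding cl_rels_def
    by (auto intro!: free_alg_closed simp: cl_gens_def)
qed

lemma presentation_osp: "presentation (osp_gens m n) (osp_rels m n r)"
proof
  let ?C = "carrier (free_alg (osp_gens m n))"
  have serre: "serre_rels m n r g \<subseteq> ?C" if g: "\<And>i. i \<in> Idx m n \<Longrightarrow> g i \<in> ?C" for g
  proof -
    have T: "i \<in> Idx m n" if "i \<in> Theta m n r" for i using that by (simp add: Theta_def)
    have s1: "serre p N x y \<in> ?C" and s2: "serre' p N t x y \<in> ?C" if "x \<in> ?C" "y \<in> ?C" for p N t x y
      unfolding serre_def serre'_def using that by (auto intro!: free_alg_closed)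
    have h: "higher m n r g (s - 1) s (s + 1) \<in> ?C" "g s \<in> ?C" if "1 < s" "s + 1 \<le> m + n" for s
    proof -
      have I: "g (s - 1) \<in> ?C" "g s \<in> ?C" "g (s + 1) \<in> ?C" using that by (auto intro!: g simp: Idx_def)
      then show "higher m n r g (s - 1) s (s + 1) \<in> ?C" "g s \<in> ?C"
        unfolding higher_def Let_def by (auto intro!: free_alg_closed)
    qed
    have h': "higher m n r g (s - Suc 0) s (m + n) \<in> ?C" "g s \<in> ?C" if "Suc 0 < s" "Suc s = m + n" for s
      using h[of s] that by simp_all
    show ?thesis
      unfolding serre_rels_def
      using s1 s2 g T h h' by (auto intro!: free_alg_closed)
  qed
  show "osp_rels m n r \<subseteq> ?C"
    unfolding osp_rels_def
    using serre[of "\<lambda>i. gen (GE i)"] serre[of "\<lambda>i. gen (GF i)"]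
    by (auto intro!: free_alg_closed simp: osp_gens_def)
qed

lemma spinor_img_closed:
  assumes "g \<in> osp_gens m n"
  shows "spinor_img m n r g \<in> carrier (free_alg (cl_gens m n))"
  using assms
  by (auto simp: osp_gens_def cl_gens_def Idx_def intro!: free_alg_closed)

context ordered_basis
begin

text \<open>Here the relations, known for operators in any Clifford module, are transferred to the
  algebra itself by means of the faithful module \<open>ex_faithful_rep\<close>.\<close>

lemma osp_rels_in_ideal:
  assumes "x \<in> osp_rels m n r"
  shows "free_ext (spinor_img m n r) x \<in> rel_ideal (cl_gens m n) (cl_rels m n r)"
proof -
  interpret P: presentation "cl_gens m n" "cl_rels m n r" by (rule presentation_cl)
  interpret Q: presentation "osp_gens m n" "osp_rels m n r" by (rule presentation_osp)
  obtain A :: "cl_gen free \<Rightarrow> cl_gen free \<Rightarrow> cl_gen free" where A: "free_rep (*\<^sub>k) A"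
    and R: "\<forall>x\<in>cl_rels m n r. \<forall>z. A x z = 0"
    and J: "\<forall>x\<in>carrier (free_alg (cl_gens m n)). (\<forall>z. A x z = 0) \<longrightarrow> x \<in> P.J"
    using P.ex_faithful_rep by blast
  interpret A: free_rep "(*\<^sub>k)" A by (rule A)
  interpret cl_rep m n r "(*\<^sub>k)" A by unfold_locales (use R in blast)
  have "free_ext (spinor_img m n r) x \<in> carrier (free_alg (cl_gens m n))"
    using assms Q.rels spinor_img_closed by (intro free_ext_closed[of "osp_gens m n"]) auto
  then show ?thesis using J osp_rels_vanish[OF assms] by blast
qed

lemma spinor_hom_gen:
  assumes "g \<in> osp_gens m n"
  shows "spinor_hom m n r (osp_cls m n r g) = cl_cls m n r (spinor_img m n r g)"
  unfolding spinor_hom_def osp_cls_def cl_cls_def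
  using pres_hom_universal(1)[OF presentation_osp presentation_cl spinor_img_closed osp_rels_in_ideal
      free_alg_closed(9)[OF assms]]
  by (simp only: free_ext_gen)

lemma spinor_hom_alg_hom: "spinor_hom m n r \<in> alg_hom (Uq_osp m n r) (Cl_q m n r)"
  unfolding spinor_hom_def Uq_osp_def Cl_q_def
  by (rule pres_hom_universal(2)[OF presentation_osp presentation_cl spinor_img_closed osp_rels_in_ideal])

end

lemma alg_hom_comp:
  assumes "f \<in> alg_hom A B" "g \<in> alg_hom B C"
  shows "g \<circ> f \<in> alg_hom A C"
  using assms ring_hom_trans[of f A B g C] ring_hom_closed[of f A B]
  by (auto simp: alg_hom_def)

theorem proposition3p8:
  fixes m n :: nat and r :: "(bvec \<times> bvec) set"
    and scale :: "kq \<Rightarrow> 'v::ab_group_add \<Rightarrow> 'v"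
    and \<rho> :: "cl_gen free set \<Rightarrow> 'v \<Rightarrow> 'v" and vac :: 'v
  assumes "m \<ge> 1" and "n \<ge> 1"
    and "admissible_order m n r"
    and "fock_space m n r scale \<rho> vac"
  shows "irreducible_module (Uq_osp m n r) scale (spinor_rep m n r \<rho>) \<and>
    highest_weight_vector m n r scale (spinor_rep m n r \<rho>) vac
      (\<lambda>i. if i < m + n then - ((-1) ^ parPhi m n r (i + 1)) else im_unit * q_half)"
proof -
  interpret ordered_basis m n r by unfold_locales fact+
  interpret P: presentation "cl_gens m n" "cl_rels m n r" by (rule presentation_cl)
  interpret Q: presentation "osp_gens m n" "osp_rels m n r" by (rule presentation_osp)
  have mod: "alg_module (pres_alg (cl_gens m n) (cl_rels m n r)) scale \<rho>"
    and fock: "\<And>i. i \<in> {1..N} \<Longrightarrow> \<rho> (cl_cls m n r (gen (GPhi i))) vac = 0"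
      "\<And>i. i \<in> {1..N} \<Longrightarrow> \<rho> (cl_cls m n r (gen (GU i))) vac = vac"
    and indep: "\<not> Modules.module.dependent scale (ket m n r \<rho> vac ` occ m n r)"
    and span: "Modules.module.span scale (ket m n r \<rho> vac ` occ m n r) = UNIV"
    using assms(4) by (auto simp: fock_space_def Cl_q_def Idx_def)
  define A where "A x = \<rho> (cls (cl_gens m n) (cl_rels m n r) (retract (cl_gens m n) x))" for x
  note A = P.module_free_rep[OF mod, folded A_def]
  have clA: "\<rho> (cl_cls m n r x) = A x" if "x \<in> carrier (free_alg (cl_gens m n))" for x
    using A(4)[OF that] by (simp add: cl_cls_def)
  have g: "gen (GPhi i) \<in> carrier (free_alg (cl_gens m n))" "gen (GPhiD i) \<in> carrier (free_alg (cl_gens m n))"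
    "gen (GU i) \<in> carrier (free_alg (cl_gens m n))" if "i \<in> {1..N}" for i
    using that by (auto intro!: free_alg_closed simp: cl_gens_def Idx_def)
  interpret free_rep scale A by (rule A(1))
  interpret cl_rep m n r scale A by unfold_locales (rule A(3))
  interpret fock m n r scale A vac
    by unfold_locales (simp_all add: A(2) fock clA[OF g(1), symmetric] clA[OF g(3), symmetric] flip: XYU_gen)
  have ket: "ket m n r \<rho> vac t = fock_vec t" for t
  proof -
    have p: "A (gen (GPhiD i) ^ k) v = (Y i ^^ k) v" if "i \<in> {1..N}" for i k v
      by (induction k arbitrary: v) (simp_all add: A_one rep_mult XYU_gen[OF that])
    have "A (prod_list (map (\<lambda>i. gen (GPhiD i) ^ t i) L)) v = creation_word L t v" if "set L \<subseteq> {1..N}" for L v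
      using that by (induction L) (simp_all add: A_one rep_mult p)
    moreover have "set [1..<N + 1] \<subseteq> {1..N}" by auto
    ultimately have "A (prod_list (map (\<lambda>i. gen (GPhiD i) ^ t i) [1..<N + 1])) vac = fock_vec t"
      unfolding fock_vec_def by blast
    moreover have "prod_list (map (\<lambda>i. gen (GPhiD i) ^ t i) [1..<N + 1]) \<in> carrier (free_alg (cl_gens m n))"
      by (rule free_alg_closed(11)) (auto intro!: free_alg_closed(8) g(2) simp del: upt_Suc)
    ultimately show ?thesis unfolding ket_def by (simp only: clA)
  qed
  then have ket_image: "ket m n r \<rho> vac ` occ m n r = fock_vec ` occ m n r" by simp
  have "(\<lambda>_. 0) \<in> occ m n r" by (simp add: occ_def)
  then have "vac \<in> fock_vec ` occ m n r" by (rule rev_image_eqI) (rule fock_vec_zero[symmetric])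
  then have vac: "vac \<noteq> 0"
    using indep[unfolded ket_image] dependent_zero[of "fock_vec ` occ m n r"] by metis
  have rep_gen: "spinor_rep m n r \<rho> (osp_cls m n r x) = A (img x)" if "x \<in> osp_gens m n" for x
    using spinor_hom_gen[OF that] clA[OF spinor_img_closed[OF that]] by (simp add: spinor_rep_def)
  have gens: "GE i \<in> osp_gens m n" "GF i \<in> osp_gens m n" "GK i \<in> osp_gens m n" "GKinv i \<in> osp_gens m n"
    if "i \<in> {1..N}" for i using that by (auto simp: osp_gens_def Idx_def)
  have cls_carrier: "osp_cls m n r x \<in> carrier (Uq_osp m n r)" if "x \<in> osp_gens m n" for x
    using that by (auto simp: Uq_osp_def osp_cls_def Q.carrier_pres intro!: free_alg_closed)
  have "irreducible_module (Uq_osp m n r) scale (spinor_rep m n r \<rho>)"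
    unfolding irreducible_module_def
  proof (intro conjI allI impI)
    show "alg_module (Uq_osp m n r) scale (spinor_rep m n r \<rho>)"
      using alg_hom_comp[OF spinor_hom_alg_hom] mod
      unfolding alg_module_def spinor_rep_def Cl_q_def by blast
    show "(UNIV :: 'v set) \<noteq> {0}" using vac by blast
    fix W assume W: "subspace W \<and> (\<forall>x\<in>carrier (Uq_osp m n r). \<forall>w\<in>W. spinor_rep m n r \<rho> x w \<in> W)"
    have "A (img x) w \<in> W" if "x \<in> osp_gens m n" "w \<in> W" for x w
      using W cls_carrier[OF that(1)] that(2) rep_gen[OF that(1)] by metis
    then show "W = {0} \<or> W = UNIV"
      using W gens span[unfolded ket_image] by (intro invariant_subspace_trivial) blast+
  qed
  moreover have "highest_weight_vector m n r scale (spinor_rep m n r \<rho>) vac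
      (\<lambda>i. if i < m + n then - ((-1) ^ parPhi m n r (i + 1)) else im_unit * q_half)"
    unfolding highest_weight_vector_def
  proof (intro conjI ballI vac)
    fix i assume "i \<in> Idx m n"
    then have i: "i \<in> {1..N}" by (simp add: Idx_def)
    then have I: "i \<in> {1..N + 1}" "Suc i \<in> {1..N + 1}" by auto
    have "X i (Y (Suc i) vac) = 0"
      by (simp add: XY_supercommute(2)[OF I] X_vac[OF i] XYU_zero)
    then show "spinor_rep m n r \<rho> (osp_cls m n r (GE i)) vac = 0"
      unfolding rep_gen[OF gens(1)[OF i]] img_GE[OF i] by simp
    have "U' (Suc i) vac = vac"
    proof (cases "Suc i \<in> {1..N}")
      case True
      show ?thesis using U_eigen_inverse[OF True, of vac 1] U_vac[OF True] by simp
    next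
      case False
      show ?thesis by (simp add: outside_range[OF False] A_one)
    qed
    moreover have "k_coeff i = (if i < m + n then - ((-1) ^ parPhi m n r (i + 1)) else im_unit * q_half)"
      using i parPhi_eq[of "Suc i"] by (auto simp: k_coeff_def)
    ultimately show "spinor_rep m n r \<rho> (osp_cls m n r (GK i)) vac =
        scale (if i < m + n then - ((-1) ^ parPhi m n r (i + 1)) else im_unit * q_half) vac"
      unfolding rep_gen[OF gens(3)[OF i]] img_GK[OF i] by (simp add: U_vac[OF i])
  qed
  ultimately show ?thesis ..
qed

end
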